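(* Let $p$ be a prime and $\mathbf{F}$ a field of characteristic $p$. For $m>2$, the Noether number of $\mathbf{F}[m\,V_2]^{SL_2(\mathbf{F}_p)}$ is less than or equal to $(p+m-2)(p-1)$. For $m=2$ and $p>2$, the Noether number is $p(p-1)$, and for $m=2$, $p=2$, the Noether number is $p+1=3$.
   Context: $V_2$ is the defining 2-dimensional representation of $SL_2(\mathbf{F}_p)$ over $\mathbf{F}$, and $SL_2(\mathbf{F}_p)$ acts diagonally on the direct sum $m\,V_2$ of $m$ copies; $\mathbf{F}[m\,V_2]=\mathbf{F}[x_1,y_1,\dots,x_m,y_m]$ is the symmetric algebra on $(m\,V_2)^*$, with the induced action by algebra automorphisms and the standard grading. The Noether number of a ring of invariants is the least integer $n$ such that the ring is generated as an $\mathbf{F}$-algebra by homogeneous elements of degree at most $n$. *)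

theory Defs
  imports "HOL-Analysis.Analysis" "HOL-Library.Poly_Mapping" "HOL-Library.Extended_Nat"
begin

text \<open>
  Polynomials with coefficients in \<open>'a\<close> and variables in \<open>'v\<close>, as finitely supported functions
  on exponent vectors (with the convolution product of \<open>HOL-Library.Poly_Mapping\<close>).
\<close>

type_synonym ('v, 'a) mpoly = "('v \<Rightarrow>\<^sub>0 nat) \<Rightarrow>\<^sub>0 'a"

definition const_poly :: "'a::zero \<Rightarrow> ('v, 'a) mpoly" where
  "const_poly c = Poly_Mapping.single 0 c"

definition var_poly :: "'v \<Rightarrow> ('v, 'a::zero_neq_one) mpoly" where
  "var_poly v = Poly_Mapping.single (Poly_Mapping.single v 1) 1"

definition subst_poly :: "('v \<Rightarrow> ('w, 'a) mpoly) \<Rightarrow> ('v, 'a::comm_semiring_1) mpoly \<Rightarrow> ('w, 'a) mpoly" where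
  "subst_poly \<sigma> f = (\<Sum>t\<in>Poly_Mapping.keys f. const_poly (Poly_Mapping.lookup f t) *
     (\<Prod>v\<in>Poly_Mapping.keys t. \<sigma> v ^ Poly_Mapping.lookup t v))"

definition mono_degree :: "('v \<Rightarrow>\<^sub>0 nat) \<Rightarrow> nat" where
  "mono_degree t = (\<Sum>v\<in>Poly_Mapping.keys t. Poly_Mapping.lookup t v)"

definition homogeneous_of_degree :: "nat \<Rightarrow> ('v, 'a::zero) mpoly \<Rightarrow> bool" where
  "homogeneous_of_degree d f \<longleftrightarrow> (\<forall>t\<in>Poly_Mapping.keys f. mono_degree t = d)"

text \<open>The subalgebra (over the coefficient field) generated by a set of polynomials.\<close>

inductive_set generated_algebra :: "('v, 'a::comm_semiring_1) mpoly set \<Rightarrow> ('v, 'a) mpoly set"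
  for S where
  gen: "f \<in> S \<Longrightarrow> f \<in> generated_algebra S"
| const: "const_poly c \<in> generated_algebra S"
| add: "f \<in> generated_algebra S \<Longrightarrow> g \<in> generated_algebra S \<Longrightarrow> f + g \<in> generated_algebra S"
| mult: "f \<in> generated_algebra S \<Longrightarrow> g \<in> generated_algebra S \<Longrightarrow> f * g \<in> generated_algebra S"

definition generated_in_degrees_upto :: "('v, 'a::comm_semiring_1) mpoly set \<Rightarrow> nat \<Rightarrow> bool" where
  "generated_in_degrees_upto R n \<longleftrightarrow>
     (\<exists>S. (\<forall>f\<in>S. \<exists>d\<le>n. homogeneous_of_degree d f) \<and> generated_algebra S = R)"

text \<open>
  The value is taken in \<^typ>\<open>enat\<close> so that it is \<open>\<infinity>\<close>, rather than an unspecified number, when no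
  degree bound exists; if one exists, the infimum is attained and is the least such bound.
\<close>

definition noether_number :: "('v, 'a::comm_semiring_1) mpoly set \<Rightarrow> enat" where
  "noether_number R = Inf (enat ` {n. generated_in_degrees_upto R n})"

text \<open>
  If \<open>'a\<close> has prime characteristic \<open>p\<close>, its unique subfield with \<open>p\<close> elements is the image of the
  integers, so \<open>SL2_prime\<close> is $SL_2(\mathbf{F}_p)$, acting on $V_2$ = \<^typ>\<open>'a^2\<close> by \<open>*v\<close>.
\<close>

definition SL2_prime :: "('a::field^2^2) set" where
  "SL2_prime = {g. (\<forall>i j. g $ i $ j \<in> range of_int) \<and> det g = 1}"

text \<open>
  The polynomial ring on $m\,V_2$: for \<open>i < m\<close> the variables \<open>(i, 1)\<close> and \<open>(i, 2)\<close> are the two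
  coordinate functions $x_{i+1}, y_{i+1}$ on the copy of $V_2$ with index \<open>i\<close>.
\<close>

definition poly_ring_mV2 :: "nat \<Rightarrow> (nat \<times> 2, 'a::field) mpoly set" where
  "poly_ring_mV2 m = {f. \<forall>t\<in>Poly_Mapping.keys f. Poly_Mapping.keys t \<subseteq> {..<m} \<times> UNIV}"

text \<open>
  On the dual space, \<open>g\<close> sends a functional $\phi$ to $\phi \circ g^{-1}$; hence it sends the
  coordinate function $v \mapsto v_k$ to $v \mapsto \sum_l (g^{-1})_{kl} v_l$, on every copy of
  $V_2$. This is extended to an algebra automorphism by substitution.
\<close>

definition diag_action :: "'a::field^2^2 \<Rightarrow> (nat \<times> 2, 'a) mpoly \<Rightarrow> (nat \<times> 2, 'a) mpoly" where
  "diag_action g = subst_poly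
     (\<lambda>(i, k). \<Sum>l\<in>UNIV. const_poly (matrix_inv g $ k $ l) * var_poly (i, l))"

definition SL2_invariants :: "nat \<Rightarrow> (nat \<times> 2, 'a::field) mpoly set" where
  "SL2_invariants m = {f \<in> poly_ring_mV2 m. \<forall>g\<in>SL2_prime. diag_action g f = f}"

end

theory Submission
  imports Defs
begin

text \<open>
  Let $G = SL_2(\mathbf{F}_p)$ and let $P$ be the subgroup of the maps $y_i \mapsto y_i + t x_i$.
  Since $[G : P] = p^2 - 1$ is invertible, the relative transfer from $P$-invariants to
  $G$-invariants is onto and linear over the $G$-invariants, so it suffices to generate the
  $P$-invariants modulo the ideal of the $G$-invariants of small degree.

  Every $P$-invariant is a combination of multiples of the minors $u_{ij} = x_i y_j - x_j y_i$, of
  monomials in the $x_i$ and the norms $N_i = y_i^p - x_i^{p-1} y_i$, and of transfers from the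
  trivial group. If the degree in some copy of $V_2$ is at least $p - 1$, interpolation along the
  lines $y_i = -s x_i$ splits off a transfer and a multiple of $N_i$; otherwise the Capelli identity
  for the copies $0$ and $i$ has invertible coefficients and shifts degree into the copy $0$.

  Modulo the minors and the invariants $x_i y_j^p - x_j^p y_i$ one has $x_i N_j \equiv 0$, and for
  $|c| = p - 1$ the polarized Dickson invariants give $N^c \equiv -x^{pc}$. Transfers of monomials
  containing an $x_i$ reduce to monomials in the $x_i$, and a monomial in the $x_i$, or the transfer
  of one in the $y_i$, survives the relative transfer only if its degree is divisible by $p - 1$.
  Beyond $(p + m - 2)(p - 1)$ such a degree forces a factor $x^{pc}$ (respectively $y^{pc}$) by
  the pigeonhole principle.

  For the lower bounds, a $G$-invariant that contains $y_0^e$ with $e > 0$ has $p (p - 1) \mid e$,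
  and $G$ has no invariants of degree $1$; so for $p = 2$ the invariants of degree at most $2$
  generate only even degrees.
\<close>

subsection \<open>Polynomials and substitutions\<close>

text \<open>The bound is where the pigeonhole principle becomes exact. On m indices, p(p - 2) + m(p
  - 1) is the largest size of a multiset from which one cannot take p - 1 times p equal elements;
  one more is (p + m - 1)(p - 1), the first multiple of p - 1 beyond (p + m - 2)(p - 1). The factor
  x^{pc} found in this way helps because it leaves a remainder: in x^{pc} x^a with a nonzero, the
  Dickson relation trades x^{pc} for -N^c, and N^c x^a is then annihilated by the relations x_i N_j
  = 0. For m \<ge> 2 the last degree lies within the bound; p + 1 exceeds it only for p = m = 2,
  whence the exceptional value. The structure of the P-invariants is worked out with infinitely many
  copies of V_2. Setting the surplus variables to 0 commutes with the group, and m enters only with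
  the degree bound.\<close>

lemma lookup_single_if:
  "Poly_Mapping.lookup (Poly_Mapping.single s c) t = (if t = s then c else 0)"
  by (auto simp: lookup_single)

lemma mpoly_monomial_sum:
  "f = (\<Sum>t\<in>Poly_Mapping.keys f. Poly_Mapping.single t (Poly_Mapping.lookup f t))"
  by (rule poly_mapping_eqI)
    (auto simp: lookup_sum lookup_single_if in_keys_iff)

lemma mpoly_induct [case_names single add]:
  fixes f :: "('v, 'a::comm_monoid_add) mpoly"
  assumes s: "\<And>t c. P (Poly_Mapping.single t c)"
    and a: "\<And>f g. P f \<Longrightarrow> P g \<Longrightarrow> P (f + g)"
  shows "P f"
proof -
  have "P (\<Sum>t\<in>T. Poly_Mapping.single t (Poly_Mapping.lookup f t))" if "finite T" for T
    using that
  proof (induction T)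
    case empty
    then show ?case using s[of 0 0] by simp
  next
    case (insert x F)
    then show ?case by (simp add: s a)
  qed
  from this[of "Poly_Mapping.keys f"] show ?thesis
    using mpoly_monomial_sum[of f] by simp
qed

lemma single_split:
  assumes "v \<in> Poly_Mapping.keys (t :: 'v \<Rightarrow>\<^sub>0 nat)"
  shows "Poly_Mapping.single v 1 + (t - Poly_Mapping.single v 1) = t"
  using assms
  by (intro poly_mapping_eqI) (auto simp: lookup_add lookup_minus lookup_single_if in_keys_iff)

lemma mono_degree_eq:
  assumes "finite V" "Poly_Mapping.keys t \<subseteq> V"
  shows "mono_degree t = (\<Sum>v\<in>V. Poly_Mapping.lookup t v)"
  unfolding mono_degree_def using assms
  by (intro sum.mono_neutral_left) (auto simp: in_keys_iff)

lemma keys_nat_add: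
  "Poly_Mapping.keys (s + t) = Poly_Mapping.keys s \<union> Poly_Mapping.keys (t :: 'v \<Rightarrow>\<^sub>0 nat)"
  by (auto simp: in_keys_iff lookup_add)

lemma mono_degree_add: "mono_degree (s + t) = mono_degree s + mono_degree t"
proof -
  have "mono_degree (s + t) = (\<Sum>v\<in>Poly_Mapping.keys s \<union> Poly_Mapping.keys t. Poly_Mapping.lookup
    (s + t) v)"
    by (rule mono_degree_eq) (auto simp: keys_nat_add)
  also have "\<dots> = mono_degree s + mono_degree t"
    by (simp add: lookup_add sum.distrib mono_degree_eq[of "Poly_Mapping.keys s \<union>
      Poly_Mapping.keys t"])
  finally show ?thesis .
qed

lemma mono_degree_0 [simp]: "mono_degree 0 = 0"
  by (simp add: mono_degree_def)

lemma mono_degree_single [simp]: "mono_degree (Poly_Mapping.single v n) = n"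
  by (simp add: mono_degree_def)

lemma mono_induct [case_names zero add]:
  fixes t :: "'v \<Rightarrow>\<^sub>0 nat"
  assumes z: "P 0" and a: "\<And>v t. P t \<Longrightarrow> P (Poly_Mapping.single v 1 + t)"
  shows "P t"
proof (induction "mono_degree t" arbitrary: t rule: less_induct)
  case less
  show ?case
  proof (cases "Poly_Mapping.keys t = {}")
    case True
    then show ?thesis using z by simp
  next
    case False
    then obtain v where v: "v \<in> Poly_Mapping.keys t" by blast
    have eq: "Poly_Mapping.single v 1 + (t - Poly_Mapping.single v 1) = t"
      using v by (rule single_split)
    have "mono_degree (t - Poly_Mapping.single v 1) < mono_degree t"
      by (subst (2) eq[symmetric]) (simp add: mono_degree_add)
    from a[OF less(1)[OF this], of v] show ?thesis using eq by simp
  qed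
qed

lemma const_poly_0 [simp]: "const_poly 0 = 0"
  and const_poly_1 [simp]: "const_poly 1 = 1"
  and const_poly_add: "const_poly (a + b) = const_poly a + const_poly b"
  and const_poly_mult: "const_poly (c * d) = const_poly c * const_poly (d :: 'a::comm_semiring_1)"
  by (simp_all add: const_poly_def single_add mult_single)

lemma const_poly_uminus: "const_poly (- a) = - const_poly (a :: 'a::ab_group_add)"
  and const_poly_diff: "const_poly (a - b) = const_poly a - const_poly (b :: 'a::ab_group_add)"
  by (simp_all add: const_poly_def single_uminus single_diff)

lemma const_poly_power: "const_poly (c ^ n) = const_poly (c :: 'a::comm_semiring_1) ^ n"
  by (induction n) (simp_all add: const_poly_mult)

lemma const_poly_of_nat: "const_poly (of_nat n) = (of_nat n :: ('v, 'a::comm_semiring_1) mpoly)"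
  by (simp add: const_poly_def)

lemma const_poly_sum: "const_poly (sum f A) = (\<Sum>x\<in>A. const_poly (f x))"
  by (induction A rule: infinite_finite_induct) (simp_all add: const_poly_add)

lemma const_poly_eq_0_iff [simp]: "const_poly c = 0 \<longleftrightarrow> c = 0"
  by (metis const_poly_0 const_poly_def inj_single injD)

lemma single_var_times:
  "Poly_Mapping.single (Poly_Mapping.single v 1 + t) c = var_poly v * Poly_Mapping.single t (c ::
    'a::comm_semiring_1)"
  by (simp add: var_poly_def mult_single)

lemma single_const_times:
  "Poly_Mapping.single t (c :: 'a::comm_semiring_1) = const_poly c * Poly_Mapping.single t 1"
  by (simp add: const_poly_def mult_single)

lemma mpoly_alg_induct [case_names const var add mult]:
  fixes f :: "('v, 'a::comm_semiring_1) mpoly"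
  assumes c: "\<And>c. P (const_poly c)" and v: "\<And>v. P (var_poly v)"
    and a: "\<And>f g. P f \<Longrightarrow> P g \<Longrightarrow> P (f + g)"
    and m: "\<And>f g. P f \<Longrightarrow> P g \<Longrightarrow> P (f * g)"
  shows "P f"
proof (induction f rule: mpoly_induct)
  case (single t k)
  have "P (Poly_Mapping.single t 1)"
  proof (induction t rule: mono_induct)
    case zero
    then show ?case using c[of 1] by (simp add: const_poly_def)
  next
    case (add v t)
    then show ?case unfolding single_var_times using m v by blast
  qed
  then show ?case by (subst single_const_times) (intro m c)
next
  case (add f g)
  then show ?case by (rule a)
qed

section \<open>Algebra homomorphisms and substitution\<close>

locale alg_hom =
  fixes \<phi> :: "('v, 'a::comm_ring_1) mpoly \<Rightarrow> ('w, 'a) mpoly"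
  assumes hom_add: "\<phi> (f + g) = \<phi> f + \<phi> g"
    and hom_mult: "\<phi> (f * g) = \<phi> f * \<phi> g"
    and hom_const: "\<phi> (const_poly c) = const_poly c"
begin

lemma hom_0: "\<phi> 0 = 0"
  using hom_const[of 0] by simp

lemma hom_1: "\<phi> 1 = 1"
  using hom_const[of 1] by simp

lemma hom_uminus: "\<phi> (- f) = - \<phi> f"
  using hom_add[of f "- f"] hom_0 by (simp add: add_eq_0_iff)

lemma hom_diff: "\<phi> (f - g) = \<phi> f - \<phi> g"
  using hom_add[of f "- g"] hom_uminus by simp

lemma hom_power: "\<phi> (f ^ n) = \<phi> f ^ n"
  by (induction n) (simp_all add: hom_1 hom_mult)

lemma hom_sum: "\<phi> (sum h A) = (\<Sum>x\<in>A. \<phi> (h x))"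
  by (induction A rule: infinite_finite_induct) (simp_all add: hom_0 hom_add)

lemma hom_prod: "\<phi> (prod h A) = (\<Prod>x\<in>A. \<phi> (h x))"
  by (induction A rule: infinite_finite_induct) (simp_all add: hom_1 hom_mult)

lemma hom_prod_mset: "\<phi> (\<Prod>x\<in>#A. h x) = (\<Prod>x\<in>#A. \<phi> (h x))"
  by (induction A) (simp_all add: hom_1 hom_mult)

lemma hom_of_nat: "\<phi> (of_nat n) = of_nat n"
  using hom_const[of "of_nat n"] by (simp add: const_poly_of_nat)

lemmas hom_simps = hom_add hom_mult hom_const hom_0 hom_1 hom_uminus hom_diff hom_power hom_sum
  hom_prod hom_prod_mset hom_of_nat

end

lemma alg_hom_comp: "alg_hom \<phi> \<Longrightarrow> alg_hom \<psi> \<Longrightarrow> alg_hom (\<lambda>f. \<phi> (\<psi> f))"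
  by (simp add: alg_hom_def)

lemma alg_hom_id: "alg_hom (\<lambda>f. f)"
  by (simp add: alg_hom_def)

lemma alg_hom_eq:
  assumes "alg_hom \<phi>" "alg_hom \<psi>" "\<And>v. \<phi> (var_poly v) = \<psi> (var_poly v)"
  shows "\<phi> f = \<psi> f"
  using assms by (induction f rule: mpoly_alg_induct) (simp_all add: alg_hom_def)

context
  fixes \<sigma> :: "'v \<Rightarrow> ('w, 'a::comm_ring_1) mpoly"
begin

private definition mono_val :: "('v \<Rightarrow>\<^sub>0 nat) \<Rightarrow> ('w, 'a) mpoly" where
  "mono_val t = (\<Prod>v\<in>Poly_Mapping.keys t. \<sigma> v ^ Poly_Mapping.lookup t v)"

private lemma mono_val_eq:
  "finite V \<Longrightarrow> Poly_Mapping.keys t \<subseteq> V \<Longrightarrow> mono_val t = (\<Prod>v\<in>V. \<sigma> v ^ Poly_Mapping.lookup t v)"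
  unfolding mono_val_def by (intro prod.mono_neutral_left) (auto simp: in_keys_iff)

private lemma mono_val_add: "mono_val (s + t) = mono_val s * mono_val t"
proof -
  let ?V = "Poly_Mapping.keys s \<union> Poly_Mapping.keys t"
  have "mono_val (s + t) = (\<Prod>v\<in>?V. \<sigma> v ^ Poly_Mapping.lookup (s + t) v)"
    by (rule mono_val_eq) (auto simp: keys_nat_add)
  also have "\<dots> = mono_val s * mono_val t"
    by (simp add: lookup_add power_add prod.distrib mono_val_eq[of ?V])
  finally show ?thesis .
qed

private lemma subst_eq:
  "finite T \<Longrightarrow> Poly_Mapping.keys f \<subseteq> T \<Longrightarrow>
    subst_poly \<sigma> f = (\<Sum>t\<in>T. const_poly (Poly_Mapping.lookup f t) * mono_val t)"
  unfolding subst_poly_def mono_val_def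
  by (intro sum.mono_neutral_left) (auto simp: in_keys_iff)

private lemma subst_add: "subst_poly \<sigma> (f + g) = subst_poly \<sigma> f + subst_poly \<sigma> g"
proof -
  let ?T = "Poly_Mapping.keys f \<union> Poly_Mapping.keys g"
  have "subst_poly \<sigma> (f + g) = (\<Sum>t\<in>?T. const_poly (Poly_Mapping.lookup (f + g) t) * mono_val t)"
    using Poly_Mapping.keys_add[of f g] by (intro subst_eq) auto
  also have "\<dots> = subst_poly \<sigma> f + subst_poly \<sigma> g"
    by (simp add: subst_eq[of ?T] lookup_add const_poly_add distrib_right sum.distrib)
  finally show ?thesis .
qed

private lemma subst_single: "subst_poly \<sigma> (Poly_Mapping.single t c) = const_poly c * mono_val t"
  by (subst subst_eq[of "{t}"]) auto

private lemma subst_mult: "subst_poly \<sigma> (f * g) = subst_poly \<sigma> f * subst_poly \<sigma> g"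
proof (induction f rule: mpoly_induct)
  case (single t c)
  show ?case
  proof (induction g rule: mpoly_induct)
    case (single s d)
    then show ?case
      by (simp add: mult_single subst_single mono_val_add const_poly_mult ac_simps)
  next
    case (add f g)
    then show ?case by (simp add: distrib_left subst_add)
  qed
next
  case (add f g)
  then show ?case by (simp add: distrib_right subst_add)
qed

private lemma subst_const: "subst_poly \<sigma> (const_poly c) = const_poly c"
  unfolding const_poly_def[of c] subst_single by (simp add: mono_val_def const_poly_def)

lemma alg_hom_subst: "alg_hom (subst_poly \<sigma>)"
  by (simp add: alg_hom_def subst_add subst_mult subst_const)

lemma subst_var [simp]: "subst_poly \<sigma> (var_poly v) = \<sigma> v"
  by (simp add: var_poly_def subst_single mono_val_def const_poly_def)

end

text \<open>Telescoping a difference of products propagates the congruence from the variables.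
  Applied to the identity and a restriction to a line, it becomes the factor theorem for a linear
  form.\<close>

lemma alg_hom_cong_mod:
  assumes \<phi>: "alg_hom \<phi>" and \<psi>: "alg_hom \<psi>" and v: "\<And>v. b dvd \<phi> (var_poly v) - \<psi> (var_poly v)"
  shows "b dvd \<phi> f - \<psi> f"
proof -
  interpret \<phi>: alg_hom \<phi> by fact
  interpret \<psi>: alg_hom \<psi> by fact
  show ?thesis
  proof (induction f rule: mpoly_alg_induct)
    case (const c)
    then show ?case by (simp add: \<phi>.hom_const \<psi>.hom_const)
  next
    case (var v)
    then show ?case using v by simp
  next
    case (add f g)
    then show ?case
      by (simp add: \<phi>.hom_simps \<psi>.hom_simps add_diff_add)
  next
    case (mult f g)
    have "\<phi> (f * g) - \<psi> (f * g) = (\<phi> f - \<psi> f) * \<phi> g + \<psi> f * (\<phi> g - \<psi> g)"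
      by (simp add: \<phi>.hom_simps \<psi>.hom_simps algebra_simps)
    then show ?case using mult by simp
  qed
qed

section \<open>Gradings by a weight on exponent vectors\<close>

definition weight_part :: "(('v \<Rightarrow>\<^sub>0 nat) \<Rightarrow> 'b) \<Rightarrow> 'b \<Rightarrow> ('v, 'a::comm_monoid_add) mpoly \<Rightarrow> ('v, 'a)
  mpoly" where
  "weight_part w d f =
    (\<Sum>t\<in>{t \<in> Poly_Mapping.keys f. w t = d}. Poly_Mapping.single t (Poly_Mapping.lookup f t))"

definition weight_homogeneous :: "(('v \<Rightarrow>\<^sub>0 nat) \<Rightarrow> 'b) \<Rightarrow> 'b \<Rightarrow> ('v, 'a::zero) mpoly \<Rightarrow> bool" where
  "weight_homogeneous w d f \<longleftrightarrow> (\<forall>t\<in>Poly_Mapping.keys f. w t = d)"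

lemma homogeneous_of_degree_iff: "homogeneous_of_degree d f \<longleftrightarrow> weight_homogeneous mono_degree d f"
  by (simp add: homogeneous_of_degree_def weight_homogeneous_def)

lemma lookup_weight_part:
  "Poly_Mapping.lookup (weight_part w d f) t = (if w t = d then Poly_Mapping.lookup f t else 0)"
  by (auto simp: weight_part_def lookup_sum lookup_single_if in_keys_iff)

lemma weight_part_add: "weight_part w d (f + g) = weight_part w d f + weight_part w d g"
  by (rule poly_mapping_eqI) (simp add: lookup_weight_part lookup_add)

lemma weight_part_0 [simp]: "weight_part w d 0 = 0"
  by (rule poly_mapping_eqI) (simp add: lookup_weight_part)

lemma weight_part_diff:
  "weight_part w d (f - g) = weight_part w d f - weight_part w d (g :: ('v, 'a::ab_group_add)
    mpoly)"
  by (rule poly_mapping_eqI) (simp add: lookup_weight_part lookup_minus)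

lemma weight_part_sum: "weight_part w d (sum h A) = (\<Sum>x\<in>A. weight_part w d (h x))"
  by (induction A rule: infinite_finite_induct) (simp_all add: weight_part_add)

lemma weight_homogeneous_part: "weight_homogeneous w d (weight_part w d f)"
  by (auto simp: weight_homogeneous_def in_keys_iff lookup_weight_part split: if_splits)

lemma weight_part_homogeneous:
  "weight_homogeneous w d f \<Longrightarrow> weight_part w e f = (if e = d then f else 0)"
  by (rule poly_mapping_eqI) (auto simp: lookup_weight_part weight_homogeneous_def in_keys_iff)

lemma weight_homogeneous_iff: "weight_homogeneous w d f \<longleftrightarrow> weight_part w d f = f"
  using weight_homogeneous_part weight_part_homogeneous by metis

lemma keys_weight_part: "Poly_Mapping.keys (weight_part w d f) \<subseteq> Poly_Mapping.keys f"
  by (auto simp: in_keys_iff lookup_weight_part split: if_splits)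

lemma sum_weight_part: "(\<Sum>d\<in>w ` Poly_Mapping.keys f. weight_part w d f) = f"
  by (rule poly_mapping_eqI) (auto simp: lookup_sum lookup_weight_part in_keys_iff)

lemma weight_homogeneous_0 [simp]: "weight_homogeneous w d 0"
  by (simp add: weight_homogeneous_def)

lemma weight_homogeneous_add:
  "weight_homogeneous w d f \<Longrightarrow> weight_homogeneous w d g \<Longrightarrow>
    weight_homogeneous w d (f + g :: ('v, 'a::comm_monoid_add) mpoly)"
  by (simp add: weight_homogeneous_iff weight_part_add)

lemma weight_homogeneous_diff:
  "weight_homogeneous w d f \<Longrightarrow> weight_homogeneous w d g \<Longrightarrow>
    weight_homogeneous w d (f - g :: ('v, 'a::ab_group_add) mpoly)"
  by (simp add: weight_homogeneous_iff weight_part_diff)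

lemma weight_homogeneous_single: "weight_homogeneous w (w t) (Poly_Mapping.single t c)"
  by (simp add: weight_homogeneous_def)

text \<open>Only the images of monomials have to be homogeneous, and the weights may take values in
  any type. So it also covers \<open>multidegree\<close>, which is function-valued and not an
  \<open>additive_weight\<close>.\<close>

lemma weight_part_hom:
  fixes \<phi> :: "('v, 'a::comm_monoid_add) mpoly \<Rightarrow> ('w, 'a) mpoly"
  assumes a: "\<And>f g. \<phi> (f + g) = \<phi> f + \<phi> g"
    and s: "\<And>t c. weight_homogeneous w' (w t) (\<phi> (Poly_Mapping.single t c))"
    and z: "\<phi> 0 = 0"
  shows "weight_part w' d (\<phi> f) = \<phi> (weight_part w d f)"
proof (induction f rule: mpoly_induct)
  case (single t c)
  show ?case
    using s[of t c] by (simp add: weight_part_homogeneous weight_part_homogeneous[OF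
      weight_homogeneous_single] z)
next
  case (add f g)
  then show ?case by (simp add: a weight_part_add)
qed

locale additive_weight =
  fixes w :: "('v \<Rightarrow>\<^sub>0 nat) \<Rightarrow> nat"
  assumes weight_add: "w (s + t) = w s + w t"
begin

lemma weight_0: "w 0 = 0"
  using weight_add[of 0 0] by simp

lemma homogeneous_mult:
  fixes f g :: "('v, 'a::comm_semiring_1) mpoly"
  assumes "weight_homogeneous w d f" "weight_homogeneous w e g"
  shows "weight_homogeneous w (d + e) (f * g)"
  unfolding weight_homogeneous_def
proof
  fix t assume "t \<in> Poly_Mapping.keys (f * g)"
  then obtain a b where "t = a + b" "a \<in> Poly_Mapping.keys f" "b \<in> Poly_Mapping.keys g"
    using keys_mult[of f g] by blast
  then show "w t = d + e" using assms by (simp add: weight_homogeneous_def weight_add)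
qed

lemma homogeneous_const: "weight_homogeneous w 0 (const_poly c)"
  by (auto simp: weight_homogeneous_def const_poly_def weight_0)

lemma homogeneous_1: "weight_homogeneous w 0 (1 :: ('v, 'a::comm_semiring_1) mpoly)"
  using homogeneous_const[of "1 :: 'a"] by simp

lemma homogeneous_const_mult:
  "weight_homogeneous w d f \<Longrightarrow> weight_homogeneous w d (const_poly c * f ::
    ('v, 'a::comm_semiring_1) mpoly)"
  using homogeneous_mult[OF homogeneous_const] by fastforce

lemma homogeneous_power:
  "weight_homogeneous w d f \<Longrightarrow> weight_homogeneous w (n * d) (f ^ n :: ('v, 'a::comm_semiring_1)
    mpoly)"
  by (induction n) (auto simp: homogeneous_1 homogeneous_mult)

lemma homogeneous_prod_mset:
  assumes "\<And>x. x \<in># A \<Longrightarrow> weight_homogeneous w d (h x)"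
  shows "weight_homogeneous w (size A * d) (\<Prod>x\<in>#A. h x :: ('v, 'a::comm_semiring_1) mpoly)"
  using assms by (induction A) (auto simp: homogeneous_1 homogeneous_mult)

lemma homogeneous_var:
  "weight_homogeneous w (w (Poly_Mapping.single v 1)) (var_poly v :: ('v, 'a::comm_semiring_1)
    mpoly)"
  unfolding var_poly_def by (rule weight_homogeneous_single)

lemma part_mult:
  fixes f e :: "('v, 'a::comm_semiring_1) mpoly"
  assumes e: "weight_homogeneous w k e"
  shows "weight_part w d (e * f) = (if k \<le> d then e * weight_part w (d - k) f else 0)"
proof (induction f rule: mpoly_induct)
  case (single t c)
  have "weight_homogeneous w (k + w t) (e * Poly_Mapping.single t c)"
    by (intro homogeneous_mult e weight_homogeneous_single)
  then show ?case
    by (auto simp: weight_part_homogeneous weight_part_homogeneous[OF weight_homogeneous_single])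
next
  case (add f g)
  then show ?case by (auto simp: distrib_left weight_part_add)
qed

end

lemma hom_single_homogeneous:
  fixes \<phi> :: "('v, 'a::comm_ring_1) mpoly \<Rightarrow> ('w, 'a) mpoly"
  assumes \<phi>: "alg_hom \<phi>" and w: "additive_weight w" and w': "additive_weight w'"
    and v: "\<And>v. weight_homogeneous w' (w (Poly_Mapping.single v 1)) (\<phi> (var_poly v))"
  shows "weight_homogeneous w' (w t) (\<phi> (Poly_Mapping.single t c))"
proof -
  interpret \<phi>: alg_hom \<phi> by fact
  interpret w: additive_weight w by fact
  interpret w': additive_weight w' by fact
  show ?thesis
  proof (induction t rule: mono_induct)
    case zero
    then show ?case
      using w'.homogeneous_const by (simp add: w.weight_0 \<phi>.hom_const flip: const_poly_def)
  next
    case (add x t)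
    then show ?case
      unfolding single_var_times \<phi>.hom_mult w.weight_add by (intro w'.homogeneous_mult v)
  qed
qed

lemma weight_part_alg_hom:
  fixes \<phi> :: "('v, 'a::comm_ring_1) mpoly \<Rightarrow> ('w, 'a) mpoly"
  assumes "alg_hom \<phi>" "additive_weight w" "additive_weight w'"
    "\<And>v. weight_homogeneous w' (w (Poly_Mapping.single v 1)) (\<phi> (var_poly v))"
  shows "weight_part w' d (\<phi> f) = \<phi> (weight_part w d f)"
  by (rule weight_part_hom)
    (use assms in \<open>auto intro: hom_single_homogeneous simp: alg_hom.hom_add alg_hom.hom_0\<close>)

subsection \<open>Derivations and the prime field\<close>

text \<open>
  The class instance in \<open>HOL-Library.Poly_Mapping\<close> needs linearly ordered variables, which
  \<^typ>\<open>nat \<times> 2\<close> is not; so the variables are renamed to natural numbers.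
\<close>

lemma mpoly_mult_eq_0:
  fixes f g :: "('v::countable, 'a::idom) mpoly"
  assumes "f * g = 0"
  shows "f = 0 \<or> g = 0"
proof -
  define \<iota> :: "('v, 'a) mpoly \<Rightarrow> (nat, 'a) mpoly" where "\<iota> = subst_poly (\<lambda>v. var_poly (to_nat v))"
  define \<kappa> :: "(nat, 'a) mpoly \<Rightarrow> ('v, 'a) mpoly" where "\<kappa> = subst_poly (\<lambda>n. var_poly (from_nat n))"
  interpret \<iota>: alg_hom \<iota> unfolding \<iota>_def by (rule alg_hom_subst)
  interpret \<kappa>: alg_hom \<kappa> unfolding \<kappa>_def by (rule alg_hom_subst)
  have inv: "\<kappa> (\<iota> h) = h" for h
    by (rule alg_hom_eq[OF alg_hom_comp[OF \<kappa>.alg_hom_axioms \<iota>.alg_hom_axioms] alg_hom_id])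
      (simp add: \<iota>_def \<kappa>_def)
  have "\<iota> f * \<iota> g = 0"
    using assms by (simp flip: \<iota>.hom_mult add: \<iota>.hom_0)
  then have "\<iota> f = 0 \<or> \<iota> g = 0" by simp
  then show ?thesis using inv \<kappa>.hom_0 by metis
qed

lemma mpoly_mult_left_cancel:
  fixes f g h :: "('v::countable, 'a::idom) mpoly"
  assumes "h * f = h * g" "h \<noteq> 0"
  shows "f = g"
  using mpoly_mult_eq_0[of h "f - g"] assms by (simp add: right_diff_distrib)

lemma var_poly_nonzero [simp]: "var_poly v \<noteq> (0 :: ('v, 'a::zero_neq_one) mpoly)"
  by (metis inj_single injD single_zero var_poly_def zero_neq_one)

section \<open>Partial derivatives and derivations along a homomorphism\<close>

definition partial_deriv :: "'v \<Rightarrow> ('v, 'a::comm_semiring_1) mpoly \<Rightarrow> ('v, 'a) mpoly" where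
  "partial_deriv v f = (\<Sum>t\<in>Poly_Mapping.keys f.
     Poly_Mapping.single (t - Poly_Mapping.single v 1)
       (of_nat (Poly_Mapping.lookup t v) * Poly_Mapping.lookup f t))"

lemma partial_deriv_eq:
  "finite T \<Longrightarrow> Poly_Mapping.keys f \<subseteq> T \<Longrightarrow> partial_deriv v f =
    (\<Sum>t\<in>T. Poly_Mapping.single (t - Poly_Mapping.single v 1)
       (of_nat (Poly_Mapping.lookup t v) * Poly_Mapping.lookup f t))"
  unfolding partial_deriv_def
  by (intro sum.mono_neutral_left) (auto simp: in_keys_iff)

lemma partial_deriv_single:
  "partial_deriv v (Poly_Mapping.single t c) =
    Poly_Mapping.single (t - Poly_Mapping.single v 1) (of_nat (Poly_Mapping.lookup t v) * c)"
  by (subst partial_deriv_eq[of "{t}"]) auto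

lemma partial_deriv_add: "partial_deriv v (f + g) = partial_deriv v f + partial_deriv v g"
proof -
  let ?T = "Poly_Mapping.keys f \<union> Poly_Mapping.keys g"
  have "partial_deriv v (f + g) =
    (\<Sum>t\<in>?T. Poly_Mapping.single (t - Poly_Mapping.single v 1)
       (of_nat (Poly_Mapping.lookup t v) * Poly_Mapping.lookup (f + g) t))"
    using Poly_Mapping.keys_add[of f g] by (intro partial_deriv_eq) auto
  also have "\<dots> = partial_deriv v f + partial_deriv v g"
    by (simp add: partial_deriv_eq[of ?T] lookup_add distrib_left single_add sum.distrib)
  finally show ?thesis .
qed

lemma mono_diff_add:
  "Poly_Mapping.lookup s v \<noteq> 0 \<Longrightarrow>
    s - Poly_Mapping.single v 1 + t = s + t - Poly_Mapping.single v (1 :: nat)"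
  by (rule poly_mapping_eqI) (auto simp: lookup_add lookup_minus lookup_single_if)

lemma partial_deriv_mult:
  "partial_deriv v (f * g) = partial_deriv v f * g + f * partial_deriv v g"
proof (induction f rule: mpoly_induct)
  case (single s c)
  show ?case
  proof (induction g rule: mpoly_induct)
    case (single t d)
    let ?e = "s + t - Poly_Mapping.single v 1"
    \<comment> \<open>If v does not occur in s, the subtraction of exponents is truncated, but the
      coefficient is then 0; hence the case distinction.\<close>
    have 1: "partial_deriv v (Poly_Mapping.single s c) * Poly_Mapping.single t d =
      Poly_Mapping.single ?e (of_nat (Poly_Mapping.lookup s v) * c * d)"
      by (cases "Poly_Mapping.lookup s v = 0")
        (simp_all add: partial_deriv_single mult_single mono_diff_add del: One_nat_def)
    have 2: "Poly_Mapping.single s c * partial_deriv v (Poly_Mapping.single t d) =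
      Poly_Mapping.single ?e (of_nat (Poly_Mapping.lookup t v) * c * d)"
      using mono_diff_add[of t v s]
      by (cases "Poly_Mapping.lookup t v = 0")
        (simp_all add: partial_deriv_single mult_single ac_simps del: One_nat_def)
    show ?case
      unfolding 1 2
      by (simp add: mult_single partial_deriv_single lookup_add algebra_simps flip: single_add)
  next
    case (add g1 g2)
    show ?case unfolding distrib_left partial_deriv_add add by (simp add: algebra_simps)
  qed
next
  case (add f1 f2)
  show ?case unfolding distrib_right partial_deriv_add add by (simp add: algebra_simps)
qed

lemma partial_deriv_const [simp]: "partial_deriv v (const_poly c) = 0"
  by (simp add: const_poly_def partial_deriv_single)

lemma partial_deriv_var: "partial_deriv v (var_poly u) = (if u = v then 1 else 0)"
  by (simp add: var_poly_def partial_deriv_single lookup_single_if)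

text \<open>Derivations along a homomorphism are the right generality for commutation rules: a
  derivation composed with a substitution, in either order, is of this kind, and two of them agree
  once they agree on the variables.\<close>

locale hom_deriv = alg_hom \<phi> for \<phi> :: "('v, 'a::comm_ring_1) mpoly \<Rightarrow> ('w, 'a) mpoly" +
  fixes \<delta> :: "('v, 'a) mpoly \<Rightarrow> ('w, 'a) mpoly"
  assumes deriv_add: "\<delta> (f + g) = \<delta> f + \<delta> g"
    and deriv_mult: "\<delta> (f * g) = \<delta> f * \<phi> g + \<phi> f * \<delta> g"
    and deriv_const: "\<delta> (const_poly c) = 0"
begin

lemma deriv_0: "\<delta> 0 = 0"
  using deriv_const[of 0] by simp

lemma deriv_1: "\<delta> 1 = 0"
  using deriv_const[of 1] by simp

lemma deriv_uminus: "\<delta> (- f) = - \<delta> f"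
  using deriv_add[of f "- f"] deriv_0 by (simp add: add_eq_0_iff)

lemma deriv_diff: "\<delta> (f - g) = \<delta> f - \<delta> g"
  using deriv_add[of f "- g"] deriv_uminus by simp

lemma deriv_sum: "\<delta> (sum h A) = (\<Sum>x\<in>A. \<delta> (h x))"
  by (induction A rule: infinite_finite_induct) (simp_all add: deriv_0 deriv_add)

lemma deriv_power: "\<delta> (f ^ n) = of_nat n * \<phi> f ^ (n - 1) * \<delta> f"
proof (induction n)
  case (Suc n)
  then show ?case by (cases n) (simp_all add: deriv_mult hom_mult hom_power algebra_simps deriv_1)
qed (simp add: deriv_1)

end

lemma hom_deriv_eq:
  assumes "hom_deriv \<phi> \<delta>" "hom_deriv \<phi> \<delta>'" "\<And>v. \<delta> (var_poly v) = \<delta>' (var_poly v)"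
  shows "\<delta> f = \<delta>' f"
proof -
  interpret d: hom_deriv \<phi> \<delta> by fact
  interpret d': hom_deriv \<phi> \<delta>' by fact
  show ?thesis
    by (induction f rule: mpoly_alg_induct)
      (use assms(3) in \<open>simp_all add: d.deriv_add d'.deriv_add d.deriv_mult d'.deriv_mult
        d.deriv_const d'.deriv_const\<close>)
qed

section \<open>Characteristic p and the prime field\<close>

lemma CHAR_mpoly: "CHAR(('v, 'a::comm_semiring_1) mpoly) = CHAR('a)"
proof (rule CHAR_eqI)
  show "(of_nat CHAR('a) :: ('v, 'a) mpoly) = 0"
    by (simp flip: const_poly_of_nat)
next
  fix n assume "(of_nat n :: ('v, 'a) mpoly) = 0"
  then have "const_poly (of_nat n :: 'a) = (0 :: ('v, 'a) mpoly)"
    by (simp add: const_poly_of_nat)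
  then show "CHAR('a) dvd n" by (simp add: of_nat_eq_0_iff_char_dvd)
qed

locale prime_char =
  fixes p :: nat and field_type :: "'a::field itself"
  assumes prime_p: "prime p" and char_p: "CHAR('a) = p"
begin

definition Fp :: "'a set" where "Fp = range of_int"

lemma p_gt_1: "p > 1" and p_ge_2: "p \<ge> 2" and p_pos: "p > 0" and p_nonzero: "p \<noteq> 0"
  using prime_gt_1_nat[OF prime_p] by auto

lemma of_nat_p [simp]: "(of_nat p :: 'a) = 0"
  using char_p of_nat_CHAR[where 'a='a] by simp

lemma frob_add: "(x + y :: 'a) ^ p = x ^ p + y ^ p"
  using freshmans_dream[where x=x and y=y] char_p prime_p by simp

lemma Fp_add [intro, simp]: "a \<in> Fp \<Longrightarrow> b \<in> Fp \<Longrightarrow> a + b \<in> Fp"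
  and Fp_mult [intro, simp]: "a \<in> Fp \<Longrightarrow> b \<in> Fp \<Longrightarrow> a * b \<in> Fp"
  and Fp_diff [intro, simp]: "a \<in> Fp \<Longrightarrow> b \<in> Fp \<Longrightarrow> a - b \<in> Fp"
  and Fp_uminus [intro, simp]: "a \<in> Fp \<Longrightarrow> - a \<in> Fp"
  unfolding Fp_def
  by (auto simp flip: of_int_add of_int_mult of_int_diff of_int_minus)

lemma Fp_0 [intro, simp]: "0 \<in> Fp"
  and Fp_1 [intro, simp]: "1 \<in> Fp"
  unfolding Fp_def using range_eqI[of 0 of_int 0] range_eqI[of 1 of_int 1] by simp_all

lemma Fp_power [intro, simp]: "a \<in> Fp \<Longrightarrow> a ^ n \<in> Fp"
  by (induction n) auto

lemma Fp_eq: "Fp = of_nat ` {..<p}"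
proof (intro equalityI subsetI)
  fix x assume "x \<in> Fp"
  then obtain n where n: "x = of_int n" by (auto simp: Fp_def)
  have "(of_int (n - n mod int p) :: 'a) = 0"
    unfolding of_int_eq_0_iff_char_dvd char_p by (rule dvd_minus_mod)
  then have "x = of_int (n mod int p)" unfolding n of_int_diff by (rule right_minus_eq[THEN iffD1])
  also have "n mod int p = int (nat (n mod int p))" using p_pos by simp
  finally have "x = of_nat (nat (n mod int p))" by simp
  moreover have "nat (n mod int p) < p"
    using pos_mod_bound[of "int p" n] p_pos by linarith
  ultimately show "x \<in> of_nat ` {..<p}" by blast
next
  fix x :: 'a assume "x \<in> of_nat ` {..<p}"
  then obtain n where "x = of_nat n" by blast
  then have "x = of_int (int n)" by simp
  then show "x \<in> Fp" unfolding Fp_def by (rule range_eqI)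
qed

lemma finite_Fp [simp]: "finite Fp"
  unfolding Fp_eq by simp

lemma card_Fp: "card Fp = p"
proof -
  have "inj_on (of_nat :: nat \<Rightarrow> 'a) {..<p}"
  proof (rule linorder_inj_onI')
    fix i j :: nat assume ij: "i \<in> {..<p}" "j \<in> {..<p}" "i < j"
    then have "\<not> p dvd j - i" by (intro nat_dvd_not_less) auto
    then have "(of_nat (j - i) :: 'a) \<noteq> 0"
      unfolding of_nat_eq_0_iff_char_dvd char_p .
    moreover have "(of_nat j :: 'a) = of_nat i + of_nat (j - i)"
      using ij by (simp flip: of_nat_add)
    ultimately show "(of_nat i :: 'a) \<noteq> of_nat j" by simp
  qed
  then show ?thesis unfolding Fp_eq by (simp add: card_image)
qed

lemma frob_Fp [simp]: "a \<in> Fp \<Longrightarrow> a ^ p = a"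
proof -
  have "(of_nat n :: 'a) ^ p = of_nat n" for n
    by (induction n) (simp_all only: of_nat_0 of_nat_Suc frob_add power_one zero_power[OF p_pos])
  then show "a \<in> Fp \<Longrightarrow> a ^ p = a" unfolding Fp_eq by blast
qed

lemma fermat_Fp: "a \<in> Fp \<Longrightarrow> a \<noteq> 0 \<Longrightarrow> a ^ (p - 1) = 1"
  using frob_Fp[of a] p_nonzero by (cases p) auto

lemma Fp_inverse [intro, simp]: "a \<in> Fp \<Longrightarrow> inverse a \<in> Fp"
proof (cases "a = 0")
  case False
  assume a: "a \<in> Fp"
  have "a * a ^ (p - 2) = 1"
  proof -
    have "p - 1 = Suc (p - 2)" using p_ge_2 by simp
    then show ?thesis using fermat_Fp[OF a False] by simp
  qed
  then have "inverse a = a ^ (p - 2)" by (rule inverse_unique)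
  then show ?thesis using a by simp
qed simp

lemma Fp_divide [intro, simp]: "a \<in> Fp \<Longrightarrow> b \<in> Fp \<Longrightarrow> a / b \<in> Fp"
  by (simp add: divide_inverse)

lemma delta_Fp: "a \<in> Fp \<Longrightarrow> 1 - a ^ (p - 1) = (if a = 0 then 1 else 0)"
  using fermat_Fp[of a] p_gt_1 by (cases "a = 0") (simp_all add: power_0_left)

text \<open>Otherwise X^r - 1, where r = k mod (p - 1) lies strictly between 0 and p - 1, would have
  p - 1 roots. The s obtained here later serves as the torus element that kills a relative
  transfer.\<close>

lemma exists_power_neq_1:
  assumes "\<not> (p - 1) dvd k"
  shows "\<exists>s\<in>Fp. s \<noteq> 0 \<and> s ^ k \<noteq> 1"
proof (rule ccontr)
  assume "\<not> ?thesis"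
  then have all: "s ^ k = 1" if "s \<in> Fp" "s \<noteq> 0" for s using that by blast
  define r where "r = k mod (p - 1)"
  have r: "0 < r" "r < p - 1"
    using assms p_gt_1 by (auto simp: r_def dvd_eq_mod_eq_0)
  have s: "s ^ r = 1" if "s \<in> Fp" "s \<noteq> 0" for s
  proof -
    have "s ^ k = s ^ ((p - 1) * (k div (p - 1)) + r)" by (simp add: r_def)
    also have "\<dots> = s ^ r" using fermat_Fp[OF that] by (simp add: power_add power_mult)
    finally show ?thesis using all[OF that] by simp
  qed
  let ?q = "monom 1 r - 1 :: 'a poly"
  have cq: "coeff ?q r = 1" using r by simp
  have q0: "?q \<noteq> 0"
  proof
    assume "?q = 0"
    then have "coeff ?q r = 0" by (simp only: coeff_0)
    then show False using cq zero_neq_one by metis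
  qed
  have "Fp - {0} \<subseteq> {x. poly ?q x = 0}" using s by (simp add: subset_iff poly_monom)
  then have "card (Fp - {0}) \<le> card {x. poly ?q x = 0}"
    using poly_roots_finite[OF q0] by (rule card_mono[rotated])
  also have "\<dots> \<le> degree ?q" using q0 by (rule card_poly_roots_bound)
  also have "\<dots> \<le> r" by (rule degree_diff_le) (auto simp: degree_monom_le)
  finally show False using r card_Fp by (simp add: card_Diff_singleton)
qed

text \<open>For 0 < k < p - 1, scaling the summation variable by an s with s^k distinct from 1
  multiplies the sum by s^k without changing it. For k = 0 there are p terms equal to 1, including
  0^0.\<close>

lemma power_sum_Fp:
  assumes "k \<le> p - 1"
  shows "(\<Sum>t\<in>Fp. t ^ k) = (if k = p - 1 then -1 else 0)"
proof -
  consider "k = p - 1" | "k = 0" "k \<noteq> p - 1" | "0 < k" "k < p - 1" using assms by linarith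
  then show ?thesis
  proof cases
    case 1
    have "(\<Sum>t\<in>Fp. t ^ k) = (\<Sum>t\<in>Fp. 1 - (if t = 0 then 1 else 0))"
      unfolding 1
    proof (intro sum.cong refl)
      fix t assume "t \<in> Fp"
      then show "t ^ (p - 1) = 1 - (if t = 0 then 1 else 0)"
        using fermat_Fp[of t] p_gt_1 by (cases "t = 0") (simp_all add: power_0_left)
    qed
    also have "\<dots> = of_nat p - 1"
      by (simp add: sum_subtractf card_Fp sum.delta')
    finally show ?thesis using 1 by simp
  next
    case 2
    then show ?thesis by (simp add: card_Fp)
  next
    case 3
    then have "\<not> (p - 1) dvd k" by (auto dest: dvd_imp_le)
    then obtain s where s: "s \<in> Fp" "s \<noteq> 0" "s ^ k \<noteq> 1" using exists_power_neq_1 by blast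
    have "(\<Sum>t\<in>Fp. t ^ k) = (\<Sum>t\<in>Fp. (s * t) ^ k)"
      by (rule sum.reindex_bij_witness[where i = "\<lambda>t. s * t" and j = "\<lambda>t. t / s"]) (simp_all add: s)
    also have "\<dots> = s ^ k * (\<Sum>t\<in>Fp. t ^ k)"
      by (simp add: power_mult_distrib sum_distrib_left)
    finally have "(1 - s ^ k) * (\<Sum>t\<in>Fp. t ^ k) = 0" by (simp add: algebra_simps)
    then have "(\<Sum>t\<in>Fp. t ^ k) = 0" using s(3) by simp
    then show ?thesis using 3 by simp
  qed
qed

text \<open>Both sides are monic of degree p, so their difference has degree below p, yet it
  vanishes at the p elements of the prime field.\<close>

lemma prod_linear_Fp: "(\<Prod>t\<in>Fp. [:t, 1:]) = monom 1 p - monom 1 1"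
proof (rule ccontr)
  let ?l = "\<Prod>t\<in>Fp. [:t, 1:]" and ?r = "monom 1 p - monom 1 1 :: 'a poly"
  assume "?l \<noteq> ?r"
  then have nz: "?l - ?r \<noteq> 0" by simp
  have degl: "degree ?l = p" by (subst degree_prod_eq_sum_degree) (auto simp: card_Fp)
  have "lead_coeff ?l = 1" by (simp add: lead_coeff_prod)
  then have cl: "coeff ?l p = 1" by (simp only: degl)
  have "degree ?r \<le> p" using p_gt_1 by (intro degree_diff_le) (auto simp: degree_monom_eq)
  then have "degree (?l - ?r) \<le> p" by (rule degree_diff_le[OF eq_refl[OF degl]])
  moreover have "coeff (?l - ?r) p = 0" using cl p_gt_1 by simp
  ultimately have "degree (?l - ?r) < p"
    using eq_zero_or_degree_less nz by blast
  moreover have "Fp \<subseteq> {x. poly (?l - ?r) x = 0}"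
  proof
    fix x assume x: "x \<in> Fp"
    have "poly ?l x = (\<Prod>t\<in>Fp. t + x)" by (simp add: poly_prod)
    also have "\<dots> = 0" using x by (intro prod_zero) (auto intro!: bexI[of _ "- x"])
    finally show "x \<in> {x. poly (?l - ?r) x = 0}" using x by (simp add: poly_monom)
  qed
  then have "card Fp \<le> card {x. poly (?l - ?r) x = 0}"
    using poly_roots_finite[OF nz] by (rule card_mono[rotated])
  then have "p \<le> degree (?l - ?r)"
    using card_poly_roots_bound[OF nz] card_Fp by simp
  ultimately show False by simp
qed

text \<open>Carries a univariate identity over to forms in X and Y, by pairing the coefficient of
  degree k with the complementary power of X.\<close>

lemma homogenize_prod:
  fixes X Y :: "('v, 'a) mpoly"
  assumes "finite T"
  shows "(\<Prod>t\<in>T. Y + const_poly t * X) =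
    (\<Sum>k\<le>card T. const_poly (coeff (\<Prod>t\<in>T. [:t, 1:]) k) * X ^ (card T - k) * Y ^ k)"
  using assms
proof (induction T)
  case (insert s T)
  let ?q = "\<Prod>t\<in>T. [:t, 1:]" and ?n = "card T"
  have dq: "degree ?q = ?n" by (subst degree_prod_eq_sum_degree) auto
  have top: "coeff ?q (Suc ?n) = 0" by (rule coeff_eq_0) (simp add: dq)
  have coeff: "coeff ([:s, 1:] * ?q) k = s * coeff ?q k + (if k = 0 then 0 else coeff ?q (k - 1))"
    for k
    by (cases k) (simp_all add: coeff_pCons)
  have A: "(\<Sum>k\<le>Suc ?n. const_poly (s * coeff ?q k) * X ^ (Suc ?n - k) * Y ^ k) =
    const_poly s * X * (\<Sum>k\<le>?n. const_poly (coeff ?q k) * X ^ (?n - k) * Y ^ k)"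
  proof -
    have "(\<Sum>k\<le>Suc ?n. const_poly (s * coeff ?q k) * X ^ (Suc ?n - k) * Y ^ k) =
      (\<Sum>k\<le>?n. const_poly (s * coeff ?q k) * X ^ (Suc ?n - k) * Y ^ k)"
      by (simp add: top)
    also have "\<dots> = (\<Sum>k\<le>?n. const_poly s * X * (const_poly (coeff ?q k) * X ^ (?n - k) * Y ^ k))"
      by (intro sum.cong) (auto simp: const_poly_mult Suc_diff_le ac_simps)
    finally show ?thesis by (simp add: sum_distrib_left)
  qed
  have B: "(\<Sum>k\<le>Suc ?n. const_poly (if k = 0 then 0 else coeff ?q (k - 1)) * X ^ (Suc ?n - k) * Y ^
    k) =
    Y * (\<Sum>k\<le>?n. const_poly (coeff ?q k) * X ^ (?n - k) * Y ^ k)"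
    by (subst sum.atMost_Suc_shift) (simp add: sum_distrib_left ac_simps)
  let ?S = "\<Sum>k\<le>?n. const_poly (coeff ?q k) * X ^ (?n - k) * Y ^ k"
  have "(\<Sum>k\<le>Suc ?n. const_poly (coeff ([:s, 1:] * ?q) k) * X ^ (Suc ?n - k) * Y ^ k) =
    const_poly s * X * ?S + Y * ?S"
    unfolding A[symmetric] B[symmetric] sum.distrib[symmetric]
    by (intro sum.cong refl) (simp only: coeff const_poly_add distrib_right)
  also have "\<dots> = (Y + const_poly s * X) * (\<Prod>t\<in>T. Y + const_poly t * X)"
    unfolding insert.IH by (simp only: distrib_right add.commute)
  finally show ?case
    unfolding prod.insert[OF insert.hyps] card_insert_disjoint[OF insert.hyps] by (rule sym)
qed simp

lemma prod_Fp:
  fixes X Y :: "('v, 'a) mpoly"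
  shows "(\<Prod>t\<in>Fp. Y + const_poly t * X) = Y ^ p - X ^ (p - 1) * Y"
proof -
  have "(\<Prod>t\<in>Fp. Y + const_poly t * X) =
    (\<Sum>k\<le>p. const_poly (coeff (monom 1 p - monom 1 1 :: 'a poly) k) * X ^ (p - k) * Y ^ k)"
    unfolding homogenize_prod[OF finite_Fp] prod_linear_Fp card_Fp by (rule refl)
  also have "\<dots> = (\<Sum>k\<in>{1, p}. const_poly (coeff (monom 1 p - monom 1 1 :: 'a poly) k) * X ^ (p - k)
    * Y ^ k)"
    using p_gt_1 by (intro sum.mono_neutral_right) auto
  also have "\<dots> = Y ^ p - X ^ (p - 1) * Y"
    using p_gt_1 by (simp add: const_poly_uminus)
  finally show ?thesis .
qed

lemma frob_mpoly: "(f + g :: ('v, 'a) mpoly) ^ p = f ^ p + g ^ p"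
  by (rule freshmans_dream) (simp_all add: CHAR_mpoly char_p prime_p)

lemma minus_one_power_p1: "(-1 :: 'a) ^ (p - 1) = 1"
  by (rule fermat_Fp) auto

end

subsection \<open>Copies of the defining representation\<close>

abbreviation x_var :: "nat \<Rightarrow> (nat \<times> 2, 'a::field) mpoly" where "x_var i \<equiv> var_poly (i, 1)"
abbreviation y_var :: "nat \<Rightarrow> (nat \<times> 2, 'a::field) mpoly" where "y_var i \<equiv> var_poly (i, 2)"

lemma two_neq_one_2 [simp]: "(2 :: 2) \<noteq> 1" "(1 :: 2) \<noteq> 2"
  by simp_all

lemma forall_copies: "(\<forall>v :: nat \<times> 2. P v) \<longleftrightarrow> (\<forall>i. P (i, 1) \<and> P (i, 2))"
  by (auto simp: forall_2)

lemma alg_hom_eq_xy: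
  fixes \<phi> \<psi> :: "(nat \<times> 2, 'a::field) mpoly \<Rightarrow> ('w, 'a) mpoly"
  assumes "alg_hom \<phi>" "alg_hom \<psi>" "\<And>i. \<phi> (x_var i) = \<psi> (x_var i)" "\<And>i. \<phi> (y_var i) = \<psi> (y_var i)"
  shows "\<phi> f = \<psi> f"
proof (rule alg_hom_eq[OF assms(1,2)])
  fix v :: "nat \<times> 2"
  have "\<forall>v. \<phi> (var_poly v) = \<psi> (var_poly v)"
    unfolding forall_copies using assms(3,4) by blast
  then show "\<phi> (var_poly v) = \<psi> (var_poly v)" by blast
qed

lemma hom_deriv_eq_xy:
  fixes \<phi> :: "(nat \<times> 2, 'a::field) mpoly \<Rightarrow> ('w, 'a) mpoly"
  assumes "hom_deriv \<phi> \<delta>" "hom_deriv \<phi> \<delta>'" "\<And>i. \<delta> (x_var i) = \<delta>' (x_var i)" "\<And>i. \<delta> (y_var i) =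
    \<delta>' (y_var i)"
  shows "\<delta> f = \<delta>' f"
proof (rule hom_deriv_eq[OF assms(1,2)])
  fix v :: "nat \<times> 2"
  have "\<forall>v. \<delta> (var_poly v) = \<delta>' (var_poly v)"
    unfolding forall_copies using assms(3,4) by blast
  then show "\<delta> (var_poly v) = \<delta>' (var_poly v)" by blast
qed

text \<open>
  The substitution uses the matrix itself, not its inverse, so this is a right action; it has the
  same invariants as the left action \<^const>\<open>diag_action\<close>.
\<close>

definition act :: "'a \<Rightarrow> 'a \<Rightarrow> 'a \<Rightarrow> 'a \<Rightarrow> (nat \<times> 2, 'a::field) mpoly \<Rightarrow> (nat \<times> 2, 'a) mpoly" where
  "act a b c d = subst_poly (\<lambda>(i, k). if k = 1 then const_poly a * x_var i + const_poly b * y_var i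
     else const_poly c * x_var i + const_poly d * y_var i)"

lemma alg_hom_act: "alg_hom (act a b c d)"
  unfolding act_def by (rule alg_hom_subst)

interpretation act: alg_hom "act a b c d" for a b c d
  by (rule alg_hom_act)

lemma act_x [simp]: "act a b c d (x_var i) = const_poly a * x_var i + const_poly b * y_var i"
  and act_y [simp]: "act a b c d (y_var i) = const_poly c * x_var i + const_poly d * y_var i"
  by (simp_all add: act_def)

lemma act_act:
  "act a b c d (act a' b' c' d' f) =
    act (a' * a + b' * c) (a' * b + b' * d) (c' * a + d' * c) (c' * b + d' * d) f"
  by (rule alg_hom_eq_xy[OF alg_hom_comp[OF alg_hom_act alg_hom_act] alg_hom_act])
    (simp_all add: act.hom_simps const_poly_add const_poly_mult algebra_simps)

lemma act_id [simp]: "act 1 0 0 1 f = f"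
  by (rule alg_hom_eq_xy[OF alg_hom_act alg_hom_id]) simp_all

abbreviation shift :: "'a \<Rightarrow> (nat \<times> 2, 'a::field) mpoly \<Rightarrow> (nat \<times> 2, 'a) mpoly" where
  "shift t \<equiv> act 1 0 t 1"

lemma shift_shift: "shift s (shift t f) = shift (s + t) f"
  by (simp add: act_act add.commute)

definition minor :: "nat \<Rightarrow> nat \<Rightarrow> (nat \<times> 2, 'a::field) mpoly" where
  "minor i j = x_var i * y_var j - x_var j * y_var i"

definition x_prod :: "nat multiset \<Rightarrow> (nat \<times> 2, 'a::field) mpoly" where
  "x_prod A = (\<Prod>i\<in>#A. x_var i)"

definition y_prod :: "nat multiset \<Rightarrow> (nat \<times> 2, 'a::field) mpoly" where
  "y_prod A = (\<Prod>i\<in>#A. y_var i)"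

lemma x_prod_simps [simp]: "x_prod {#} = 1" "x_prod (add_mset i A) = x_var i * x_prod A" "x_prod
  (A + B) = x_prod A * x_prod B"
  by (simp_all add: x_prod_def)

lemma y_prod_simps [simp]: "y_prod {#} = 1" "y_prod (add_mset i A) = y_var i * y_prod A" "y_prod
  (A + B) = y_prod A * y_prod B"
  by (simp_all add: y_prod_def)

lemma x_prod_replicate: "x_prod (replicate_mset n i) = x_var i ^ n"
  by (induction n) simp_all

lemma y_prod_replicate: "y_prod (replicate_mset n i) = y_var i ^ n"
  by (induction n) simp_all

lemma act_minor: "act a b c d (minor i j) = const_poly (a * d - b * c) * minor i j"
  by (simp add: minor_def act.hom_simps const_poly_diff const_poly_mult algebra_simps)

section \<open>Degrees in single copies\<close>

definition copy_degree :: "nat \<Rightarrow> (nat \<times> 2 \<Rightarrow>\<^sub>0 nat) \<Rightarrow> nat" where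
  "copy_degree i t = Poly_Mapping.lookup t (i, 1) + Poly_Mapping.lookup t (i, 2)"

interpretation mono_degree: additive_weight mono_degree
  by unfold_locales (rule mono_degree_add)

interpretation copy_degree: additive_weight "copy_degree i" for i
  by unfold_locales (simp add: copy_degree_def lookup_add)

lemma copy_degree_single [simp]:
  "copy_degree i (Poly_Mapping.single (j, k) n) = (if i = j then n else 0)"
proof -
  have "k = 1 \<or> k = 2" by (rule exhaust_2)
  then show ?thesis by (auto simp: copy_degree_def lookup_single_if)
qed

lemma copy_degree_le: "i \<noteq> j \<Longrightarrow> copy_degree i t + copy_degree j t \<le> mono_degree t"
proof (induction t rule: mono_induct)
  case zero
  then show ?case by (simp add: copy_degree.weight_0)
next
  case (add v t)
  then show ?case by (cases v) (auto simp: copy_degree.weight_add mono_degree_add)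
qed

lemma homogeneous_xy:
  "weight_homogeneous (copy_degree i) (if i = j then 1 else 0) (x_var j)"
  "weight_homogeneous (copy_degree i) (if i = j then 1 else 0) (y_var j)"
  "weight_homogeneous mono_degree 1 (x_var j)"
  "weight_homogeneous mono_degree 1 (y_var j)"
  by (rule copy_degree.homogeneous_var[of i "(j, 1)", unfolded copy_degree_single]
      copy_degree.homogeneous_var[of i "(j, 2)", unfolded copy_degree_single]
      mono_degree.homogeneous_var[of "(j, 1)", unfolded mono_degree_single]
      mono_degree.homogeneous_var[of "(j, 2)", unfolded mono_degree_single])+

lemma copy_degree_act_single:
  "weight_homogeneous (copy_degree i) (copy_degree i t) (act a b c d (Poly_Mapping.single t k))"
proof (rule hom_single_homogeneous[OF alg_hom_act copy_degree.additive_weight_axioms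
  copy_degree.additive_weight_axioms])
  fix v :: "nat \<times> 2"
  obtain j k where v: "v = (j, k)" by (cases v)
  have k: "k = 1 \<or> k = 2" by (rule exhaust_2)
  show "weight_homogeneous (copy_degree i) (copy_degree i (Poly_Mapping.single v 1)) (act a b c d
    (var_poly v))"
    unfolding v copy_degree_single using k
    by (elim disjE)
      (simp_all only: act_x act_y weight_homogeneous_add copy_degree.homogeneous_const_mult
        homogeneous_xy)
qed

lemma mono_degree_act_single:
  "weight_homogeneous mono_degree (mono_degree t) (act a b c d (Poly_Mapping.single t k))"
proof (rule hom_single_homogeneous[OF alg_hom_act mono_degree.additive_weight_axioms
  mono_degree.additive_weight_axioms])
  fix v :: "nat \<times> 2"
  obtain j k where v: "v = (j, k)" by (cases v)
  have k: "k = 1 \<or> k = 2" by (rule exhaust_2)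
  show "weight_homogeneous mono_degree (mono_degree (Poly_Mapping.single v 1)) (act a b c d
    (var_poly v))"
    unfolding v mono_degree_single using k
    by (elim disjE)
      (simp_all only: act_x act_y weight_homogeneous_add mono_degree.homogeneous_const_mult
        homogeneous_xy)
qed

lemma mono_degree_part_act:
  "weight_part mono_degree d (act a b c e f) = act a b c e (weight_part mono_degree d f)"
  by (rule weight_part_hom[OF act.hom_add mono_degree_act_single act.hom_0])

definition multidegree :: "(nat \<times> 2 \<Rightarrow>\<^sub>0 nat) \<Rightarrow> nat \<Rightarrow> nat" where
  "multidegree t = (\<lambda>i. copy_degree i t)"

lemma multidegree_part_act:
  "weight_part multidegree d (act a b c e f) = act a b c e (weight_part multidegree d f)"
proof (rule weight_part_hom[OF act.hom_add _ act.hom_0])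
  fix t :: "nat \<times> 2 \<Rightarrow>\<^sub>0 nat" and k :: 'a
  have "weight_homogeneous (copy_degree i) (copy_degree i t) (act a b c e (Poly_Mapping.single t
    k))" for i
    by (rule copy_degree_act_single)
  then show "weight_homogeneous multidegree (multidegree t) (act a b c e (Poly_Mapping.single t k))"
    unfolding weight_homogeneous_def multidegree_def by (simp add: fun_eq_iff)
qed

section \<open>Polarization and the Capelli identity\<close>

definition polarize :: "nat \<Rightarrow> nat \<Rightarrow> (nat \<times> 2, 'a::field) mpoly \<Rightarrow> (nat \<times> 2, 'a) mpoly" where
  "polarize i j f = x_var j * partial_deriv (i, 1) f + y_var j * partial_deriv (i, 2) f"

interpretation polarize: hom_deriv "\<lambda>f :: (nat \<times> 2, 'a::field) mpoly. f" "polarize i j" for i j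
  by unfold_locales
    (simp_all add: polarize_def partial_deriv_add partial_deriv_mult algebra_simps)

lemma polarize_x [simp]: "polarize i j (x_var k) = (if k = i then x_var j else 0)"
  and polarize_y [simp]: "polarize i j (y_var k) = (if k = i then y_var j else 0)"
  by (simp_all add: polarize_def partial_deriv_var)

lemma polarize_const_mult: "polarize i j (const_poly c * f) = const_poly c * polarize i j f"
  by (simp add: polarize.deriv_mult polarize.deriv_const)

text \<open>Polarization exchanges copies, while the group acts in the same way inside each copy.
  Both composites are derivations along \<open>act a b c d\<close>, so the variables decide.\<close>

lemma polarize_act: "polarize i j (act a b c d f) = act a b c d (polarize i j f)"
proof (rule hom_deriv_eq_xy[of "act a b c d" "\<lambda>f. polarize i j (act a b c d f)" "\<lambda>f. act a b c d
  (polarize i j f)"])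
  show "hom_deriv (act a b c d) (\<lambda>f. polarize i j (act a b c d f))"
    by unfold_locales
      (simp_all add: act.hom_simps polarize.deriv_add polarize.deriv_mult polarize.deriv_const)
  show "hom_deriv (act a b c d) (\<lambda>f. act a b c d (polarize i j f))"
    by unfold_locales
      (simp_all add: act.hom_simps polarize.deriv_add polarize.deriv_mult polarize.deriv_const)
  fix k :: nat
  show "polarize i j (act a b c d (x_var k)) = act a b c d (polarize i j (x_var k))"
    by (simp add: polarize.deriv_add polarize_const_mult act.hom_0)
  show "polarize i j (act a b c d (y_var k)) = act a b c d (polarize i j (y_var k))"
    by (simp add: polarize.deriv_add polarize_const_mult act.hom_0)
qed

lemma polarize_self_single:
  "polarize i i (Poly_Mapping.single t c) = of_nat (copy_degree i t) * Poly_Mapping.single t c"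
proof (induction t rule: mono_induct)
  case zero
  then show ?case
    by (simp add: copy_degree.weight_0 polarize.deriv_const flip: const_poly_def)
next
  case (add v t)
  obtain j k where v: "v = (j, k)" by (cases v)
  have k: "k = 1 \<or> k = 2" by (rule exhaust_2)
  then have h: "polarize i i (var_poly v) = of_nat (copy_degree i (Poly_Mapping.single v 1)) *
    var_poly v"
    unfolding v copy_degree_single by (elim disjE) simp_all
  then show ?case
    unfolding single_var_times polarize.deriv_mult add copy_degree.weight_add of_nat_add h
    by (simp only: distrib_right distrib_left mult_ac)
qed

text \<open>Euler's identity in the variables of one copy; the degree counts only modulo the
  characteristic.\<close>

lemma euler:
  assumes "weight_homogeneous (copy_degree i) d f"
  shows "polarize i i f = of_nat d * f"
proof -
  have "polarize i i f = (\<Sum>t\<in>Poly_Mapping.keys f. polarize i i (Poly_Mapping.single t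
    (Poly_Mapping.lookup f t)))"
    by (subst (1) mpoly_monomial_sum[of f]) (rule polarize.deriv_sum)
  also have "\<dots> = (\<Sum>t\<in>Poly_Mapping.keys f. of_nat d * Poly_Mapping.single t (Poly_Mapping.lookup f
    t))"
    using assms by (intro sum.cong refl) (simp add: polarize_self_single weight_homogeneous_def)
  also have "\<dots> = of_nat d * f"
    unfolding sum_distrib_left[symmetric] using mpoly_monomial_sum[of f] by simp
  finally show ?thesis .
qed

text \<open>Cayley's Omega operator, the determinant of partial derivatives dual to
  \<open>minor i j\<close>.\<close>

definition omega_process :: "nat \<Rightarrow> nat \<Rightarrow> (nat \<times> 2, 'a::field) mpoly \<Rightarrow> (nat \<times> 2, 'a) mpoly" where
  "omega_process i j f = partial_deriv (i, 1) (partial_deriv (j, 2) f) - partial_deriv (i, 2)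
    (partial_deriv (j, 1) f)"

text \<open>
  The Capelli identity for two copies. For $r < p - 1$ and $0 < d < p$ the factor on the left is
  invertible in characteristic $p$, so that modulo \<^term>\<open>minor i j\<close> an invariant is a polarization
  of one that has smaller degree in the copy $j$.
\<close>

lemma capelli:
  assumes ij: "i \<noteq> j" and "weight_homogeneous (copy_degree i) r f" "weight_homogeneous
    (copy_degree j) d f"
  shows "of_nat ((r + 1) * d) * f = polarize i j (polarize j i f) + minor i j * omega_process i j f"
proof -
  have 1: "polarize i j (polarize j i f) = polarize j j f +
     x_var i * polarize i j (partial_deriv (j, 1) f) + y_var i * polarize i j (partial_deriv (j,
       2) f)"
    unfolding polarize_def[of j] polarize.deriv_add polarize.deriv_mult by (simp add: algebra_simps)
  have 2: "polarize i i (polarize j j f) =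
     x_var j * polarize i i (partial_deriv (j, 1) f) + y_var j * polarize i i (partial_deriv (j,
       2) f)"
    unfolding polarize_def[of j j] polarize.deriv_add polarize.deriv_mult using ij by simp
  have 3: "polarize j j f = of_nat d * f" by (rule euler[OF assms(3)])
  have 4: "polarize i i (polarize j j f) = of_nat (r * d) * f"
    unfolding 3 using polarize_const_mult[of i i "of_nat d" f]
    unfolding const_poly_of_nat euler[OF assms(2)] by (simp only: of_nat_mult mult_ac)
  have "of_nat ((r + 1) * d) * f = polarize i i (polarize j j f) + polarize j j f"
    unfolding 4 unfolding 3 by (simp add: algebra_simps)
  also have "\<dots> = polarize i j (polarize j i f) + minor i j * omega_process i j f"
    unfolding 1 2 unfolding polarize_def[of i] omega_process_def minor_def
      by (simp add: algebra_simps)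
  finally show ?thesis .
qed

lemma keys_partial_deriv:
  assumes "s \<in> Poly_Mapping.keys (partial_deriv v f)"
  shows "Poly_Mapping.single v 1 + s \<in> Poly_Mapping.keys f"
proof -
  have "s \<in> (\<Union>t\<in>Poly_Mapping.keys f. Poly_Mapping.keys (Poly_Mapping.single
    (t - Poly_Mapping.single v 1)
       (of_nat (Poly_Mapping.lookup t v) * Poly_Mapping.lookup f t)))"
    using assms unfolding partial_deriv_def by (rule subsetD[OF Poly_Mapping.keys_sum])
  then obtain t where t: "t \<in> Poly_Mapping.keys f" "s = t - Poly_Mapping.single v 1"
    "Poly_Mapping.lookup t v \<noteq> 0"
    by (force split: if_splits)
  then show ?thesis using single_split[of v t] by (simp add: in_keys_iff)
qed

lemma keys_var_mult:
  assumes "s \<in> Poly_Mapping.keys (var_poly v * f)"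
  shows "\<exists>r. s = Poly_Mapping.single v 1 + r \<and> r \<in> Poly_Mapping.keys f"
  using assms keys_mult[of "var_poly v" f] by (auto simp: var_poly_def split: if_splits)

text \<open>The exponents are related by an equation between sums, with the removed variable added
  back, so that any additive weight can be applied to both sides without truncated
  subtraction.\<close>

lemma keys_polarize:
  assumes "s \<in> Poly_Mapping.keys (polarize i j f)"
  shows "\<exists>k. \<exists>t\<in>Poly_Mapping.keys f. s + Poly_Mapping.single (i, k) 1 = Poly_Mapping.single (j, k)
    1 + t"
proof -
  have "s \<in> Poly_Mapping.keys (x_var j * partial_deriv (i, 1) f) \<or> s \<in> Poly_Mapping.keys
    (y_var j * partial_deriv (i, 2) f)"
    using subsetD[OF Poly_Mapping.keys_add assms[unfolded polarize_def]] by blast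
  then obtain k where k: "s \<in> Poly_Mapping.keys (var_poly (j, k) * partial_deriv (i, k) f)" by blast
  obtain r where r: "s = Poly_Mapping.single (j, k) 1 + r" "r \<in> Poly_Mapping.keys (partial_deriv
    (i, k) f)"
    using keys_var_mult[OF k] by blast
  then have "Poly_Mapping.single (i, k) 1 + r \<in> Poly_Mapping.keys f" by (intro keys_partial_deriv)
  then show ?thesis
    by (intro exI[of _ k] bexI[of _ "Poly_Mapping.single (i, k) 1 + r"]) (simp_all add:
      r(1) ac_simps)
qed

section \<open>Restriction to the lines \<open>y_i = - s x_i\<close> in one copy\<close>

definition specialize :: "nat \<Rightarrow> 'a \<Rightarrow> (nat \<times> 2, 'a::field) mpoly \<Rightarrow> (nat \<times> 2, 'a) mpoly" where
  "specialize i s = subst_poly (\<lambda>v. if v = (i, 2) then const_poly (- s) * x_var i else var_poly v)"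

lemma alg_hom_specialize: "alg_hom (specialize i s)"
  unfolding specialize_def by (rule alg_hom_subst)

interpretation specialize: alg_hom "specialize i s" for i s
  by (rule alg_hom_specialize)

lemma specialize_x [simp]: "specialize i s (x_var j) = x_var j"
  and specialize_y [simp]: "specialize i s (y_var j) = (if i = j then const_poly (- s) * x_var i
    else y_var j)"
  by (auto simp: specialize_def)

text \<open>The shift by s relates the line y_i = - s x_i to y_i = 0. For a P-invariant, the values
  on all these lines with s in the prime field are thus determined by those on y_i = 0.\<close>

lemma specialize_shift: "specialize i s (shift s f) = shift s (specialize i 0 f)"
  by (rule alg_hom_eq_xy[OF alg_hom_comp[OF alg_hom_specialize alg_hom_act] alg_hom_comp[OF
    alg_hom_act alg_hom_specialize]])
    (simp_all add: specialize.hom_simps act.hom_simps const_poly_uminus)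

lemma specialize_shift_specialize: "specialize i s (shift t (specialize i 0 f)) =
  shift t (specialize i 0 f)"
  by (rule alg_hom_eq_xy[OF alg_hom_comp[OF alg_hom_specialize alg_hom_comp[OF alg_hom_act
    alg_hom_specialize]]
    alg_hom_comp[OF alg_hom_act alg_hom_specialize]])
    (simp_all add: specialize.hom_simps act.hom_simps)

lemma specialize_specialize: "specialize i 0 (specialize i 0 f) = specialize i 0 f"
  by (rule alg_hom_eq_xy[OF alg_hom_comp[OF alg_hom_specialize alg_hom_specialize]
    alg_hom_specialize])
    (simp_all add: specialize.hom_simps)

lemma dvd_specialize: "y_var i + const_poly s * x_var i dvd f - specialize i s f"
proof -
  have "\<forall>v. y_var i + const_poly s * x_var i dvd var_poly v - specialize i s (var_poly v)"
    unfolding forall_copies by (simp add: const_poly_uminus)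
  then have "y_var i + const_poly s * x_var i dvd var_poly v - specialize i s (var_poly v)" for v
    by blast
  then show ?thesis by (rule alg_hom_cong_mod[OF alg_hom_id alg_hom_specialize])
qed

text \<open>A monomial containing y_i is sent to 0; any other keeps its whole degree in copy i as a
  power of x_i.\<close>

lemma power_dvd_specialize_single:
  "n \<le> copy_degree i t \<Longrightarrow> x_var i ^ n dvd specialize i 0 (Poly_Mapping.single t c)"
proof (induction t arbitrary: n rule: mono_induct)
  case zero
  then show ?case by (simp add: copy_degree.weight_0)
next
  case (add v t)
  obtain j k where v: "v = (j, k)" by (cases v)
  consider "i \<noteq> j" | "i = j" "k = 1" | "i = j" "k = 2" using exhaust_2[of k] by blast
  then show ?case
  proof cases
    case 1
    then have "n \<le> copy_degree i t" using add.prems by (simp add: v copy_degree.weight_add)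
    then show ?thesis using add.IH unfolding single_var_times specialize.hom_mult
      by (simp add: dvd_mult)
  next
    case 2
    then have "n - 1 \<le> copy_degree i t" using add.prems by (simp add: v copy_degree.weight_add)
    then have "x_var i * x_var i ^ (n - 1) dvd x_var i * specialize i 0 (Poly_Mapping.single t c)"
      using add.IH by (intro mult_dvd_mono) simp_all
    then have "x_var i ^ n dvd x_var i * specialize i 0 (Poly_Mapping.single t c)"
      by (cases n) simp_all
    then show ?thesis unfolding single_var_times specialize.hom_mult using 2 by (simp add: v)
  next
    case 3
    then show ?thesis unfolding single_var_times specialize.hom_mult by (simp add: v)
  qed
qed

lemma power_dvd_specialize:
  assumes "\<And>t. t \<in> Poly_Mapping.keys f \<Longrightarrow> n \<le> copy_degree i t"
  shows "x_var i ^ n dvd specialize i 0 f"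
  by (subst mpoly_monomial_sum) (auto simp: specialize.hom_sum intro!:
    dvd_sum power_dvd_specialize_single assms)

lemma specialize_single_const:
  assumes "\<And>j. j \<noteq> i \<Longrightarrow> copy_degree j t = 0"
  shows "\<exists>c'. specialize i 0 (Poly_Mapping.single t c) = const_poly c' * x_var i ^ copy_degree i t"
  using assms
proof (induction t rule: mono_induct)
  case zero
  have "specialize i 0 (Poly_Mapping.single 0 c) = const_poly c * x_var i ^ copy_degree i 0"
    using specialize.hom_const[of i 0 c] by (simp add: const_poly_def copy_degree.weight_0)
  then show ?case by blast
next
  case (add v t)
  obtain j k where v: "v = (j, k)" by (cases v)
  have ij: "i = j"
    using add.prems[of j] by (auto simp: v copy_degree.weight_add)
  have "copy_degree l t = 0" if "l \<noteq> i" for l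
    using add.prems[OF that] by (simp add: copy_degree.weight_add)
  then obtain c' where c': "specialize i 0 (Poly_Mapping.single t c) = const_poly c' * x_var i ^
    copy_degree i t"
    using add.IH by blast
  have "k = 1 \<or> k = 2" by (rule exhaust_2)
  then show ?case
  proof
    assume "k = 1"
    then show ?thesis unfolding single_var_times specialize.hom_mult c'
      by (intro exI[of _ c']) (simp add: v ij copy_degree.weight_add algebra_simps)
  next
    assume "k = 2"
    then show ?thesis unfolding single_var_times specialize.hom_mult c'
      by (intro exI[of _ 0]) (simp add: v ij)
  qed
qed

lemma specialize_const:
  assumes "\<And>t j. t \<in> Poly_Mapping.keys f \<Longrightarrow> j \<noteq> i \<Longrightarrow> copy_degree j t = 0"
    and "weight_homogeneous (copy_degree i) d f"
  shows "\<exists>c. specialize i 0 f = const_poly c * x_var i ^ d"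
proof -
  have "\<exists>c. specialize i 0 (\<Sum>t\<in>T. Poly_Mapping.single t (Poly_Mapping.lookup f t)) =
    const_poly c * x_var i ^ d"
    if "finite T" "T \<subseteq> Poly_Mapping.keys f" for T
    using that
  proof (induction T)
    case empty
    show ?case by (rule exI[of _ 0]) (simp add: specialize.hom_0)
  next
    case (insert t T)
    then obtain c where c: "specialize i 0 (\<Sum>t\<in>T. Poly_Mapping.single t (Poly_Mapping.lookup f t))
      = const_poly c * x_var i ^ d"
      by blast
    have t: "t \<in> Poly_Mapping.keys f" using insert.prems by blast
    then have "copy_degree i t = d" using assms(2) by (simp add: weight_homogeneous_def)
    moreover obtain c' where "specialize i 0 (Poly_Mapping.single t (Poly_Mapping.lookup f t)) =
      const_poly c' * x_var i ^ copy_degree i t"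
      using specialize_single_const assms(1)[OF t] by blast
    ultimately have "specialize i 0 (\<Sum>t\<in>insert t T. Poly_Mapping.single t (Poly_Mapping.lookup f
      t)) = const_poly (c' + c) * x_var i ^ d"
      using insert.hyps c by (simp add: specialize.hom_add const_poly_add distrib_right)
    then show ?case by blast
  qed
  from this[of "Poly_Mapping.keys f"] show ?thesis using mpoly_monomial_sum[of f] by simp
qed

lemma mpoly_prod_nonzero:
  fixes h :: "'b \<Rightarrow> ('v::countable, 'a::idom) mpoly"
  assumes "\<And>x. x \<in> A \<Longrightarrow> h x \<noteq> 0"
  shows "prod h A \<noteq> 0"
  using assms
proof (induction A rule: infinite_finite_induct)
  case (insert x A)
  then show ?case using mpoly_mult_eq_0[of "h x" "prod h A"] by auto
qed simp_all

text \<open>The linear factors are split off one at a time: on the line of s each factor already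
  removed becomes (t - s) x_i with t distinct from s, so the vanishing passes to the
  quotient.\<close>

lemma linear_dvd:
  assumes "finite T" "\<And>s. s \<in> T \<Longrightarrow> specialize i s f = 0"
  shows "(\<Prod>t\<in>T. y_var i + const_poly t * x_var i) dvd f"
  using assms
proof (induction T)
  case (insert s T)
  let ?l = "\<lambda>t. y_var i + const_poly t * x_var i"
  obtain q where q: "f = (\<Prod>t\<in>T. ?l t) * q" using insert by (auto elim: dvdE)
  have "specialize i s (?l t) = const_poly (t - s) * x_var i" for t
    by (simp add: specialize.hom_simps const_poly_diff const_poly_uminus algebra_simps)
  then have "(\<Prod>t\<in>T. const_poly (t - s) * x_var i) * specialize i s q = 0"
    using insert.prems[of s] unfolding q by (simp add: specialize.hom_mult specialize.hom_prod)
  moreover have "(\<Prod>t\<in>T. const_poly (t - s) * x_var i) \<noteq> 0"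
  proof (rule mpoly_prod_nonzero)
    fix t assume "t \<in> T"
    then have "t - s \<noteq> 0" using insert.hyps by auto
    then show "const_poly (t - s) * x_var i \<noteq> 0"
      using mpoly_mult_eq_0[of "const_poly (t - s)" "x_var i"] by auto
  qed
  ultimately have "specialize i s q = 0" using mpoly_mult_eq_0 by blast
  then have "?l s dvd q" using dvd_specialize[of i s q] by simp
  then have "?l s * (\<Prod>t\<in>T. ?l t) dvd f" unfolding q by (subst mult.commute) (intro mult_dvd_mono
    dvd_refl)
  then show ?case using insert.hyps by simp
qed simp

subsection \<open>Invariants of the unipotent subgroup\<close>

context prime_char
begin

definition unip_inv :: "(nat \<times> 2, 'a) mpoly set" where
  "unip_inv = {f. \<forall>t\<in>Fp. shift t f = f}"

definition unip_transfer :: "(nat \<times> 2, 'a) mpoly \<Rightarrow> (nat \<times> 2, 'a) mpoly" where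
  "unip_transfer f = (\<Sum>t\<in>Fp. shift t f)"

definition norm_y :: "nat \<Rightarrow> (nat \<times> 2, 'a) mpoly" where
  "norm_y i = y_var i ^ p - x_var i ^ (p - 1) * y_var i"

definition norm_prod :: "nat multiset \<Rightarrow> (nat \<times> 2, 'a) mpoly" where
  "norm_prod A = (\<Prod>i\<in>#A. norm_y i)"

lemma norm_prod_simps [simp]: "norm_prod {#} = 1" "norm_prod (add_mset i A) = norm_y i * norm_prod
  A" "norm_prod (A + B) = norm_prod A * norm_prod B"
  by (simp_all add: norm_prod_def)

lemma x_power_p: "(x_var i :: (nat \<times> 2, 'a) mpoly) ^ p = x_var i ^ (p - 1) * x_var i"
  using p_pos by (simp flip: power_Suc2)

lemma y_power_p: "y_var i ^ p = norm_y i + x_var i ^ (p - 1) * y_var i"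
  by (simp add: norm_y_def)

lemma const_power_p: "t \<in> Fp \<Longrightarrow> (const_poly t :: (nat \<times> 2, 'a) mpoly) ^ p = const_poly t"
  using frob_Fp[of t] by (metis const_poly_power)

lemma shift_norm_y: "t \<in> Fp \<Longrightarrow> shift t (norm_y i) = norm_y i"
  by (simp add: norm_y_def act.hom_simps frob_mpoly power_mult_distrib const_power_p x_power_p
    algebra_simps)

lemma unip_inv_iff: "f \<in> unip_inv \<longleftrightarrow> (\<forall>t\<in>Fp. shift t f = f)"
  by (simp add: unip_inv_def)

lemma unip_inv_add [intro]: "f \<in> unip_inv \<Longrightarrow> g \<in> unip_inv \<Longrightarrow> f + g \<in> unip_inv"
  and unip_inv_diff [intro]: "f \<in> unip_inv \<Longrightarrow> g \<in> unip_inv \<Longrightarrow> f - g \<in> unip_inv"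
  and unip_inv_mult [intro]: "f \<in> unip_inv \<Longrightarrow> g \<in> unip_inv \<Longrightarrow> f * g \<in> unip_inv"
  and unip_inv_uminus [intro]: "f \<in> unip_inv \<Longrightarrow> - f \<in> unip_inv"
  and unip_inv_const [intro]: "const_poly c \<in> unip_inv"
  and unip_inv_0 [intro]: "0 \<in> unip_inv"
  and unip_inv_1 [intro]: "1 \<in> unip_inv"
  and unip_inv_x [intro]: "x_var i \<in> unip_inv"
  and unip_inv_norm_y [intro]: "norm_y i \<in> unip_inv"
  and unip_inv_minor [intro]: "minor i j \<in> unip_inv"
  and unip_inv_power [intro]: "f \<in> unip_inv \<Longrightarrow> f ^ n \<in> unip_inv"
  by (simp_all add: unip_inv_iff act.hom_simps shift_norm_y act_minor)

lemma unip_inv_x_prod [intro]: "x_prod A \<in> unip_inv"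
  by (induction A) auto

lemma unip_inv_norm_prod [intro]: "norm_prod A \<in> unip_inv"
  by (induction A) auto

lemma unip_inv_polarize [intro]: "f \<in> unip_inv \<Longrightarrow> polarize i j f \<in> unip_inv"
  unfolding unip_inv_iff polarize_act[symmetric] by simp

lemma unip_inv_part: "f \<in> unip_inv \<Longrightarrow> weight_part mono_degree d f \<in> unip_inv"
  unfolding unip_inv_iff mono_degree_part_act[symmetric] by simp

lemma unip_inv_multidegree_part: "f \<in> unip_inv \<Longrightarrow> weight_part multidegree d f \<in> unip_inv"
  unfolding unip_inv_iff multidegree_part_act[symmetric] by simp

lemma unip_transfer_unip_inv [intro]: "unip_transfer f \<in> unip_inv"
  unfolding unip_inv_iff
proof
  fix s assume s: "s \<in> Fp"
  have "shift s (unip_transfer f) = (\<Sum>t\<in>Fp. shift (s + t) f)"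
    by (simp add: unip_transfer_def act.hom_sum shift_shift)
  also have "\<dots> = unip_transfer f"
    unfolding unip_transfer_def
    by (rule sum.reindex_bij_witness[where i = "\<lambda>t. t - s" and j = "\<lambda>t. s + t"]) (simp_all add: s)
  finally show "shift s (unip_transfer f) = unip_transfer f" .
qed

lemma unip_transfer_add: "unip_transfer (f + g) = unip_transfer f + unip_transfer g"
  and unip_transfer_diff: "unip_transfer (f - g) = unip_transfer f - unip_transfer g"
  and unip_transfer_0 [simp]: "unip_transfer 0 = 0"
  by (simp_all add: unip_transfer_def act.hom_simps sum.distrib sum_subtractf)

lemma unip_transfer_mult: "q \<in> unip_inv \<Longrightarrow> unip_transfer (q * f) = q * unip_transfer f"
  by (simp add: unip_transfer_def act.hom_mult unip_inv_iff sum_distrib_left)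

lemma unip_transfer_polarize: "polarize i j (unip_transfer f) = unip_transfer (polarize i j f)"
  by (simp add: unip_transfer_def polarize.deriv_sum polarize_act)

lemma unip_transfer_part: "weight_part mono_degree d (unip_transfer f) =
  unip_transfer (weight_part mono_degree d f)"
  by (simp add: unip_transfer_def weight_part_sum mono_degree_part_act)

text \<open>The norm is the product over the P-orbit of y_i, and its factors are the linear forms
  that vanish on the lines of interpolation.\<close>

lemma norm_y_prod: "norm_y i = (\<Prod>t\<in>Fp. y_var i + const_poly t * x_var i)"
  by (simp add: prod_Fp norm_y_def)

lemma norm_y_nonzero: "norm_y i \<noteq> 0"
  unfolding norm_y_prod
proof (rule mpoly_prod_nonzero)
  fix t
  show "y_var i + const_poly t * x_var i \<noteq> 0"
  proof
    assume "y_var i + const_poly t * x_var i = 0"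
    then have "act 0 0 0 1 (y_var i + const_poly t * x_var i) = 0" by (simp only: act.hom_0)
    then show False by (simp add: act.hom_simps)
  qed
qed

lemma norm_y_homogeneous: "weight_homogeneous mono_degree p (norm_y i)"
proof -
  have "weight_homogeneous mono_degree (p * 1) (y_var i ^ p :: (nat \<times> 2, 'a) mpoly)"
    by (intro mono_degree.homogeneous_power homogeneous_xy)
  moreover have "weight_homogeneous mono_degree ((p - 1) * 1 + 1) (x_var i ^ (p - 1) * y_var i ::
    (nat \<times> 2, 'a) mpoly)"
    by (intro mono_degree.homogeneous_power mono_degree.homogeneous_mult homogeneous_xy)
  ultimately show ?thesis
    unfolding norm_y_def using p_pos by (simp add: weight_homogeneous_diff)
qed

text \<open>The quotient inherits the invariance because the norm is invariant and can be
  cancelled.\<close>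

lemma unip_inv_division:
  assumes f: "f \<in> unip_inv" and specialize: "\<And>s. s \<in> Fp \<Longrightarrow> specialize i s f = 0"
  shows "\<exists>q\<in>unip_inv. f = norm_y i * q"
proof -
  have "norm_y i dvd f" unfolding norm_y_prod by (rule linear_dvd) (simp_all add: specialize)
  then obtain q where q: "f = norm_y i * q" by (rule dvdE)
  have "shift t q = q" if t: "t \<in> Fp" for t
  proof (rule mpoly_mult_left_cancel[OF _ norm_y_nonzero])
    show "norm_y i * shift t q = norm_y i * q"
      using f t unfolding q unip_inv_iff by (simp add: act.hom_mult shift_norm_y)
  qed
  then show ?thesis using q by (auto simp: unip_inv_iff)
qed

text \<open>
  Interpolation along the lines $y_i = - s x_i$: on each of them the transfer chosen here has the
  same values as \<open>f\<close>, because $1 - (t - s)^{p - 1}$ vanishes for $t \neq s$.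
\<close>

lemma unip_inv_trace_division:
  assumes f: "f \<in> unip_inv" and k: "specialize i 0 f = x_var i ^ (p - 1) * k"
  shows "\<exists>h. \<exists>q\<in>unip_inv. f = unip_transfer h + norm_y i * q"
proof -
  \<comment> \<open>A second specialization removes y_i from the cofactor, so that its shifts are
    not affected by further specialization (\<open>k'2\<close>).\<close>
  define k' where "k' = specialize i 0 k"
  have k': "specialize i 0 f = x_var i ^ (p - 1) * k'"
    using arg_cong[OF k, of "specialize i 0"] by (simp add: specialize_specialize
      specialize.hom_simps k'_def)
  have k'2: "specialize i s (shift t k') = shift t k'" for s t
    unfolding k'_def by (rule specialize_shift_specialize)
  define h where "h = k' * (x_var i ^ (p - 1) - y_var i ^ (p - 1))"
  have "specialize i s (f - unip_transfer h) = 0" if s: "s \<in> Fp" for s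
  proof -
    have "specialize i s f = specialize i s (shift s f)" using f s by (simp add: unip_inv_iff)
    also have "\<dots> = x_var i ^ (p - 1) * shift s k'"
      unfolding specialize_shift k' by (simp add: act.hom_simps)
    finally have 1: "specialize i s f = x_var i ^ (p - 1) * shift s k'" .
    have 2: "specialize i s (shift t h) = (if t = s then x_var i ^ (p - 1) * shift s k' else 0)"
      if t: "t \<in> Fp" for t
    proof -
      have y: "specialize i s (shift t (y_var i)) = const_poly (t - s) * x_var i"
        by (simp add: specialize.hom_simps const_poly_diff const_poly_uminus algebra_simps)
      have "specialize i s (shift t h) = shift t k' * (x_var i ^ (p - 1) - (const_poly (t - s) *
        x_var i) ^ (p - 1))"
        unfolding h_def act.hom_mult specialize.hom_mult k'2 act.hom_diff specialize.hom_diff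
          act.hom_power specialize.hom_power y
        by simp
      also have "\<dots> = shift t k' * (const_poly (1 - (t - s) ^ (p - 1)) * x_var i ^ (p - 1))"
        unfolding const_poly_diff[of 1] const_poly_power power_mult_distrib
        by (simp add: left_diff_distrib)
      finally show ?thesis using delta_Fp[of "t - s"] s t by simp
    qed
    have "specialize i s (unip_transfer h) = (\<Sum>t\<in>Fp. specialize i s (shift t h))"
      by (simp add: unip_transfer_def specialize.hom_sum)
    also have "\<dots> = (\<Sum>t\<in>Fp. if t = s then x_var i ^ (p - 1) * shift s k' else 0)"
      by (intro sum.cong refl 2)
    also have "\<dots> = specialize i s f" using s by (simp add: 1)
    finally show ?thesis by (simp add: specialize.hom_diff)
  qed
  moreover have "f - unip_transfer h \<in> unip_inv" using f by blast
  ultimately obtain q where "q \<in> unip_inv" "f - unip_transfer h = norm_y i * q" using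
    unip_inv_division by blast
  then have "f = unip_transfer h + norm_y i * q" by (simp add: algebra_simps)
  then show ?thesis using \<open>q \<in> unip_inv\<close> by blast
qed

section \<open>The structure of the P-invariants\<close>

inductive_set structured :: "(nat \<times> 2, 'a) mpoly set" where
  minor: "q \<in> unip_inv \<Longrightarrow> minor i j * q \<in> structured"
| monomial: "const_poly c * (x_prod A * norm_prod B) \<in> structured"
| unip_transfer: "unip_transfer h \<in> structured"
| add: "f \<in> structured \<Longrightarrow> g \<in> structured \<Longrightarrow> f + g \<in> structured"

lemma structured_0: "0 \<in> structured"
  using structured.unip_transfer[of 0] by simp

lemma structured_sum: "(\<And>x. x \<in> A \<Longrightarrow> h x \<in> structured) \<Longrightarrow> sum h A \<in> structured"
  by (induction A rule: infinite_finite_induct) (simp_all add: structured_0 structured.add)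

lemma structured_const_mult: "f \<in> structured \<Longrightarrow> const_poly c * f \<in> structured"
proof (induction rule: structured.induct)
  case (minor q i j)
  then show ?case using structured.minor[of "const_poly c * q" i j]
    by (simp add: unip_inv_mult unip_inv_const ac_simps)
next
  case (monomial c' A B)
  then show ?case using structured.monomial[of "c * c'" A B] by (simp add: const_poly_mult ac_simps)
next
  case (unip_transfer h)
  then show ?case using structured.unip_transfer[of "const_poly c * h"]
    by (simp add: unip_transfer_mult unip_inv_const)
next
  case (add f g)
  then show ?case by (simp add: distrib_left structured.add)
qed

lemma structured_norm_y_mult: "f \<in> structured \<Longrightarrow> norm_y l * f \<in> structured"
proof (induction rule: structured.induct)
  case (minor q i j)
  then show ?case using structured.minor[of "norm_y l * q" i j]
    by (simp add: unip_inv_mult unip_inv_norm_y ac_simps)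
next
  case (monomial c' A B)
  then show ?case using structured.monomial[of "c'" A "add_mset l B"] by (simp add: ac_simps)
next
  case (unip_transfer h)
  then show ?case using structured.unip_transfer[of "norm_y l * h"]
    by (simp add: unip_transfer_mult unip_inv_norm_y)
next
  case (add f g)
  then show ?case by (simp add: distrib_left structured.add)
qed

lemma polarize_minor:
  "polarize i j (minor k l) = (if k = i then minor j l else 0) + (if l = i then minor k j else 0)"
  by (simp add: minor_def polarize.deriv_diff polarize.deriv_mult)

text \<open>In characteristic p the derivative of y_i^p vanishes, and since p - 1 = -1 the two
  derivatives of x_i^{p-1} y_i combine into a minor.\<close>

lemma polarize_norm_y: "polarize i j (norm_y i) = minor j i * x_var i ^ (p - 2)"
proof -
  obtain n where n: "p = Suc (Suc n)" using p_ge_2 by (metis add_2_eq_Suc le_Suc_ex)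
  have z: "(of_nat p :: (nat \<times> 2, 'a) mpoly) = 0"
    using const_poly_of_nat[where 'a='a and n=p] by simp
  then have "(of_nat (p - 1) :: (nat \<times> 2, 'a) mpoly) = -1"
    by (simp add: n eq_neg_iff_add_eq_0 add.commute)
  then have m: "(of_nat (Suc n) :: (nat \<times> 2, 'a) mpoly) = -1" by (simp add: n)
  have "polarize i j (norm_y i) = - (polarize i j (x_var i ^ (p - 1)) * y_var i + x_var i ^
    (p - 1) * y_var j)"
    unfolding norm_y_def polarize.deriv_diff polarize.deriv_mult polarize.deriv_power[of _ _
      "y_var i"] z by simp
  also have "polarize i j (x_var i ^ (p - 1) :: (nat \<times> 2, 'a) mpoly) =
    - (x_var i ^ (p - 2) * x_var j)"
    unfolding polarize.deriv_power n by (simp add: m del: of_nat_Suc)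
  finally show ?thesis by (simp add: n minor_def algebra_simps)
qed

lemma polarize_norm_prod: "\<exists>q\<in>unip_inv. polarize i j (norm_prod B) = minor j i * q"
proof (induction B)
  case empty
  show ?case by (rule bexI[of _ 0]) (auto simp: polarize.deriv_1)
next
  case (add k B)
  then obtain q where q: "q \<in> unip_inv" "polarize i j (norm_prod B) = minor j i * q" by blast
  obtain r where r: "r \<in> unip_inv" "polarize i j (norm_y k) = minor j i * r"
  proof (cases "k = i")
    case True
    then show ?thesis using that[of "x_var i ^ (p - 2)"] polarize_norm_y by blast
  next
    case False
    then have "polarize i j (norm_y k) = 0"
      by (simp add: norm_y_def polarize.deriv_diff polarize.deriv_mult polarize.deriv_power)
    then show ?thesis using that[of 0] by auto
  qed
  have "polarize i j (norm_prod (add_mset k B)) = minor j i * (r * norm_prod B + norm_y k * q)"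
    by (simp add: polarize.deriv_mult q r algebra_simps)
  moreover have "r * norm_prod B + norm_y k * q \<in> unip_inv" using q r by blast
  ultimately show ?case by blast
qed

lemma polarize_x_prod:
  "polarize i j (x_prod A :: (nat \<times> 2, 'a) mpoly) = of_nat (count A i) * (x_var j * x_prod
    (A - {#i#}))"
proof (induction A)
  case empty
  show ?case by (simp add: polarize.deriv_1)
next
  case (add k A)
  show ?case
  proof (cases "k = i")
    case True
    have h: "of_nat (count A i) * (x_var i * x_prod (A - {#i#})) = of_nat (count A i) *
      (x_prod A :: (nat \<times> 2, 'a) mpoly)"
    proof (cases "i \<in># A")
      case True
      then have "x_var i * x_prod (A - {#i#}) = (x_prod A :: (nat \<times> 2, 'a) mpoly)"
        by (metis x_prod_simps(2) insert_DiffM)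
      then show ?thesis by simp
    qed (simp add: not_in_iff)
    have "x_var i * (of_nat (count A i) * (x_var j * x_prod (A - {#i#}))) =
      x_var j * (of_nat (count A i) * (x_var i * x_prod (A - {#i#})) :: (nat \<times> 2, 'a) mpoly)"
      by (simp only: mult_ac)
    then show ?thesis unfolding h using True by (simp add: polarize.deriv_mult add algebra_simps)
  next
    case False
    then show ?thesis by (simp add: polarize.deriv_mult add algebra_simps)
  qed
qed

text \<open>The Capelli identity recovers an invariant as a polarization, so the structured elements
  have to be stable under polarization. Derivatives that fall on a norm only contribute multiples of
  minors.\<close>

lemma structured_polarize: "f \<in> structured \<Longrightarrow> polarize i j f \<in> structured"
proof (induction rule: structured.induct)
  case (minor q k l)
  have "polarize i j (minor k l * q) = (if k = i then minor j l * q else 0) +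
      (if l = i then minor k j * q else 0) + minor k l * polarize i j q"
    by (simp add: polarize.deriv_mult polarize_minor algebra_simps)
  also have "\<dots> \<in> structured"
    using minor structured_0 by (auto intro!: structured.add structured.minor)
  finally show ?case .
next
  case (monomial c A B)
  obtain q where q: "q \<in> unip_inv" "polarize i j (norm_prod B) = minor j i * q" using
    polarize_norm_prod by blast
  have "polarize i j (const_poly c * (x_prod A * norm_prod B)) =
    const_poly (c * of_nat (count A i)) * (x_prod (add_mset j (A - {#i#})) * norm_prod B) + minor
      j i * (const_poly c * x_prod A * q)"
    by (simp add: polarize_const_mult polarize.deriv_mult q polarize_x_prod polarize.deriv_const
      const_poly_mult const_poly_of_nat algebra_simps)
  also have "\<dots> \<in> structured"
    using q by (intro structured.add structured.monomial structured.minor) auto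
  finally show ?case .
next
  case (unip_transfer h)
  then show ?case by (simp add: unip_transfer_polarize structured.unip_transfer)
next
  case (add f g)
  then show ?case by (simp add: polarize.deriv_add structured.add)
qed

text \<open>The summands produced by interpolation need not be homogeneous. Comparing the parts of
  degree n leaves the part of q of degree n - p, which the induction on the degree covers.\<close>

lemma structured_step:
  assumes f: "f \<in> unip_inv" "weight_homogeneous mono_degree n f"
    and IH: "\<And>m q. m < n \<Longrightarrow> q \<in> unip_inv \<Longrightarrow> weight_homogeneous mono_degree m q \<Longrightarrow> q \<in> structured"
    and eq: "f = g + norm_y i * q" and q: "q \<in> unip_inv" and g: "weight_part mono_degree n g \<in>
      structured"
  shows "f \<in> structured"
proof -
  have "f = weight_part mono_degree n g + weight_part mono_degree n (norm_y i * q)"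
    using f(2) eq by (metis weight_homogeneous_iff weight_part_add)
  moreover have "weight_part mono_degree n (norm_y i * q) \<in> structured"
  proof (cases "p \<le> n")
    case True
    then have "weight_part mono_degree (n - p) q \<in> structured"
      using p_pos q by (intro IH[of "n - p"] unip_inv_part weight_homogeneous_part) auto
    then show ?thesis
      using True by (simp add: mono_degree.part_mult[OF norm_y_homogeneous] structured_norm_y_mult)
  next
    case False
    then show ?thesis by (simp add: mono_degree.part_mult[OF norm_y_homogeneous] structured_0)
  qed
  ultimately show ?thesis using g by (metis structured.add)
qed

text \<open>The inner induction is on \<open>n - b 0\<close>, the degree outside copy 0: a Capelli
  step keeps n and raises \<open>b 0\<close> by one. When everything lies in copy 0, f agrees with a
  multiple of x_0^(b 0) on all the lines, so their difference is a multiple of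
  \<open>norm_y 0\<close>.\<close>

lemma structured_multidegree:
  assumes IH: "\<And>m q. m < n \<Longrightarrow> q \<in> unip_inv \<Longrightarrow> weight_homogeneous mono_degree m q \<Longrightarrow> q \<in> structured"
    and f: "f \<in> unip_inv" "weight_homogeneous mono_degree n f"
    and b: "\<And>i. weight_homogeneous (copy_degree i) (b i) f"
  shows "f \<in> structured"
  using f b
proof (induction "n - b 0" arbitrary: f b rule: less_induct)
  case less
  note f = less.prems(1,2) and b = less.prems(3)
  consider i where "p - 1 \<le> b i" | i where "\<forall>j. b j < p - 1" "i \<noteq> 0" "b i \<noteq> 0"
    | "\<forall>j. j \<noteq> 0 \<longrightarrow> b j = 0"
    by (meson not_le)
  then show ?case
  proof cases
    case 1
    have "x_var i ^ (p - 1) dvd specialize i 0 f"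
      using b[of i] 1 by (intro power_dvd_specialize) (simp add: weight_homogeneous_def)
    then obtain k where "specialize i 0 f = x_var i ^ (p - 1) * k" by (rule dvdE)
    then obtain h q where "q \<in> unip_inv" "f = unip_transfer h + norm_y i * q" using
      unip_inv_trace_division[OF f(1)] by blast
    then show ?thesis
      by (intro structured_step[OF f IH, where g = "unip_transfer h" and i = i and q = q])
        (auto simp: unip_transfer_part structured.unip_transfer)
  next
    case 2
    let ?c = "of_nat ((b 0 + 1) * b i) :: 'a"
    have c0: "?c \<noteq> 0"
    proof -
      \<comment> \<open>Both numbers lie strictly between 0 and p.\<close>
      have "\<not> p dvd b 0 + 1" "\<not> p dvd b i"
        using 2(1)[rule_format, of 0] 2(1)[rule_format, of i] 2(3) by (auto dest!: dvd_imp_le)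
      then have "\<not> p dvd (b 0 + 1) * b i"
        using prime_dvd_multD[OF prime_p] by blast
      then show ?thesis unfolding of_nat_eq_0_iff_char_dvd char_p .
    qed
    have cap: "const_poly ?c * f = polarize 0 i (polarize i 0 f) + minor 0 i * omega_process 0 i f"
      using capelli[OF 2(2)[symmetric] b b] by (simp only: const_poly_of_nat)
    have D: "polarize i 0 f \<in> structured"
    \<comment> \<open>The zero polynomial is homogeneous of every degree; only a monomial of f
      guarantees \<open>b 0 + b i \<le> n\<close>, on which the decrease of the measure
      rests.\<close>
    proof (cases "f = 0")
      case True
      then show ?thesis by (simp add: polarize.deriv_0 structured_0)
    next
      case False
      then obtain t where t: "t \<in> Poly_Mapping.keys f" by (metis keys_eq_empty ex_in_conv)
      have lt: "b 0 + b i \<le> n"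
        using copy_degree_le[OF 2(2)[symmetric], of t] b[of 0] b[of i] f(2) t
        by (simp add: weight_homogeneous_def)
      define b' where "b' = b(0 := b 0 + 1, i := b i - 1)"
      show ?thesis
      proof (rule less.hyps[of b'])
        show "n - b' 0 < n - b 0" using lt 2 by (simp add: b'_def)
        show "polarize i 0 f \<in> unip_inv" using f by blast
        show "weight_homogeneous mono_degree n (polarize i 0 f)"
          unfolding weight_homogeneous_def
        proof
          fix s assume "s \<in> Poly_Mapping.keys (polarize i 0 f)"
          then obtain k r where r: "r \<in> Poly_Mapping.keys f" and
            eq: "s + Poly_Mapping.single (i, k) 1 = Poly_Mapping.single (0, k) 1 + r"
            using keys_polarize[of s i 0 f] by blast
          show "mono_degree s = n"
            using arg_cong[OF eq, of mono_degree] f(2) r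
            by (simp add: mono_degree_add weight_homogeneous_def)
        qed
        show "weight_homogeneous (copy_degree j) (b' j) (polarize i 0 f)" for j
          unfolding weight_homogeneous_def
        proof
          fix s assume "s \<in> Poly_Mapping.keys (polarize i 0 f)"
          then obtain k r where r: "r \<in> Poly_Mapping.keys f" and
            eq: "s + Poly_Mapping.single (i, k) 1 = Poly_Mapping.single (0, k) 1 + r"
            using keys_polarize[of s i 0 f] by blast
          show "copy_degree j s = b' j"
            using arg_cong[OF eq, of "copy_degree j"] b[of j] r 2(2)
            by (auto simp: copy_degree.weight_add weight_homogeneous_def b'_def split: if_splits)
        qed
      qed
    qed
    \<comment> \<open>The invariance is read off from the Capelli identity: its other terms are
      invariant, and the minor can be cancelled.\<close>
    have om: "omega_process 0 i f \<in> unip_inv"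
      unfolding unip_inv_iff
    proof
      fix t assume t: "t \<in> Fp"
      have "minor 0 i * shift t (omega_process 0 i f) = shift t (minor 0 i * omega_process 0 i f)"
        by (simp add: act.hom_mult act_minor)
      also have "minor 0 i * omega_process 0 i f = const_poly ?c * f - polarize 0 i (polarize i 0
        f)"
        unfolding cap by simp
      also have "\<dots> \<in> unip_inv" using f(1) by blast
      then have "shift t (const_poly ?c * f - polarize 0 i (polarize i 0 f)) =
        const_poly ?c * f - polarize 0 i (polarize i 0 f)"
        using t unfolding unip_inv_iff by blast
      also have "\<dots> = minor 0 i * omega_process 0 i f" unfolding cap by simp
      finally have eq: "minor 0 i * shift t (omega_process 0 i f) = minor 0 i * omega_process 0 i
        f" .
      have "minor 0 i \<noteq> (0 :: (nat \<times> 2, 'a) mpoly)"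
      proof
        assume "minor 0 i = (0 :: (nat \<times> 2, 'a) mpoly)"
        then have "specialize i 0 (minor 0 i :: (nat \<times> 2, 'a) mpoly) = 0" by (simp only:
          specialize.hom_0)
        then have "x_var i * y_var 0 = (0 :: (nat \<times> 2, 'a) mpoly)"
          using 2(2) by (simp add: minor_def specialize.hom_simps)
        then show False using mpoly_mult_eq_0 var_poly_nonzero by metis
      qed
      from mpoly_mult_left_cancel[OF eq this] show "shift t (omega_process 0 i f) =
        omega_process 0 i f" .
    qed
    have eq: "const_poly (inverse ?c) * (const_poly ?c * f) = f"
      using c0 unfolding mult.assoc[symmetric] const_poly_mult[symmetric] by simp
    have S: "polarize 0 i (polarize i 0 f) + minor 0 i * omega_process 0 i f \<in> structured"
      by (intro structured.add structured_polarize[OF D] structured.minor om)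
    have "const_poly (inverse ?c) * (const_poly ?c * f) \<in> structured"
      unfolding cap by (rule structured_const_mult[OF S])
    then show ?thesis unfolding eq .
  next
    case 3
    have "\<exists>c. specialize 0 0 f = const_poly c * x_var 0 ^ b 0"
      using b 3 by (intro specialize_const) (auto simp: weight_homogeneous_def)
    then obtain c where c: "specialize 0 0 f = const_poly c * x_var 0 ^ b 0" by blast
    let ?g = "const_poly c * x_var 0 ^ b 0"
    have "specialize 0 s (f - ?g) = 0" if s: "s \<in> Fp" for s
    proof -
      have "specialize 0 s f = specialize 0 s (shift s f)" using f(1) s by (simp add: unip_inv_iff)
      also have "\<dots> = ?g" unfolding specialize_shift c by (simp add: act.hom_simps)
      finally show ?thesis by (simp add: specialize.hom_simps)
    qed
    moreover have "f - ?g \<in> unip_inv" using f(1) by blast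
    ultimately obtain q where q: "q \<in> unip_inv" "f - ?g = norm_y 0 * q" using unip_inv_division by
      blast
    then have eq: "f = ?g + norm_y 0 * q" by (simp add: algebra_simps)
    have "weight_homogeneous mono_degree (b 0 * 1) ?g"
      by (intro mono_degree.homogeneous_const_mult mono_degree.homogeneous_power homogeneous_xy)
    then have "weight_part mono_degree n ?g = (if n = b 0 * 1 then ?g else 0)"
      by (rule weight_part_homogeneous)
    moreover have "?g \<in> structured"
      using structured.monomial[of c "replicate_mset (b 0) 0" "{#}"] by (simp add: x_prod_replicate)
    ultimately show ?thesis
      using structured_0 by (intro structured_step[OF f IH eq q(1)]) auto
  qed
qed

theorem unip_inv_structured: "f \<in> unip_inv \<Longrightarrow> f \<in> structured"
proof -
  have *: "f \<in> structured" if "f \<in> unip_inv" "weight_homogeneous mono_degree n f" for n f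
    using that
  proof (induction n arbitrary: f rule: less_induct)
    case (less n)
    have "weight_part multidegree d f \<in> structured" for d
    proof (rule structured_multidegree[of n _ d])
      show "weight_part multidegree d f \<in> unip_inv" using less.prems
        by (intro unip_inv_multidegree_part)
      show "weight_homogeneous mono_degree n (weight_part multidegree d f)"
        using less.prems keys_weight_part[of multidegree d f] by (auto simp: weight_homogeneous_def)
      show "weight_homogeneous (copy_degree i) (d i) (weight_part multidegree d f)" for i
        using weight_homogeneous_part[of multidegree d f] by (auto simp: weight_homogeneous_def
          multidegree_def)
    qed (use less.IH in blast)
    then show ?case
      using structured_sum[of "multidegree ` Poly_Mapping.keys f" "\<lambda>d. weight_part multidegree d f"]
      by (simp add: sum_weight_part)
  qed
  assume f: "f \<in> unip_inv"
  have "weight_part mono_degree d f \<in> structured" for d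
    by (rule *[OF unip_inv_part[OF f] weight_homogeneous_part])
  then show ?thesis
    using structured_sum[of "mono_degree ` Poly_Mapping.keys f" "\<lambda>d. weight_part mono_degree d f"]
    by (simp add: sum_weight_part)
qed

end

subsection \<open>The relative transfer\<close>

context prime_char
begin

definition SL2_inv :: "(nat \<times> 2, 'a) mpoly set" where
  "SL2_inv = {f. \<forall>a\<in>Fp. \<forall>b\<in>Fp. \<forall>c\<in>Fp. \<forall>d\<in>Fp. a * d - b * c = 1 \<longrightarrow> act a b c d f = f}"

lemma SL2_inv_act: "f \<in> SL2_inv \<Longrightarrow> a \<in> Fp \<Longrightarrow> b \<in> Fp \<Longrightarrow> c \<in> Fp \<Longrightarrow> d \<in> Fp \<Longrightarrow> a * d - b * c = 1 \<Longrightarrow>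
  act a b c d f = f"
  by (simp add: SL2_inv_def)

lemma SL2_inv_I:
  assumes "\<And>a b c d. a \<in> Fp \<Longrightarrow> b \<in> Fp \<Longrightarrow> c \<in> Fp \<Longrightarrow> d \<in> Fp \<Longrightarrow> a * d - b * c = 1 \<Longrightarrow> act a b c d f = f"
  shows "f \<in> SL2_inv"
  unfolding SL2_inv_def using assms by blast

lemma SL2_inv_unip_inv: "f \<in> SL2_inv \<Longrightarrow> f \<in> unip_inv"
  unfolding unip_inv_iff by (intro ballI SL2_inv_act) simp_all

lemma SL2_inv_part: "f \<in> SL2_inv \<Longrightarrow> weight_part mono_degree e f \<in> SL2_inv"
  by (simp add: SL2_inv_def mono_degree_part_act[symmetric])

definition nonzero_rows :: "('a \<times> 'a) set" where
  "nonzero_rows = Fp \<times> Fp - {(0, 0)}"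

text \<open>
  The first row of a matrix in $SL_2(\mathbf{F}_p)$ determines its coset modulo $P$,
  hence its effect on $P$-invariants; \<open>row_act r\<close> uses one representative with first row \<open>r\<close>.
\<close>

definition row_act :: "'a \<times> 'a \<Rightarrow> (nat \<times> 2, 'a) mpoly \<Rightarrow> (nat \<times> 2, 'a) mpoly" where
  "row_act r f = (if snd r = 0 then act (fst r) 0 0 (1 / fst r) f
     else act (fst r) (snd r) (- 1 / snd r) 0 f)"

definition rel_transfer :: "(nat \<times> 2, 'a) mpoly \<Rightarrow> (nat \<times> 2, 'a) mpoly" where
  "rel_transfer f = (\<Sum>r\<in>nonzero_rows. row_act r f)"

lemma row_act_form:
  assumes "(a, b) \<in> nonzero_rows"
  shows "\<exists>c\<in>Fp. \<exists>d\<in>Fp. a * d - b * c = 1 \<and> (\<forall>f. row_act (a, b) f = act a b c d f)"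
proof (cases "b = 0")
  case True
  then show ?thesis using assms
    by (intro bexI[of _ 0] bexI[of _ "1 / a"]) (auto simp: nonzero_rows_def row_act_def)
next
  case False
  then show ?thesis using assms
    by (intro bexI[of _ "- 1 / b"] bexI[of _ 0]) (auto simp: nonzero_rows_def row_act_def)
qed

text \<open>Two matrices of determinant 1 with the same first row differ by a lower unipotent left
  factor, which acts on f first and fixes it.\<close>

lemma row_act_any:
  assumes f: "f \<in> unip_inv" and abcd: "a \<in> Fp" "b \<in> Fp" "c \<in> Fp" "d \<in> Fp" and det: "a * d - b * c
    = 1"
  shows "act a b c d f = row_act (a, b) f"
proof (cases "b = 0")
  case True
  then have "a * d = 1" using det by simp
  then have a: "a \<noteq> 0" "d = 1 / a" by (auto simp: eq_divide_eq mult.commute)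
  have "row_act (a, b) f = act a 0 0 (1 / a) (shift (c / a) f)"
    using f abcd True by (simp add: row_act_def unip_inv_iff)
  also have "\<dots> = act a b c d f"
    using a True by (simp add: act_act)
  finally show ?thesis by simp
next
  case False
  have c: "c = d / b * a - 1 / b" using det False by (simp add: field_simps)
  have "row_act (a, b) f = act a b (- 1 / b) 0 (shift (d / b) f)"
    using f abcd False by (simp add: row_act_def unip_inv_iff)
  also have "\<dots> = act a b c d f"
    unfolding act_act using False by (simp add: c)
  finally show ?thesis by simp
qed

lemma nonzero_rows_mult:
  assumes "a \<in> Fp" "b \<in> Fp" "c \<in> Fp" "d \<in> Fp" "a * d - b * c = 1" "(x, y) \<in> nonzero_rows"
  shows "(x * a + y * c, x * b + y * d) \<in> nonzero_rows"
proof -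
  have "x = 0 \<and> y = 0" if "x * a + y * c = 0" "x * b + y * d = 0"
  proof -
    have "x * (a * d - b * c) = (x * a + y * c) * d - (x * b + y * d) * c"
      "y * (a * d - b * c) = (x * b + y * d) * a - (x * a + y * c) * b"
      by (simp_all add: algebra_simps)
    then show ?thesis unfolding that assms(5) by simp
  qed
  then show ?thesis using assms by (auto simp: nonzero_rows_def)
qed

text \<open>A group element permutes the nonzero rows, and \<open>row_act_any\<close> makes the
  choice of representatives irrelevant. The inverse permutation is given by the adjugate
  matrix.\<close>

lemma rel_transfer_SL2_inv:
  assumes f: "f \<in> unip_inv"
  shows "rel_transfer f \<in> SL2_inv"
proof (rule SL2_inv_I)
  fix a b c d assume abcd: "a \<in> Fp" "b \<in> Fp" "c \<in> Fp" "d \<in> Fp" and det: "a * d - b * c = 1"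
  have act_row: "act a b c d (row_act (x, y) f) = row_act (x * a + y * c, x * b + y * d) f"
    if xy: "(x, y) \<in> nonzero_rows" for x y
  proof -
    obtain z w where zw: "z \<in> Fp" "w \<in> Fp" "x * w - y * z = 1" "row_act (x, y) f = act x y z w f"
      using row_act_form[OF xy] by blast
    have "act a b c d (row_act (x, y) f) =
      act (x * a + y * c) (x * b + y * d) (z * a + w * c) (z * b + w * d) f"
      by (simp add: zw(4) act_act)
    also have "\<dots> = row_act (x * a + y * c, x * b + y * d) f"
    proof (rule row_act_any[OF f])
      have "(x * a + y * c) * (z * b + w * d) - (x * b + y * d) * (z * a + w * c) =
        (x * w - y * z) * (a * d - b * c)" by (simp add: algebra_simps)
      then show "(x * a + y * c) * (z * b + w * d) - (x * b + y * d) * (z * a + w * c) = 1"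
        using zw(3) det by simp
    qed (use xy abcd zw in \<open>auto simp: nonzero_rows_def\<close>)
    finally show ?thesis .
  qed
  have "act a b c d (rel_transfer f) = (\<Sum>(x, y)\<in>nonzero_rows. row_act (x * a + y * c,
    x * b + y * d) f)"
    unfolding rel_transfer_def act.hom_sum by (intro sum.cong refl) (auto simp: act_row)
  also have "\<dots> = (\<Sum>r\<in>nonzero_rows. row_act r f)"
  proof (rule sum.reindex_bij_witness[where i = "\<lambda>(x, y). (x * d + y * (- c), x * (- b) + y * a)"
        and j = "\<lambda>(x, y). (x * a + y * c, x * b + y * d)"])
    fix r assume r: "r \<in> nonzero_rows"
    obtain x y where xy: "r = (x, y)" by (cases r)
    have e: "x * a * d + y * c * d - (x * b * c + y * d * c) = x * (a * d - b * c)"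
      "x * d * a + y * (- c) * a + (x * (- b) + y * a) * c = x * (a * d - b * c)"
      "(x * a + y * c) * (- b) + (x * b + y * d) * a = y * (a * d - b * c)"
      "(x * d + y * (- c)) * b + (x * (- b) + y * a) * d = y * (a * d - b * c)"
      "(x * a + y * c) * d + (x * b + y * d) * (- c) = x * (a * d - b * c)"
      "(x * d + y * (- c)) * a + (x * (- b) + y * a) * c = x * (a * d - b * c)"
      by (simp_all add: algebra_simps)
    show "(case (case r of (x, y) \<Rightarrow> (x * a + y * c, x * b + y * d)) of
        (x, y) \<Rightarrow> (x * d + y * (- c), x * (- b) + y * a)) = r"
      unfolding xy prod.case e det by simp
    show "(case (case r of (x, y) \<Rightarrow> (x * d + y * (- c), x * (- b) + y * a)) of
        (x, y) \<Rightarrow> (x * a + y * c, x * b + y * d)) = r"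
      unfolding xy prod.case e det by simp
    show "(case r of (x, y) \<Rightarrow> (x * a + y * c, x * b + y * d)) \<in> nonzero_rows"
      using nonzero_rows_mult[OF abcd det] r unfolding xy by simp
    show "(case r of (x, y) \<Rightarrow> (x * d + y * (- c), x * (- b) + y * a)) \<in> nonzero_rows"
      using nonzero_rows_mult[of d "- b" "- c" a x y] abcd det r unfolding xy
        by (simp add: mult.commute)
  qed auto
  finally show "act a b c d (rel_transfer f) = rel_transfer f" by (simp add: rel_transfer_def)
qed

lemma row_act_add: "row_act r (f + g) = row_act r f + row_act r g"
  and row_act_mult: "row_act r (f * g) = row_act r f * row_act r g"
  and row_act_0: "row_act r 0 = 0"
  and row_act_const: "row_act r (const_poly c) = const_poly c"
  by (simp_all add: row_act_def act.hom_simps)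

lemma row_act_SL2_inv:
  assumes "f \<in> SL2_inv" "r \<in> nonzero_rows"
  shows "row_act r f = f"
proof -
  obtain a b where r: "r = (a, b)" by (cases r)
  obtain c d where "c \<in> Fp" "d \<in> Fp" "a * d - b * c = 1" "row_act (a, b) f = act a b c d f"
    using row_act_form[of a b] assms r by blast
  then show ?thesis using assms SL2_inv_act[of f a b c d] by (auto simp: r nonzero_rows_def)
qed

lemma rel_transfer_add: "rel_transfer (f + g) = rel_transfer f + rel_transfer g"
  by (simp add: rel_transfer_def row_act_add sum.distrib)

lemma rel_transfer_0 [simp]: "rel_transfer 0 = 0"
  by (simp add: rel_transfer_def row_act_0)

lemma rel_transfer_mult: "e \<in> SL2_inv \<Longrightarrow> rel_transfer (e * f) = e * rel_transfer f"
  by (simp add: rel_transfer_def row_act_mult row_act_SL2_inv sum_distrib_left)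

lemma SL2_inv_const: "const_poly c \<in> SL2_inv"
  by (rule SL2_inv_I) (simp add: act.hom_const)

lemma rel_transfer_part: "weight_part mono_degree d (rel_transfer f) =
  rel_transfer (weight_part mono_degree d f)"
  unfolding rel_transfer_def weight_part_sum by (intro sum.cong refl) (simp add:
    row_act_def mono_degree_part_act)

text \<open>The number of rows is the index p^2 - 1, which is -1 in the field. Hence the relative
  transfer negates G-invariants, and each of them is a relative transfer.\<close>

lemma of_nat_card_nonzero_rows: "(of_nat (card nonzero_rows) :: 'a) = -1"
proof -
  have "card nonzero_rows = p * p - 1"
    unfolding nonzero_rows_def by (simp add: card_Diff_singleton card_cartesian_product card_Fp)
  then have "card nonzero_rows + 1 = p * p" using p_pos by simp
  then have "(of_nat (card nonzero_rows + 1) :: 'a) = 0" by simp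
  then show ?thesis by (simp add: eq_neg_iff_add_eq_0 add.commute)
qed

lemma rel_transfer_of_SL2_inv: "f \<in> SL2_inv \<Longrightarrow> rel_transfer f = - f"
proof -
  assume f: "f \<in> SL2_inv"
  have "rel_transfer f = of_nat (card nonzero_rows) * f"
    unfolding rel_transfer_def using row_act_SL2_inv[OF f] by simp
  also have "of_nat (card nonzero_rows) = const_poly (-1 :: 'a)"
    by (simp only: const_poly_of_nat[symmetric] of_nat_card_nonzero_rows)
  finally show ?thesis by (simp add: const_poly_uminus)
qed

text \<open>Applying a torus element first only permutes the summands, because scaling permutes the
  rows. The relative transfer is therefore both unchanged and multiplied by c.\<close>

lemma rel_transfer_torus:
  assumes f: "f \<in> unip_inv" and s: "s \<in> Fp" "s \<noteq> 0"
    and eig: "act s 0 0 (1 / s) f = const_poly c * f" and c: "c \<noteq> 1"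
  shows "rel_transfer f = 0"
proof -
  have row: "row_act (x, y) (act s 0 0 (1 / s) f) = row_act (s * x, s * y) f" if xy:
    "(x, y) \<in> nonzero_rows" for x y
  proof -
    obtain z w where zw: "z \<in> Fp" "w \<in> Fp" "x * w - y * z = 1"
      "row_act (x, y) (act s 0 0 (1 / s) f) = act x y z w (act s 0 0 (1 / s) f)"
      using row_act_form[OF xy] by blast
    have "act x y z w (act s 0 0 (1 / s) f) = act (s * x) (s * y) (z / s) (w / s) f"
      by (simp add: act_act)
    also have "\<dots> = row_act (s * x, s * y) f"
      by (rule row_act_any[OF f]) (use xy zw s in \<open>auto simp: nonzero_rows_def\<close>)
    finally show ?thesis using zw by simp
  qed
  have "rel_transfer (act s 0 0 (1 / s) f) = (\<Sum>(x, y)\<in>nonzero_rows. row_act (s * x, s * y) f)"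
    unfolding rel_transfer_def by (intro sum.cong refl) (auto simp: row)
  also have "\<dots> = rel_transfer f"
    unfolding rel_transfer_def
    by (rule sum.reindex_bij_witness[where i = "\<lambda>(x, y). (x / s, y / s)" and j = "\<lambda>(x, y). (s * x,
      s * y)"])
      (use s in \<open>auto simp: nonzero_rows_def\<close>)
  finally have "const_poly c * rel_transfer f = rel_transfer f"
    unfolding eig rel_transfer_mult[OF SL2_inv_const] .
  then have "const_poly (c - 1) * rel_transfer f = 0" by (simp add: const_poly_diff algebra_simps)
  moreover have "const_poly (c - 1) \<noteq> (0 :: (nat \<times> 2, 'a) mpoly)" using c by simp
  ultimately show ?thesis using mpoly_mult_eq_0 by blast
qed

lemma act_torus_x_prod: "act s 0 0 (1 / s) (x_prod A) = const_poly (s ^ size A) * x_prod A"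
  by (induction A) (simp_all add: act.hom_simps const_poly_mult)

lemma act_torus_y_prod: "act s 0 0 (1 / s) (y_prod A) = const_poly ((1 / s) ^ size A) * y_prod A"
proof (induction A)
  case (add i A)
  have "act s 0 0 (1 / s) (y_prod (add_mset i A)) = const_poly (1 / s) * y_var i * (const_poly
    ((1 / s) ^ size A) * y_prod A)"
    unfolding y_prod_simps act.hom_mult add by simp
  also have "\<dots> = const_poly (1 / s * (1 / s) ^ size A) * (y_var i * y_prod A)"
    unfolding const_poly_mult by (simp only: mult_ac)
  finally show ?case by simp
qed (simp add: act.hom_1)

text \<open>The torus normalizes P and rescales its parameter t by s^2.\<close>

lemma act_torus_unip_transfer:
  assumes s: "s \<in> Fp" "s \<noteq> 0"
  shows "act s 0 0 (1 / s) (unip_transfer f) = unip_transfer (act s 0 0 (1 / s) f)"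
proof -
  have "act s 0 0 (1 / s) (unip_transfer f) = (\<Sum>t\<in>Fp. shift (t * s * s) (act s 0 0 (1 / s) f))"
    unfolding unip_transfer_def act.hom_sum using s by (intro sum.cong refl) (simp add: act_act)
  also have "\<dots> = unip_transfer (act s 0 0 (1 / s) f)"
    unfolding unip_transfer_def
    by (rule sum.reindex_bij_witness[where i = "\<lambda>t. t / s / s" and j = "\<lambda>t. t * s * s"])
      (use s in auto)
  finally show ?thesis .
qed

lemma rel_transfer_x_prod: "\<not> (p - 1) dvd size A \<Longrightarrow> rel_transfer (x_prod A) = 0"
  using exists_power_neq_1[of "size A"] rel_transfer_torus[OF unip_inv_x_prod _ _
    act_torus_x_prod] by blast

lemma rel_transfer_unip_transfer_y_prod:
  assumes "\<not> (p - 1) dvd size A"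
  shows "rel_transfer (unip_transfer (y_prod A)) = 0"
proof -
  obtain s where s: "s \<in> Fp" "s \<noteq> 0" "s ^ size A \<noteq> 1"
    using exists_power_neq_1[OF assms] by blast
  show ?thesis
  proof (rule rel_transfer_torus[OF unip_transfer_unip_inv s(1,2)])
    show "act s 0 0 (1 / s) (unip_transfer (y_prod A)) = const_poly ((1 / s) ^ size A) *
      unip_transfer (y_prod A)"
      unfolding act_torus_unip_transfer[OF s(1,2)] act_torus_y_prod by (rule unip_transfer_mult[OF
        unip_inv_const])
    show "(1 / s) ^ size A \<noteq> 1" using s by (simp add: power_divide)
  qed
qed

text \<open>The minor of copy i against the p-th powers of copy j. For i = j it is x_i N_i, the
  Dickson invariant of degree p + 1.\<close>

definition frob_minor :: "nat \<Rightarrow> nat \<Rightarrow> (nat \<times> 2, 'a) mpoly" where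
  "frob_minor i j = x_var i * y_var j ^ p - x_var j ^ p * y_var i"

lemma minor_SL2_inv: "minor i j \<in> SL2_inv"
  by (rule SL2_inv_I) (simp add: act_minor)

lemma frob_minor_SL2_inv: "frob_minor i j \<in> SL2_inv"
proof (rule SL2_inv_I)
  fix a b c d assume abcd: "a \<in> Fp" "b \<in> Fp" "c \<in> Fp" "d \<in> Fp" and det: "a * d - b * c = 1"
  have "act a b c d (frob_minor i j) = const_poly (a * d - b * c) * frob_minor i j"
    using abcd
    by (simp add: frob_minor_def act.hom_simps frob_mpoly power_mult_distrib const_power_p
      const_poly_diff const_poly_mult algebra_simps)
  then show "act a b c d (frob_minor i j) = frob_minor i j" by (simp add: det)
qed

lemma minor_homogeneous: "weight_homogeneous mono_degree 2 (minor i j :: (nat \<times> 2, 'a) mpoly)"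
proof -
  have "weight_homogeneous mono_degree (1 + 1) (minor i j :: (nat \<times> 2, 'a) mpoly)"
    unfolding minor_def by (intro weight_homogeneous_diff mono_degree.homogeneous_mult
      homogeneous_xy)
  then show ?thesis by (simp add: numeral_2_eq_2)
qed

lemma frob_minor_homogeneous: "weight_homogeneous mono_degree (p + 1) (frob_minor i j)"
proof -
  have "weight_homogeneous mono_degree (1 + p * 1) (x_var i * y_var j ^ p :: (nat \<times> 2, 'a) mpoly)"
    by (intro mono_degree.homogeneous_mult mono_degree.homogeneous_power homogeneous_xy)
  moreover have "weight_homogeneous mono_degree (p * 1 + 1) (x_var j ^ p * y_var i ::
    (nat \<times> 2, 'a) mpoly)"
    by (intro mono_degree.homogeneous_mult mono_degree.homogeneous_power homogeneous_xy)
  ultimately show ?thesis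
    unfolding frob_minor_def by (simp add: weight_homogeneous_diff)
qed

section \<open>Transfers modulo the ideal of the minors\<close>

inductive_set minor_ideal :: "(nat \<times> 2, 'a) mpoly set" where
  zero: "0 \<in> minor_ideal"
| minor: "q \<in> unip_inv \<Longrightarrow> minor i j * q \<in> minor_ideal"
| frob_minor: "q \<in> unip_inv \<Longrightarrow> frob_minor i j * q \<in> minor_ideal"
| add: "f \<in> minor_ideal \<Longrightarrow> g \<in> minor_ideal \<Longrightarrow> f + g \<in> minor_ideal"

lemma minor_ideal_mult: "f \<in> minor_ideal \<Longrightarrow> q \<in> unip_inv \<Longrightarrow> q * f \<in> minor_ideal"
proof (induction rule: minor_ideal.induct)
  case (minor q' i j)
  then show ?case using minor_ideal.minor[of "q * q'" i j]
    by (simp add: unip_inv_mult mult.left_commute)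
next
  case (frob_minor q' i j)
  then show ?case using minor_ideal.frob_minor[of "q * q'" i j]
    by (simp add: unip_inv_mult mult.left_commute)
qed (auto simp: distrib_left intro: minor_ideal.intros)

lemma minor_ideal_uminus: "f \<in> minor_ideal \<Longrightarrow> - f \<in> minor_ideal"
  using minor_ideal_mult[of f "- 1"] unip_inv_uminus[OF unip_inv_1] by simp

lemma minor_ideal_diff: "f \<in> minor_ideal \<Longrightarrow> g \<in> minor_ideal \<Longrightarrow> f - g \<in> minor_ideal"
  using minor_ideal.add[OF _ minor_ideal_uminus, of f g] by simp

text \<open>In the difference of \<open>frob_minor i j\<close> and x_j^{p-1} times the minor, the
  terms x_j^p y_i cancel and x_i times the norm remains.\<close>

lemma minor_ideal_xn: "q \<in> unip_inv \<Longrightarrow> x_var i * norm_y j * q \<in> minor_ideal"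
proof -
  assume q: "q \<in> unip_inv"
  have "x_var i * norm_y j = frob_minor i j - minor i j * x_var j ^ (p - 1)"
    unfolding frob_minor_def norm_y_def minor_def x_power_p by (simp add: algebra_simps)
  then have "x_var i * norm_y j * q = frob_minor i j * q - minor i j * (x_var j ^ (p - 1) * q)"
    by (simp only: left_diff_distrib mult.assoc)
  also have "\<dots> \<in> minor_ideal" using q by (intro minor_ideal_diff minor_ideal.frob_minor
    minor_ideal.minor unip_inv_mult unip_inv_power unip_inv_x)
  finally show ?thesis .
qed

lemma minor_ideal_x_prod_norm_prod:
  assumes "A \<noteq> {#}" "B \<noteq> {#}" "q \<in> unip_inv"
  shows "x_prod A * norm_prod B * q \<in> minor_ideal"
proof -
  obtain i A' where A: "A = add_mset i A'" using assms(1) by (meson multiset_cases)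
  obtain j B' where B: "B = add_mset j B'" using assms(2) by (meson multiset_cases)
  have "x_prod A * norm_prod B * q = x_var i * norm_y j * (x_prod A' * norm_prod B' * q)"
    by (simp add: A B algebra_simps)
  then show ?thesis using assms(3) by (auto intro!: minor_ideal_xn)
qed

text \<open>Modulo the minors x_i y_j may be replaced by x_j y_i, also under the transfer, which is
  linear over P-invariants. So only the total multiset and the number of x-factors matter; in the
  induction g collects the x-factors already matched.\<close>

lemma swap_minor_ideal:
  assumes "size A = size A'" "A + B = A' + B'"
  shows "unip_transfer (g * (x_prod A * y_prod B)) - unip_transfer (g * (x_prod A' * y_prod B')) \<in>
    minor_ideal"
  using assms
proof (induction A arbitrary: A' B B' g)
  case empty
  then show ?case by (simp add: minor_ideal.zero)
next
  case (add i A)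
  show ?case
  proof (cases "i \<in># A'")
    case True
    then obtain A1 where A1: "A' = add_mset i A1" by (meson mset_add)
    have "unip_transfer (g * x_var i * (x_prod A * y_prod B)) - unip_transfer (g * x_var i *
      (x_prod A1 * y_prod B')) \<in> minor_ideal"
      using add.prems by (intro add.IH) (simp_all add: A1)
    then show ?thesis by (simp add: A1 mult_ac)
  next
    case False
    have "i \<in># A' + B'" using add.prems(2) by (metis union_iff union_single_eq_member)
    then have "i \<in># B'" using False by simp
    then obtain B1 where B1: "B' = add_mset i B1" by (meson mset_add)
    have "A' \<noteq> {#}" using add.prems(1) by auto
    then obtain j A1 where A1: "A' = add_mset j A1" by (meson multiset_cases)
    have "g * (x_prod A' * y_prod B') = g * x_var i * (x_prod A1 * y_prod (add_mset j B1)) + minor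
      j i * (g * (x_prod A1 * y_prod B1))"
      by (simp add: A1 B1 minor_def algebra_simps)
    then have eq: "unip_transfer (g * (x_prod A' * y_prod B')) =
        unip_transfer (g * x_var i * (x_prod A1 * y_prod (add_mset j B1))) + minor j i *
          unip_transfer (g * (x_prod A1 * y_prod B1))"
      by (simp add: unip_transfer_add unip_transfer_mult unip_inv_minor)
    have "unip_transfer (g * x_var i * (x_prod A * y_prod B)) - unip_transfer (g * x_var i *
      (x_prod A1 * y_prod (add_mset j B1))) \<in> minor_ideal"
      using add.prems by (intro add.IH) (simp_all add: A1 B1)
    then have "unip_transfer (g * x_var i * (x_prod A * y_prod B)) - unip_transfer (g * x_var i *
      (x_prod A1 * y_prod (add_mset j B1)))
       - minor j i * unip_transfer (g * (x_prod A1 * y_prod B1)) \<in> minor_ideal"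
      by (rule minor_ideal_diff[OF _ minor_ideal.minor[OF unip_transfer_unip_inv]])
    moreover have e1: "g * (x_prod (add_mset i A) * y_prod B) = g * x_var i * (x_prod A * y_prod B)"
      by (simp only: x_prod_simps mult_ac)
    ultimately show ?thesis unfolding eq e1 diff_diff_eq by blast
  qed
qed

lemma shift_y_prod_expand:
  "\<exists>e. (\<forall>t. shift t (y_prod B :: (nat \<times> 2, 'a) mpoly) = (\<Sum>k\<le>size B. const_poly (t ^ k) * e k)) \<and> e
    (size B) = x_prod B"
proof (induction B)
  case empty
  show ?case by (rule exI[of _ "\<lambda>_. 1"]) (simp add: act.hom_1)
next
  case (add i B)
  then obtain e :: "nat \<Rightarrow> (nat \<times> 2, 'a) mpoly" where e: "\<And>t. shift t (y_prod B) =
    (\<Sum>k\<le>size B. const_poly (t ^ k) * e k)"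
    "e (size B) = x_prod B" by blast
  let ?n = "size B"
  define e' where "e' k = (if k \<le> ?n then y_var i * e k else 0) + (if k = 0 then 0 else x_var i *
    e (k - 1))" for k
  have "shift t (y_prod (add_mset i B)) = (\<Sum>k\<le>Suc ?n. const_poly (t ^ k) * e' k)" for t
  proof -
    have A: "(\<Sum>k\<le>Suc ?n. const_poly (t ^ k) * (if k \<le> ?n then y_var i * e k else 0)) =
      y_var i * (\<Sum>k\<le>?n. const_poly (t ^ k) * e k)"
      by (simp add: sum_distrib_left mult.left_commute)
    have "(\<Sum>k\<le>Suc ?n. const_poly (t ^ k) * (if k = 0 then 0 else x_var i * e (k - 1))) =
      (\<Sum>k\<le>?n. const_poly (t ^ Suc k) * (x_var i * e k))"
      by (subst sum.atMost_Suc_shift) simp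
    also have "\<dots> = const_poly t * x_var i * (\<Sum>k\<le>?n. const_poly (t ^ k) * e k)"
      by (simp add: sum_distrib_left const_poly_mult mult_ac)
    finally have "(\<Sum>k\<le>Suc ?n. const_poly (t ^ k) * e' k) =
      (y_var i + const_poly t * x_var i) * (\<Sum>k\<le>?n. const_poly (t ^ k) * e k)"
      unfolding e'_def distrib_left sum.distrib A distrib_right by simp
    then show ?thesis using e(1)[of t] by (simp add: act.hom_mult add.commute)
  qed
  moreover have "e' (Suc ?n) = x_prod (add_mset i B)" by (simp add: e'_def e)
  ultimately show ?case unfolding size_add_mset by blast
qed

text \<open>Expanded in powers of the shift parameter, the transfer involves only power sums over
  the prime field, and up to degree p - 1 only the one of exponent p - 1 is nonzero.\<close>

lemma unip_transfer_y_prod: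
  assumes "size B \<le> p - 1"
  shows "unip_transfer (y_prod B) = (if size B = p - 1 then - x_prod B else 0)"
proof -
  obtain e :: "nat \<Rightarrow> (nat \<times> 2, 'a) mpoly" where e: "\<And>t. shift t (y_prod B) =
    (\<Sum>k\<le>size B. const_poly (t ^ k) * e k)"
    "e (size B) = x_prod B" using shift_y_prod_expand by blast
  have "unip_transfer (y_prod B) = (\<Sum>k\<le>size B. const_poly (\<Sum>t\<in>Fp. t ^ k) * e k)"
    unfolding unip_transfer_def e(1) by (subst sum.swap) (simp add: const_poly_sum
      sum_distrib_right)
  also have "\<dots> = (\<Sum>k\<le>size B. if k = p - 1 then - e k else 0)"
    using assms by (intro sum.cong refl) (auto simp: power_sum_Fp const_poly_uminus)
  also have "\<dots> = (if size B = p - 1 then - x_prod B else 0)"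
    using assms e(2) by auto
  finally show ?thesis .
qed

lemma mset_interpolate:
  assumes "M \<subseteq># N" "size M \<le> n" "n \<le> size N"
  shows "\<exists>M'. M \<subseteq># M' \<and> M' \<subseteq># N \<and> size M' = n"
  using assms(2,3)
proof (induction n rule: dec_induct)
  case base
  then show ?case using assms(1) by blast
next
  case (step n)
  then obtain M' where M': "M \<subseteq># M'" "M' \<subseteq># N" "size M' = n" by auto
  then have "N - M' \<noteq> {#}" using step.prems by (metis Diff_eq_empty_iff_mset size_mset_mono
    not_less_eq_eq)
  then obtain x where "x \<in># N - M'" by blast
  then have "add_mset x M' \<subseteq># N" using M'(2)
    by (metis insert_subset_eq_iff mset_subset_eq_insertD subset_mset.add_diff_inverse
      subset_mset.le_add_same_cancel1 union_mset_add_mset_right add_mset_add_single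
        mset_subset_eq_single mset_subset_eq_mono_add_left_cancel)
  then show ?case using M'(1,3)
    by (intro exI[of _ "add_mset x M'"]) (auto intro: subset_mset.order_trans)
qed

text \<open>Induction on the number of y-factors. With at least p of them, swapping collects y_i^p =
  N_i + x_i^{p-1} y_i. The norm is annihilated by an x-factor, for which A has to be nonempty, and
  the other term has p - 1 fewer y-factors. One y_i survives, so B stays nonempty and keeps its size
  modulo p - 1.\<close>

lemma unip_transfer_x_prod_y_prod:
  assumes "A \<noteq> {#}" "p \<le> count (A + B) i"
  shows "unip_transfer (x_prod A * y_prod B) - (if B \<noteq> {#} \<and> (p - 1) dvd size B then - x_prod
    (A + B) else 0) \<in> minor_ideal"
  using assms
proof (induction "size B" arbitrary: A B rule: less_induct)
  case less
  show ?case
  proof (cases "size B \<le> p - 1")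
    case True
    have "(p - 1) dvd size B \<longleftrightarrow> size B = 0 \<or> size B = p - 1"
      using True dvd_imp_le[of "p - 1" "size B"] by (cases "size B = 0") auto
    then have "(B \<noteq> {#} \<and> (p - 1) dvd size B) \<longleftrightarrow> size B = p - 1"
      using p_gt_1 by auto
    then have "unip_transfer (x_prod A * y_prod B) = (if B \<noteq> {#} \<and> (p - 1) dvd size B then -
      x_prod (A + B) else 0)"
      using unip_transfer_y_prod[OF True] by (simp add: unip_transfer_mult unip_inv_x_prod)
    then show ?thesis by (simp add: minor_ideal.zero)
  next
    case False
    have "replicate_mset p i \<subseteq># A + B"
      using less.prems(2) unfolding count_le_replicate_mset_subset_eq .
    moreover have "size (replicate_mset p i) \<le> size B" using False by simp
    ultimately obtain B' where B': "replicate_mset p i \<subseteq># B'" "B' \<subseteq># A + B" "size B' = size B"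
      using mset_interpolate[of "replicate_mset p i" "A + B" "size B"] by fastforce
    then obtain B2 where B2: "B' = replicate_mset p i + B2" by (metis subset_mset.add_diff_inverse)
    obtain A' where A': "A + B = A' + B'" using B'(2) by (metis subset_mset.add_diff_inverse
      add.commute)
    have sA: "size A = size A'" using arg_cong[OF A', of size] B'(3) by simp
    then have A'0: "A' \<noteq> {#}" using less.prems(1) by (metis size_eq_0_iff_empty)
    let ?A = "A' + replicate_mset (p - 1) i" and ?B = "add_mset i B2"
    have tot: "?A + ?B = A + B"
      unfolding A' B2 using p_pos by (cases p) (simp_all add: ac_simps)
    have sB: "size B = size ?B + (p - 1)"
      using B'(3) p_pos unfolding B2 by simp
    have 1: "unip_transfer (x_prod A * y_prod B) - unip_transfer (x_prod A' * y_prod B') \<in>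
      minor_ideal"
      using swap_minor_ideal[OF sA A', of 1] by simp
    have "x_prod A' * y_prod B' = x_prod A' * norm_y i * y_prod B2 + x_prod ?A * y_prod ?B"
      unfolding B2 by (simp add: y_prod_replicate x_prod_replicate y_power_p algebra_simps)
    then have 2: "unip_transfer (x_prod A' * y_prod B') = x_prod A' * norm_prod {#i#} *
      unip_transfer (y_prod B2) + unip_transfer (x_prod ?A * y_prod ?B)"
      by (simp add: unip_transfer_add unip_transfer_mult unip_inv_mult unip_inv_x_prod
        unip_inv_norm_y)
    have 3: "x_prod A' * norm_prod {#i#} * unip_transfer (y_prod B2) \<in> minor_ideal"
      using A'0 by (intro minor_ideal_x_prod_norm_prod) auto
    have 4: "unip_transfer (x_prod ?A * y_prod ?B) - (if ?B \<noteq> {#} \<and> (p - 1) dvd size ?B then -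
      x_prod (?A + ?B) else 0) \<in> minor_ideal"
    proof (rule less.hyps)
      show "size ?B < size B" using sB p_gt_1 by simp
      show "?A \<noteq> {#}" using A'0 by simp
      show "p \<le> count (?A + ?B) i" unfolding tot by (rule less.prems(2))
    qed
    have "(?B \<noteq> {#} \<and> (p - 1) dvd size ?B) \<longleftrightarrow> (B \<noteq> {#} \<and> (p - 1) dvd size B)"
    proof -
      have "B \<noteq> {#}" using sB by auto
      moreover have "(p - 1) dvd size B \<longleftrightarrow> (p - 1) dvd size ?B" unfolding sB
        by (rule dvd_add_left_iff) simp
      ultimately show ?thesis by simp
    qed
    then have 5: "unip_transfer (x_prod ?A * y_prod ?B) - (if B \<noteq> {#} \<and> (p - 1) dvd size B then -
      x_prod (A + B) else 0) \<in> minor_ideal"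
      using 4 unfolding tot by simp
    have "unip_transfer (x_prod A * y_prod B) - (if B \<noteq> {#} \<and> (p - 1) dvd size B then - x_prod
      (A + B) else 0) =
      (unip_transfer (x_prod A * y_prod B) - unip_transfer (x_prod A' * y_prod B')) + (x_prod A' *
        norm_prod {#i#} * unip_transfer (y_prod B2) +
       (unip_transfer (x_prod ?A * y_prod ?B) - (if B \<noteq> {#} \<and> (p - 1) dvd size B then - x_prod
         (A + B) else 0)))"
      unfolding 2 by (simp only: add_diff_eq diff_add_cancel)
    also have "\<dots> \<in> minor_ideal" by (intro minor_ideal.add 1 3 5)
    finally show ?thesis .
  qed
qed

text \<open>The image of \<open>norm_prod C\<close> under x -> y, y -> -x.\<close>

definition conj_prod :: "nat multiset \<Rightarrow> (nat \<times> 2, 'a) mpoly" where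
  "conj_prod C = (\<Prod>i\<in>#C. x_var i * y_var i ^ (p - 1) - x_var i ^ p)"

text \<open>Expand the product. By the previous lemma every term with y-factors transfers to its
  sign times -x^T, where T is the common total multiset, and a term without them to 0. The signs add
  up to 0 unless C is empty; the term without y-factors occurs only for empty B and has sign
  (-1)^(size C).\<close>

lemma unip_transfer_x_prod_y_prod_conj_prod:
  assumes "A \<noteq> {#} \<or> C \<noteq> {#}" "(p - 1) dvd size B" "p \<le> count (A + B + repeat_mset p C) i"
  shows "unip_transfer (x_prod A * y_prod B * conj_prod C) -
    const_poly ((if B = {#} then (-1) ^ size C else 0) - (if C = {#} then 1 else 0)) *
      x_prod (A + B + repeat_mset p C) \<in> minor_ideal"
  using assms
proof (induction C arbitrary: A B)
  case empty
  then have "unip_transfer (x_prod A * y_prod B) - (if B \<noteq> {#} \<and> (p - 1) dvd size B then - x_prod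
    (A + B) else 0) \<in> minor_ideal"
    by (intro unip_transfer_x_prod_y_prod[of A B i]) simp_all
  then show ?case using empty by (auto simp: conj_prod_def const_poly_uminus split: if_splits)
next
  case (add j C)
  let ?T = "A + B + repeat_mset p (add_mset j C)"
  let ?A1 = "add_mset j A" and ?B1 = "B + replicate_mset (p - 1) j" and ?A2 = "A + replicate_mset
    p j"
  have B1: "?B1 \<noteq> {#}" and A2: "?A2 \<noteq> {#}" using p_gt_1 by (auto simp: replicate_mset_eq_empty_iff)
  have t1: "?A1 + ?B1 + repeat_mset p C = ?T"
    using p_pos by (cases p) (simp_all add: ac_simps)
  have t2: "?A2 + B + repeat_mset p C = ?T"
    by (simp add: ac_simps)
  have 1: "unip_transfer (x_prod ?A1 * y_prod ?B1 * conj_prod C) -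
    const_poly ((if ?B1 = {#} then (-1) ^ size C else 0) - (if C = {#} then 1 else 0)) *
      x_prod (?A1 + ?B1 + repeat_mset p C) \<in> minor_ideal"
    by (rule add.IH) (use add.prems in \<open>simp_all only: t1\<close>, simp_all)
  have 2: "unip_transfer (x_prod ?A2 * y_prod B * conj_prod C) -
    const_poly ((if B = {#} then (-1) ^ size C else 0) - (if C = {#} then 1 else 0)) *
      x_prod (?A2 + B + repeat_mset p C) \<in> minor_ideal"
    by (rule add.IH) (use add.prems A2 in \<open>simp_all only: t2\<close>, simp_all)
  have "x_prod A * y_prod B * conj_prod (add_mset j C) = x_prod ?A1 * y_prod ?B1 * conj_prod C -
    x_prod ?A2 * y_prod B * conj_prod C"
    by (simp add: conj_prod_def x_prod_replicate y_prod_replicate algebra_simps)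
  then have h: "unip_transfer (x_prod A * y_prod B * conj_prod (add_mset j C)) =
    unip_transfer (x_prod ?A1 * y_prod ?B1 * conj_prod C) - unip_transfer (x_prod ?A2 * y_prod B *
      conj_prod C)"
    by (simp only: unip_transfer_diff)
  define k1 k2 :: 'a where "k1 = 0 - (if C = {#} then 1 else 0)"
    and "k2 = (if B = {#} then (-1) ^ size C else 0) - (if C = {#} then 1 else 0)"
  have k: "(if B = {#} then (-1) ^ size (add_mset j C) else 0) - (if add_mset j C =
    {#} then 1 else 0) = k1 - k2"
    by (simp add: k1_def k2_def)
  have "unip_transfer (x_prod A * y_prod B * conj_prod (add_mset j C)) - const_poly (k1 - k2) *
    x_prod ?T =
    (unip_transfer (x_prod ?A1 * y_prod ?B1 * conj_prod C) - const_poly k1 * x_prod ?T) -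
      (unip_transfer (x_prod ?A2 * y_prod B * conj_prod C) - const_poly k2 * x_prod ?T)"
    unfolding h const_poly_diff by (simp only: left_diff_distrib) (simp only: algebra_simps)
  also have "\<dots> \<in> minor_ideal"
  proof (rule minor_ideal_diff)
    show "unip_transfer (x_prod ?A1 * y_prod ?B1 * conj_prod C) - const_poly k1 * x_prod ?T \<in>
      minor_ideal"
      using 1 unfolding t1 k1_def if_not_P[OF B1] .
    show "unip_transfer (x_prod ?A2 * y_prod B * conj_prod C) - const_poly k2 * x_prod ?T \<in>
      minor_ideal"
      using 2 unfolding t2 k2_def .
  qed
  finally show ?case unfolding k .
qed

section \<open>Relative transfers of products of norms\<close>

lemma row_act_norm_y_0:
  assumes "a \<in> Fp" "a \<noteq> 0"
  shows "row_act (a, 0) (norm_y i) = const_poly (1 / a) * norm_y i"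
  using assms fermat_Fp[OF assms]
  by (simp add: row_act_def norm_y_def act.hom_simps power_mult_distrib const_power_p algebra_simps
      flip: const_poly_power)

text \<open>Writing a x_i + b y_i as b (y_i + (a/b) x_i), Fermat's theorem removes b^{p-1}; what
  remains is the conjugate norm at the shifted y_i.\<close>

lemma row_act_norm_y:
  assumes "a \<in> Fp" "b \<in> Fp" "b \<noteq> 0"
  shows "row_act (a, b) (norm_y i) = const_poly (1 / b) * shift (a / b) (x_var i * y_var i ^
    (p - 1) - x_var i ^ p)"
proof -
  have y: "const_poly a * x_var i + const_poly b * y_var i = const_poly b * (const_poly (a / b) *
    x_var i + y_var i :: (nat \<times> 2, 'a) mpoly)"
    using assms(3) by (simp add: distrib_left mult.assoc[symmetric] flip: const_poly_mult)
  have bp: "(const_poly b :: (nat \<times> 2, 'a) mpoly) ^ (p - 1) = 1"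
    using fermat_Fp[OF assms(2,3)] by (simp flip: const_poly_power)
  have mb: "(const_poly (- 1 / b) :: (nat \<times> 2, 'a) mpoly) ^ p = - const_poly (1 / b)"
    using const_power_p[of "- 1 / b"] assms by (simp add: const_poly_uminus)
  have "row_act (a, b) (norm_y i) = (const_poly (- 1 / b) * x_var i) ^ p -
     (const_poly a * x_var i + const_poly b * y_var i) ^ (p - 1) * (const_poly (- 1 / b) * x_var i)"
    using assms(3) by (simp add: row_act_def norm_y_def act.hom_simps)
  also have "\<dots> = - const_poly (1 / b) * x_var i ^ p -
     (const_poly (a / b) * x_var i + y_var i) ^ (p - 1) * (const_poly (- 1 / b) * x_var i)"
    unfolding y power_mult_distrib bp mb by simp
  also have "\<dots> = const_poly (1 / b) * shift (a / b) (x_var i * y_var i ^ (p - 1) - x_var i ^ p)"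
    by (simp add: act.hom_simps const_poly_uminus algebra_simps)
  finally show ?thesis .
qed

lemma row_act_norm_prod_0:
  assumes "a \<in> Fp" "a \<noteq> 0"
  shows "row_act (a, 0) (norm_prod C) = const_poly ((1 / a) ^ size C) * norm_prod C"
  by (induction C)
    (simp_all add: row_act_mult row_act_norm_y_0[OF assms] row_act_const[of _ 1,
      simplified] const_poly_mult del: times_divide_eq_left divide_divide_eq_left)

lemma row_act_norm_prod:
  assumes "a \<in> Fp" "b \<in> Fp" "b \<noteq> 0"
  shows "row_act (a, b) (norm_prod C) = const_poly ((1 / b) ^ size C) * shift (a / b) (conj_prod C)"
proof (induction C)
  case empty
  show ?case by (simp add: row_act_const[of _ 1, simplified] conj_prod_def act.hom_1)
next
  case (add i C)
  have "row_act (a, b) (norm_prod (add_mset i C)) =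
     const_poly (1 / b) * shift (a / b) (x_var i * y_var i ^ (p - 1) - x_var i ^ p) *
     (const_poly ((1 / b) ^ size C) * shift (a / b) (conj_prod C))"
    unfolding norm_prod_simps row_act_mult add row_act_norm_y[OF assms] ..
  also have "\<dots> = const_poly (1 / b * (1 / b) ^ size C) *
     (shift (a / b) (x_var i * y_var i ^ (p - 1) - x_var i ^ p) * shift (a / b) (conj_prod C))"
    unfolding const_poly_mult by (simp only: mult_ac)
  also have "\<dots> = const_poly ((1 / b) ^ size (add_mset i C)) * shift (a / b)
    (conj_prod (add_mset i C))"
    unfolding act.hom_mult[symmetric] by (simp add: conj_prod_def)
  finally show ?case .
qed

lemma of_nat_p1: "of_nat (p - 1) = (- 1 :: (nat \<times> 2, 'a) mpoly)"
proof -
  have "(of_nat (p - 1) :: 'a) = of_nat p - of_nat 1" using p_pos by (intro of_nat_diff) simp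
  then have "(of_nat (p - 1) :: 'a) = - 1" by simp
  moreover have "of_nat (p - 1) = (const_poly (of_nat (p - 1) :: 'a) :: (nat \<times> 2, 'a) mpoly)"
    by (simp only: const_poly_of_nat)
  ultimately show ?thesis by (simp only: const_poly_uminus const_poly_1)
qed

text \<open>Having p - 1 norms makes all scalars trivial by Fermat's theorem. The p - 1 rows (a, 0)
  then contribute -N^C. For each of the p - 1 nonzero b, the rows (a, b) run through all shifts of
  the conjugate product.\<close>

lemma rel_transfer_norm_prod:
  assumes C: "size C = p - 1"
  shows "rel_transfer (norm_prod C) = - (norm_prod C + unip_transfer (conj_prod C))"
proof -
  let ?F = "Fp - {0}"
  have pow: "(1 / a) ^ size C = 1" if "a \<in> ?F" for a
    using that fermat_Fp[of "1 / a"] by (simp add: C)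
  have nonzero_rows: "nonzero_rows = ?F \<times> {0} \<union> Fp \<times> ?F" by (auto simp: nonzero_rows_def)
  have "rel_transfer (norm_prod C) = (\<Sum>r\<in>?F \<times> {0}. row_act r (norm_prod C)) + (\<Sum>r\<in>Fp \<times> ?F. row_act
    r (norm_prod C))"
    unfolding rel_transfer_def nonzero_rows by (rule sum.union_disjoint) auto
  also have "(\<Sum>r\<in>?F \<times> {0}. row_act r (norm_prod C)) = (\<Sum>r\<in>?F \<times> {0 :: 'a}. norm_prod C)"
  proof (intro sum.cong refl)
    fix r assume "r \<in> ?F \<times> {0 :: 'a}"
    then obtain a where a: "a \<in> ?F" "r = (a, 0)" by auto
    then show "row_act r (norm_prod C) = norm_prod C" using row_act_norm_prod_0[of a C] pow[of a]
      by simp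
  qed
  also have "\<dots> = - norm_prod C"
    using of_nat_p1 by (simp add: card_cartesian_product card_Diff_singleton card_Fp)
  also have "(\<Sum>r\<in>Fp \<times> ?F. row_act r (norm_prod C)) = (\<Sum>r\<in>Fp \<times> ?F. shift (fst r / snd r)
    (conj_prod C))"
  proof (intro sum.cong refl)
    fix r assume "r \<in> Fp \<times> ?F"
    then obtain a b where ab: "a \<in> Fp" "b \<in> ?F" "r = (a, b)" by auto
    then show "row_act r (norm_prod C) = shift (fst r / snd r) (conj_prod C)"
      using row_act_norm_prod[of a b C] pow[of b] by simp
  qed
  also have "\<dots> = (\<Sum>a\<in>Fp. \<Sum>b\<in>?F. shift (a / b) (conj_prod C))"
    by (simp add: sum.cartesian_product case_prod_beta)
  also have "\<dots> = (\<Sum>b\<in>?F. \<Sum>a\<in>Fp. shift (a / b) (conj_prod C))"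
    by (rule sum.swap)
  also have "\<dots> = (\<Sum>b\<in>?F. unip_transfer (conj_prod C))"
  proof (rule sum.cong[OF refl])
    fix b assume b: "b \<in> ?F"
    show "(\<Sum>a\<in>Fp. shift (a / b) (conj_prod C)) = unip_transfer (conj_prod C)"
      unfolding unip_transfer_def
      by (rule sum.reindex_bij_witness[where i = "\<lambda>t. t * b" and j = "\<lambda>a. a / b"]) (use b in auto)
  qed
  also have "\<dots> = - unip_transfer (conj_prod C)"
    using of_nat_p1 by (simp add: card_Diff_singleton card_Fp)
  finally show ?thesis by simp
qed

text \<open>
  The relative transfer of a product of $p - 1$ norms is, up to sign, a polarized Dickson invariant.
\<close>

lemma dickson_relation:
  assumes C: "size C = p - 1"
  shows "norm_prod C + x_prod (repeat_mset p C) + rel_transfer (norm_prod C) \<in> minor_ideal"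
proof -
  have C0: "C \<noteq> {#}" using C p_gt_1 by auto
  then obtain i where i: "i \<in># C" by blast
  then have "p \<le> count ({#} + {#} + repeat_mset p C) i" by (simp add: count_repeat_mset)
  then have "unip_transfer (x_prod {#} * y_prod {#} * conj_prod C) -
    const_poly ((if {#} = ({#} :: nat multiset) then (-1) ^ size C else 0) - (if C =
      {#} then 1 else 0)) *
      x_prod ({#} + {#} + repeat_mset p C) \<in> minor_ideal"
    using C0 by (intro unip_transfer_x_prod_y_prod_conj_prod) simp_all
  then have "unip_transfer (conj_prod C) - x_prod (repeat_mset p C) \<in> minor_ideal"
    using C0 minus_one_power_p1 by (simp add: C)
  from minor_ideal_uminus[OF this] show ?thesis by (simp add: rel_transfer_norm_prod[OF C])
qed

end

subsection \<open>The upper bound\<close>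

lemma matrix_inv_2:
  fixes g :: "'a::field^2^2"
  assumes "det g = 1"
  shows "matrix_inv g = vector [vector [g $ 2 $ 2, - g $ 1 $ 2], vector [- g $ 2 $ 1, g $ 1 $ 1]]"
proof -
  let ?h = "vector [vector [g $ 2 $ 2, - g $ 1 $ 2], vector [- g $ 2 $ 1, g $ 1 $ 1]] :: 'a^2^2"
  have d: "g $ 1 $ 1 * g $ 2 $ 2 - g $ 1 $ 2 * g $ 2 $ 1 = 1" using assms by (simp add: det_2)
  have gh: "g ** ?h = mat 1"
    using d by (simp add: vec_eq_iff forall_2 matrix_matrix_mult_def sum_2 mat_def algebra_simps)
  then have hg: "?h ** g = mat 1" by (simp add: matrix_left_right_inverse)
  have inv: "g ** matrix_inv g = mat 1 \<and> matrix_inv g ** g = mat 1"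
    unfolding matrix_inv_def by (rule someI[of _ ?h]) (simp add: gh hg)
  have "matrix_inv g = matrix_inv g ** (g ** ?h)" by (simp only: gh matrix_mul_rid)
  also have "\<dots> = (matrix_inv g ** g) ** ?h" by (rule matrix_mul_assoc)
  also have "\<dots> = ?h" using inv by (simp only: matrix_mul_lid)
  finally show ?thesis .
qed

lemma diag_action_act:
  assumes "det g = 1"
  shows "diag_action g = act (g $ 2 $ 2) (- g $ 1 $ 2) (- g $ 2 $ 1) (g $ 1 $ 1)"
proof -
  have "(\<lambda>(i, k). \<Sum>l\<in>UNIV. const_poly (matrix_inv g $ k $ l) * var_poly (i, l)) =
    (\<lambda>(i, k). if k = 1 then const_poly (g $ 2 $ 2) * x_var i + const_poly (- g $ 1 $ 2) * y_var i
     else const_poly (- g $ 2 $ 1) * x_var i + const_poly (g $ 1 $ 1) * y_var i)"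
  proof (rule ext, clarify)
    fix i :: nat and k :: 2
    have "k = 1 \<or> k = 2" by (rule exhaust_2)
    then show "(\<Sum>l\<in>UNIV. const_poly (matrix_inv g $ k $ l) * var_poly (i, l)) =
      (if k = 1 then const_poly (g $ 2 $ 2) * x_var i + const_poly (- g $ 1 $ 2) * y_var i
       else const_poly (- g $ 2 $ 1) * x_var i + const_poly (g $ 1 $ 1) * y_var i)"
      by (elim disjE) (simp_all add: matrix_inv_2[OF assms] sum_2)
  qed
  then show ?thesis unfolding diag_action_def act_def by simp
qed

lemma poly_ring_add: "f \<in> poly_ring_mV2 m \<Longrightarrow> g \<in> poly_ring_mV2 m \<Longrightarrow> f + g \<in> poly_ring_mV2 m"
  using Poly_Mapping.keys_add[of f g] by (auto simp: poly_ring_mV2_def)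

lemma poly_ring_mult:
  assumes "f \<in> poly_ring_mV2 m" "g \<in> poly_ring_mV2 m"
  shows "f * g \<in> poly_ring_mV2 m"
  unfolding poly_ring_mV2_def
proof (rule CollectI, rule ballI)
  fix t assume "t \<in> Poly_Mapping.keys (f * g)"
  then obtain r s where "t = r + s" "r \<in> Poly_Mapping.keys f" "s \<in> Poly_Mapping.keys g"
    using subsetD[OF keys_mult] by blast
  then show "Poly_Mapping.keys t \<subseteq> {..<m} \<times> UNIV"
    using assms unfolding poly_ring_mV2_def by (simp add: keys_nat_add)
qed

lemma poly_ring_const: "const_poly c \<in> poly_ring_mV2 m"
  by (simp add: poly_ring_mV2_def const_poly_def)

lemma poly_ring_var: "i < m \<Longrightarrow> var_poly (i, k) \<in> poly_ring_mV2 m"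
  by (simp add: poly_ring_mV2_def var_poly_def)

lemma poly_ring_part: "f \<in> poly_ring_mV2 m \<Longrightarrow> weight_part w d f \<in> poly_ring_mV2 m"
  using keys_weight_part[of w d f] by (auto simp: poly_ring_mV2_def)

text \<open>A retraction onto the ring of m copies that commutes with the group and with taking
  degree parts.\<close>

definition restrict_copies :: "nat \<Rightarrow> (nat \<times> 2, 'a::field) mpoly \<Rightarrow> (nat \<times> 2, 'a) mpoly" where
  "restrict_copies m = subst_poly (\<lambda>v. if fst v < m then var_poly v else 0)"

lemma alg_hom_restrict: "alg_hom (restrict_copies m)"
  unfolding restrict_copies_def by (rule alg_hom_subst)

interpretation restrict: alg_hom "restrict_copies m" for m
  by (rule alg_hom_restrict)

lemma restrict_var [simp]: "restrict_copies m (var_poly (i, k)) = (if i < m then var_poly (i, k)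
  else 0)"
  by (simp add: restrict_copies_def)

lemma restrict_in_ring: "restrict_copies m f \<in> poly_ring_mV2 m"
proof (induction f rule: mpoly_alg_induct)
  case (var v)
  then show ?case using poly_ring_const[of 0 m] by (cases v) (auto simp: poly_ring_var)
qed (auto simp: restrict.hom_simps poly_ring_add poly_ring_mult poly_ring_const)

lemma restrict_single:
  "Poly_Mapping.keys t \<subseteq> {..<m} \<times> UNIV \<Longrightarrow> restrict_copies m (Poly_Mapping.single t c) =
    Poly_Mapping.single t c"
proof (induction t rule: mono_induct)
  case zero
  then show ?case using restrict.hom_const[of m c] by (simp add: const_poly_def)
next
  case (add v t)
  then have "fst v < m" "Poly_Mapping.keys t \<subseteq> {..<m} \<times> UNIV" by (auto simp: keys_nat_add)
  then show ?case unfolding single_var_times restrict.hom_mult using add.IH by (cases v) simp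
qed

lemma restrict_ring: "f \<in> poly_ring_mV2 m \<Longrightarrow> restrict_copies m f = f"
proof -
  assume f: "f \<in> poly_ring_mV2 m"
  have "restrict_copies m f =
    (\<Sum>t\<in>Poly_Mapping.keys f. restrict_copies m (Poly_Mapping.single t (Poly_Mapping.lookup f t)))"
    by (subst (1) mpoly_monomial_sum[of f]) (rule restrict.hom_sum)
  also have "\<dots> = (\<Sum>t\<in>Poly_Mapping.keys f. Poly_Mapping.single t (Poly_Mapping.lookup f t))"
    using f by (intro sum.cong refl restrict_single) (auto simp: poly_ring_mV2_def)
  also have "\<dots> = f" by (rule mpoly_monomial_sum[symmetric])
  finally show ?thesis .
qed

lemma restrict_act: "restrict_copies m (act a b c d f) = act a b c d (restrict_copies m f)"
  by (rule alg_hom_eq_xy[OF alg_hom_comp[OF alg_hom_restrict alg_hom_act] alg_hom_comp[OF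
    alg_hom_act alg_hom_restrict]])
    (simp_all add: restrict.hom_simps act.hom_simps)

lemma restrict_part:
  "weight_part mono_degree d (restrict_copies m f) = restrict_copies m (weight_part mono_degree d
    f)"
proof (rule weight_part_alg_hom[OF alg_hom_restrict mono_degree.additive_weight_axioms
  mono_degree.additive_weight_axioms])
  fix v :: "nat \<times> 2"
  show "weight_homogeneous mono_degree (mono_degree (Poly_Mapping.single v 1)) (restrict_copies m
    (var_poly v :: (nat \<times> 2, 'a) mpoly))"
    by (cases "fst v < m")
      (simp_all only: restrict_copies_def subst_var if_True if_False weight_homogeneous_0
        mono_degree.homogeneous_var)
qed

text \<open>Greedy removal: while more than m(p - 1) elements remain, some element occurs p times.
  With \<open>size A + p\<close> on the right, the hypothesis for k bounds what remains after k - 1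
  removals.\<close>

lemma mset_pigeonhole:
  fixes A :: "nat multiset"
  assumes "set_mset A \<subseteq> {..<m}" "p * k + m * (p - 1) < size A + p" "p > 0"
  shows "\<exists>C. size C = k \<and> repeat_mset p C \<subseteq># A"
  using assms(2)
proof (induction k)
  case 0
  then show ?case by (intro exI[of _ "{#}"]) simp
next
  case (Suc k)
  then obtain C where C: "size C = k" "repeat_mset p C \<subseteq># A" by auto
  let ?D = "A - repeat_mset p C"
  have "size ?D = size A - p * k" using C by (simp add: size_Diff_submset)
  then have big: "m * (p - 1) < size ?D" using Suc.prems by simp
  have "\<exists>i. p \<le> count ?D i"
  proof (rule ccontr)
    assume "\<not> ?thesis"
    then have le: "count ?D i \<le> p - 1" for i by (metis Suc_pred' assms(3) less_Suc_eq_le not_le)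
    have "size ?D = (\<Sum>i\<in>set_mset ?D. count ?D i)" by (rule size_multiset_overloaded_eq)
    also have "\<dots> \<le> (\<Sum>i<m. count ?D i)"
      using assms(1) by (intro sum_mono2) (auto dest: in_diffD)
    also have "\<dots> \<le> (\<Sum>i<m. p - 1)" by (intro sum_mono le)
    finally show False using big by simp
  qed
  then obtain i where "p \<le> count ?D i" by blast
  then have "replicate_mset p i \<subseteq># ?D" unfolding count_le_replicate_mset_subset_eq .
  then have "repeat_mset p (add_mset i C) \<subseteq># A"
    using C(2) by (simp add: subset_mset.le_diff_conv2 add.commute)
  then show ?case using C(1) by (intro exI[of _ "add_mset i C"]) simp
qed

lemma single_x_prod_y_prod: "\<exists>A B. Poly_Mapping.single t c = const_poly c * (x_prod A * y_prod B)"
proof (induction t rule: mono_induct)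
  case zero
  show ?case by (intro exI[of _ "{#}"]) (simp add: const_poly_def)
next
  case (add v t)
  then obtain A B where AB: "Poly_Mapping.single t c = const_poly c * (x_prod A * y_prod B)" by
    blast
  obtain i k where v: "v = (i, k)" by (cases v)
  have "k = 1 \<or> k = 2" by (rule exhaust_2)
  then show ?case
  proof
    assume "k = 1"
    then show ?thesis unfolding single_var_times AB v
      by (intro exI[of _ "add_mset i A"] exI[of _ B]) (simp add: mult_ac)
  next
    assume "k = 2"
    then show ?thesis unfolding single_var_times AB v
      by (intro exI[of _ A] exI[of _ "add_mset i B"]) (simp add: mult_ac)
  qed
qed

lemma x_prod_homogeneous: "weight_homogeneous mono_degree (size A) (x_prod A)"
  unfolding x_prod_def by (rule mono_degree.homogeneous_prod_mset[of A 1 x_var,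
    unfolded mult_1_right]) (rule homogeneous_xy(3))

lemma y_prod_homogeneous: "weight_homogeneous mono_degree (size A) (y_prod A)"
  unfolding y_prod_def by (rule mono_degree.homogeneous_prod_mset[of A 1 y_var,
    unfolded mult_1_right]) (rule homogeneous_xy(4))

lemma restrict_x_prod: "restrict_copies m (x_prod A) = (if set_mset A \<subseteq> {..<m} then x_prod A else
  0)"
  by (induction A) (auto simp: restrict.hom_mult restrict.hom_1)

lemma restrict_y_prod: "restrict_copies m (y_prod A) = (if set_mset A \<subseteq> {..<m} then y_prod A else
  0)"
  by (induction A) (auto simp: restrict.hom_mult restrict.hom_1)

context prime_char
begin

lemma SL2_invariants_eq: "SL2_invariants m = poly_ring_mV2 m \<inter> SL2_inv"
proof (intro equalityI subsetI)
  fix f :: "(nat \<times> 2, 'a) mpoly"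
  assume f: "f \<in> SL2_invariants m"
  have "f \<in> SL2_inv"
  proof (rule SL2_inv_I)
    fix a b c d assume abcd: "a \<in> Fp" "b \<in> Fp" "c \<in> Fp" "d \<in> Fp" and det: "a * d - b * c = 1"
    \<comment> \<open>\<open>diag_action\<close> substitutes the inverse matrix, so g is taken to be
      the inverse of the matrix with entries a, b, c, d.\<close>
    let ?g = "vector [vector [d, - b], vector [- c, a]] :: 'a^2^2"
    have det1: "det ?g = 1" using det by (simp add: det_2 mult.commute)
    moreover have "\<forall>i j. ?g $ i $ j \<in> Fp" using abcd by (simp add: forall_2)
    ultimately have "?g \<in> SL2_prime" unfolding SL2_prime_def Fp_def by simp
    then have "diag_action ?g f = f" using f by (simp add: SL2_invariants_def)
    then show "act a b c d f = f" by (simp add: diag_action_act[OF det1])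
  qed
  then show "f \<in> poly_ring_mV2 m \<inter> SL2_inv" using f by (simp add: SL2_invariants_def)
next
  fix f :: "(nat \<times> 2, 'a) mpoly"
  assume f: "f \<in> poly_ring_mV2 m \<inter> SL2_inv"
  have "diag_action g f = f" if g: "g \<in> SL2_prime" for g
  proof -
    have det: "det g = 1" and ent: "g $ i $ j \<in> Fp" for i j
      using g by (auto simp: SL2_prime_def Fp_def)
    show ?thesis
      unfolding diag_action_act[OF det] using f ent det
      by (intro SL2_inv_act) (auto simp: det_2 mult.commute)
  qed
  then show "f \<in> SL2_invariants m" using f by (simp add: SL2_invariants_def)
qed

lemma SL2_inv_add: "f \<in> SL2_inv \<Longrightarrow> g \<in> SL2_inv \<Longrightarrow> f + g \<in> SL2_inv"
  and SL2_inv_mult: "f \<in> SL2_inv \<Longrightarrow> g \<in> SL2_inv \<Longrightarrow> f * g \<in> SL2_inv"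
  by (simp_all add: SL2_inv_def act.hom_simps)

lemma generated_subset:
  assumes "S \<subseteq> SL2_invariants m"
  shows "generated_algebra S \<subseteq> (SL2_invariants m :: (nat \<times> 2, 'a) mpoly set)"
proof
  fix f assume "f \<in> generated_algebra S"
  then show "f \<in> SL2_invariants m"
    using assms unfolding SL2_invariants_eq
    by (induction rule: generated_algebra.induct)
      (auto intro: poly_ring_add poly_ring_mult poly_ring_const SL2_inv_add SL2_inv_mult
        SL2_inv_const)
qed

lemma restrict_SL2_inv: "f \<in> SL2_inv \<Longrightarrow> restrict_copies m f \<in> SL2_invariants m"
  unfolding SL2_invariants_eq by (simp add: restrict_in_ring SL2_inv_def restrict_act[symmetric])

lemma restrict_unip_transfer: "restrict_copies m (unip_transfer f) =
  unip_transfer (restrict_copies m f)"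
  by (simp add: unip_transfer_def restrict.hom_sum restrict_act)

lemma restrict_rel_transfer: "restrict_copies m (rel_transfer f) = rel_transfer (restrict_copies m
  f)"
  unfolding rel_transfer_def restrict.hom_sum by (intro sum.cong refl) (simp add:
    row_act_def restrict_act)

lemma norm_prod_homogeneous: "weight_homogeneous mono_degree (size C * p) (norm_prod C)"
  unfolding norm_prod_def by (intro mono_degree.homogeneous_prod_mset norm_y_homogeneous)

lemma generated_closure:
  fixes S :: "(nat \<times> 2, 'a) mpoly set"
  shows "f \<in> generated_algebra S \<Longrightarrow> const_poly c * f \<in> generated_algebra S"
    and "f \<in> generated_algebra S \<Longrightarrow> g \<in> generated_algebra S \<Longrightarrow> f - g \<in> generated_algebra S"
    and "0 \<in> generated_algebra S"
proof -
  show 1: "const_poly c * f \<in> generated_algebra S" if "f \<in> generated_algebra S" for f c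
    by (intro generated_algebra.mult generated_algebra.const that)
  show "f - g \<in> generated_algebra S" if "f \<in> generated_algebra S" "g \<in> generated_algebra S"
    using generated_algebra.add[OF that(1) 1[OF that(2), of "-1"]] by (simp add: const_poly_uminus)
  show "0 \<in> generated_algebra S" using generated_algebra.const[of 0 S] by simp
qed

lemma generated_sum:
  "(\<And>x. x \<in> A \<Longrightarrow> h x \<in> generated_algebra S) \<Longrightarrow>
    sum h A \<in> generated_algebra (S :: (nat \<times> 2, 'a) mpoly set)"
  by (induction A rule: infinite_finite_induct) (auto intro: generated_algebra.add
    generated_closure)

section \<open>The induction step for a degree d beyond the bound\<close>

context
  fixes m n d :: nat and S :: "(nat \<times> 2, 'a) mpoly set"
  assumes m: "m \<ge> 2" and n1: "(p + m - 2) * (p - 1) \<le> n" and n2: "p + 1 \<le> n" and d: "n < d"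
    and S: "\<And>e f. e \<le> n \<Longrightarrow> f \<in> SL2_invariants m \<Longrightarrow> weight_homogeneous mono_degree e f \<Longrightarrow> f \<in> S"
    and IH: "\<And>e f. e < d \<Longrightarrow> f \<in> SL2_invariants m \<Longrightarrow> weight_homogeneous mono_degree e f \<Longrightarrow>
      f \<in> generated_algebra S"
begin

text \<open>Restriction and degree part are built into the condition, so that inhomogeneous elements
  in arbitrarily many copies can be handled. On a G-invariant of degree d in m copies, the condition
  says that -f lies in the algebra.\<close>

definition decomposable :: "(nat \<times> 2, 'a) mpoly set" where
  "decomposable = {q \<in> unip_inv. rel_transfer (restrict_copies m (weight_part mono_degree d q)) \<in>
    generated_algebra S}"

lemma decomposable_add: "f \<in> decomposable \<Longrightarrow> g \<in> decomposable \<Longrightarrow> f + g \<in> decomposable"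
  by (auto simp: decomposable_def weight_part_add restrict.hom_add rel_transfer_add intro:
    generated_algebra.add)

lemma decomposable_const_mult: "f \<in> decomposable \<Longrightarrow> const_poly c * f \<in> decomposable"
  by (auto simp: decomposable_def mono_degree.part_mult[OF mono_degree.homogeneous_const]
    restrict.hom_simps
      rel_transfer_mult[OF SL2_inv_const] intro: generated_closure)

lemma decomposable_uminus: "f \<in> decomposable \<Longrightarrow> - f \<in> decomposable"
  using decomposable_const_mult[of f "-1"] by (simp add: const_poly_uminus)

lemma decomposable_diff: "f \<in> decomposable \<Longrightarrow> g \<in> decomposable \<Longrightarrow> f - g \<in> decomposable"
  using decomposable_add[OF _ decomposable_uminus, of f g] by simp

text \<open>The G-invariant e leaves the relative transfer as a factor. It is itself a generator,
  and the cofactor has degree d - k < d, where the induction hypothesis applies.\<close>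

lemma decomposable_mult:
  assumes e: "e \<in> SL2_inv" "weight_homogeneous mono_degree k e" "0 < k" "k \<le> n" and q:
    "q \<in> unip_inv"
  shows "e * q \<in> decomposable"
proof -
  let ?r = "restrict_copies m"
  have re: "?r e \<in> SL2_invariants m" by (rule restrict_SL2_inv[OF e(1)])
  have "weight_homogeneous mono_degree k (?r e)"
    using e(2) unfolding weight_homogeneous_iff restrict_part by simp
  then have reS: "?r e \<in> generated_algebra S" using S[OF e(4) re] by (intro generated_algebra.gen)
  have reG: "?r e \<in> SL2_inv" using re by (simp add: SL2_invariants_eq)
  let ?q = "?r (weight_part mono_degree (d - k) q)"
  have "rel_transfer ?q = ?r (rel_transfer (weight_part mono_degree (d - k) q))"
    by (rule restrict_rel_transfer[symmetric])
  then have "rel_transfer ?q \<in> SL2_invariants m"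
    using q by (simp add: restrict_SL2_inv rel_transfer_SL2_inv unip_inv_part)
  moreover have "weight_homogeneous mono_degree (d - k) (rel_transfer ?q)"
    unfolding weight_homogeneous_iff rel_transfer_part restrict_part
    using weight_homogeneous_part[of mono_degree "d - k" q] by (simp add: weight_homogeneous_iff)
  ultimately have "rel_transfer ?q \<in> generated_algebra S" using e(3,4) d by (intro IH[of "d - k"])
    auto
  then have "rel_transfer (?r (weight_part mono_degree d (e * q))) \<in> generated_algebra S"
    using e(4) d reS
    by (simp add: mono_degree.part_mult[OF e(2)] restrict.hom_mult rel_transfer_mult[OF reG]
      generated_algebra.mult)
  then show ?thesis using e(1) q by (simp add: decomposable_def SL2_inv_unip_inv unip_inv_mult)
qed

lemma minor_ideal_decomposable: "f \<in> minor_ideal \<Longrightarrow> f \<in> decomposable"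
proof (induction rule: minor_ideal.induct)
  case zero
  then show ?case by (auto simp: decomposable_def restrict.hom_0 intro: generated_closure)
next
  case (minor q i j)
  then show ?case using n2 p_gt_1 by (intro decomposable_mult[OF minor_SL2_inv minor_homogeneous])
    auto
next
  case (frob_minor q i j)
  then show ?case using n2 by (intro decomposable_mult[OF frob_minor_SL2_inv
    frob_minor_homogeneous]) auto
next
  case (add f g)
  show ?case by (rule decomposable_add[OF add.IH])
qed

text \<open>Two copies suffice to bring the degree p(p - 1) of the polarized Dickson invariants
  within the bound.\<close>

lemma p2_le_n: "p * (p - 1) \<le> n"
  using n1 m mult_le_mono1[of p "p + m - 2" "p - 1"] by linarith

text \<open>The relative transfer in \<open>dickson_relation\<close> is an invariant of degree p(p -
  1), so it is absorbed as well: modulo decomposable elements, N^c may be exchanged for -x^{pc} in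
  front of any P-invariant.\<close>

lemma dickson_decomposable:
  assumes C: "size C = p - 1" and q: "q \<in> unip_inv"
  shows "(norm_prod C + x_prod (repeat_mset p C)) * q \<in> decomposable"
proof -
  have "rel_transfer (norm_prod C) * q \<in> decomposable"
  proof (rule decomposable_mult[OF rel_transfer_SL2_inv[OF unip_inv_norm_prod] _ _ _ q])
    show "weight_homogeneous mono_degree (p * (p - 1)) (rel_transfer (norm_prod C))"
      using norm_prod_homogeneous[of C] unfolding weight_homogeneous_iff rel_transfer_part
        by (simp add: C mult.commute)
    show "0 < p * (p - 1)" using p_gt_1 by simp
  qed (rule p2_le_n)
  moreover have "(norm_prod C + x_prod (repeat_mset p C) + rel_transfer (norm_prod C)) * q \<in>
    decomposable"
    using minor_ideal_decomposable[OF minor_ideal_mult[OF dickson_relation[OF C] q]]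
      by (simp add: mult.commute)
  ultimately have "(norm_prod C + x_prod (repeat_mset p C) + rel_transfer (norm_prod C)) * q -
    rel_transfer (norm_prod C) * q \<in> decomposable"
    by (rule decomposable_diff[rotated])
  then show ?thesis by (simp only: distrib_right add_diff_cancel_right')
qed

lemma decomposable_wrong_degree:
  assumes "q \<in> unip_inv" "weight_homogeneous mono_degree e q" "e \<noteq> d"
  shows "q \<in> decomposable"
  using assms by (simp add: decomposable_def weight_part_homogeneous restrict.hom_0
    generated_closure)

lemma decomposable_rel_transfer_0:
  assumes "q \<in> unip_inv" "rel_transfer q = 0"
  shows "q \<in> decomposable"
proof -
  have "rel_transfer (restrict_copies m (weight_part mono_degree d q)) =
    restrict_copies m (weight_part mono_degree d (rel_transfer q))"
    by (simp add: restrict_rel_transfer rel_transfer_part)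
  then show ?thesis using assms by (simp add: decomposable_def restrict.hom_0 generated_closure)
qed

lemma decomposable_restrict_0: "q \<in> unip_inv \<Longrightarrow> restrict_copies m q = 0 \<Longrightarrow> q \<in> decomposable"
  by (simp add: decomposable_def restrict_part[symmetric] generated_closure)

text \<open>Being a multiple of p - 1 beyond the bound, d is at least (p + m - 1)(p - 1). This meets
  the pigeonhole condition for p - 1 removals with nothing to spare.\<close>

lemma pigeonhole_d:
  assumes A: "set_mset A \<subseteq> {..<m}" "size A = d" and dvd: "(p - 1) dvd d"
  shows "\<exists>C. size C = p - 1 \<and> repeat_mset p C \<subseteq># A"
proof (rule mset_pigeonhole[OF A(1) _ p_pos])
  obtain k where k: "d = (p - 1) * k" using dvd by (rule dvdE)
  have "(p + m - 2) * (p - 1) < k * (p - 1)"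
    using le_less_trans[OF n1 d] unfolding k by (simp only: mult.commute)
  then have "p + m - 2 < k" by (rule mult_right_less_imp_less) simp
  then have "(p + m - 1) * (p - 1) \<le> k * (p - 1)" by (intro mult_le_mono1) simp
  then have "(p + m - 1) * (p - 1) \<le> d" by (simp add: k mult.commute)
  moreover have "p * (p - 1) + m * (p - 1) = (p + m - 1) * (p - 1) + (p - 1)"
    using p_gt_1 by (cases p) (simp_all add: algebra_simps)
  ultimately show "p * (p - 1) + m * (p - 1) < size A + p" using A(2) p_pos by linarith
qed

lemma x_prod_decomposable: "x_prod A \<in> decomposable"
proof -
  consider "size A \<noteq> d" | "\<not> set_mset A \<subseteq> {..<m}" | "\<not> (p - 1) dvd size A"
    | "size A = d" "set_mset A \<subseteq> {..<m}" "(p - 1) dvd d" by metis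
  then show ?thesis
  proof cases
    case 1
    then show ?thesis by (rule decomposable_wrong_degree[OF unip_inv_x_prod x_prod_homogeneous])
  next
    case 2
    then show ?thesis by (intro decomposable_restrict_0) (auto simp: restrict_x_prod)
  next
    case 3
    then show ?thesis by (intro decomposable_rel_transfer_0 unip_inv_x_prod rel_transfer_x_prod)
  next
    case 4
    then obtain C where C: "size C = p - 1" "repeat_mset p C \<subseteq># A" using pigeonhole_d by blast
    obtain A' where A: "A = repeat_mset p C + A'" using C(2) by (metis subset_mset.add_diff_inverse)
    \<comment> \<open>The remainder is nonempty because p(p - 1) \<le> n < d; a single x-factor in
      it annihilates the norms obtained by the exchange.\<close>
    have "A' \<noteq> {#}" using p2_le_n d 4(1) C(1) unfolding A by auto
    moreover have "C \<noteq> {#}" using C(1) p_gt_1 by auto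
    ultimately have "x_prod A' * norm_prod C * 1 \<in> minor_ideal"
      by (rule minor_ideal_x_prod_norm_prod[OF _ _ unip_inv_1])
    then have "norm_prod C * x_prod A' \<in> decomposable" by (intro minor_ideal_decomposable)
      (simp add: mult.commute)
    from decomposable_diff[OF dickson_decomposable[OF C(1) unip_inv_x_prod[of A']] this] show
      ?thesis
      by (simp add: A distrib_right)
  qed
qed

text \<open>Here the exchange runs the other way: p - 1 of the norms become x^{pc}, and a norm left
  over annihilates it.\<close>

lemma norm_prod_decomposable: "norm_prod B \<in> decomposable"
proof (cases "size B * p = d")
  case False
  then show ?thesis by (rule decomposable_wrong_degree[OF unip_inv_norm_prod norm_prod_homogeneous])
next
  case True
  then have sB: "p - 1 < size B" using p2_le_n d p_pos by (metis le_less_trans mult.commute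
    mult_less_cancel2)
  then obtain C where C: "C \<subseteq># B" "size C = p - 1"
    using mset_interpolate[of "{#}" B "p - 1"] by auto
  obtain B' where B: "B = C + B'" using C(1) by (metis subset_mset.add_diff_inverse)
  have "B' \<noteq> {#}" using sB C(2) unfolding B by auto
  moreover have "repeat_mset p C \<noteq> {#}"
    using C(2) p_gt_1 by (auto simp: repeat_mset_eq_empty_iff)
  ultimately have "x_prod (repeat_mset p C) * norm_prod B' * 1 \<in> minor_ideal"
    by (intro minor_ideal_x_prod_norm_prod unip_inv_1)
  then have "x_prod (repeat_mset p C) * norm_prod B' \<in> decomposable"
    by (intro minor_ideal_decomposable) simp
  from decomposable_diff[OF dickson_decomposable[OF C(2) unip_inv_norm_prod[of B']] this] show
    ?thesis
    by (simp add: B distrib_right)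
qed

lemma unip_transfer_homogeneous:
  "weight_homogeneous mono_degree e f \<Longrightarrow> weight_homogeneous mono_degree e (unip_transfer f)"
  by (simp add: weight_homogeneous_iff unip_transfer_part)

lemma unip_transfer_x_prod_y_prod_restrict:
  assumes "\<not> set_mset (A + B) \<subseteq> {..<m}"
  shows "unip_transfer (x_prod A * y_prod B) \<in> decomposable"
proof (rule decomposable_restrict_0[OF unip_transfer_unip_inv])
  have "restrict_copies m (x_prod A * y_prod B :: (nat \<times> 2, 'a) mpoly) = 0"
    using assms by (auto simp: restrict.hom_mult restrict_x_prod restrict_y_prod)
  then show "restrict_copies m (unip_transfer (x_prod A * y_prod B)) = 0"
    by (simp add: restrict_unip_transfer)
qed

lemma unip_transfer_x_prod_y_prod_degree:
  assumes "size (A + B) \<noteq> d"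
  shows "unip_transfer (x_prod A * y_prod B) \<in> decomposable"
  using assms
  by (intro decomposable_wrong_degree[OF unip_transfer_unip_inv unip_transfer_homogeneous[OF
    mono_degree.homogeneous_mult[OF x_prod_homogeneous y_prod_homogeneous]]]) simp

text \<open>One p-fold index is enough to evaluate the transfer as 0 or a monomial in the x_i, and d
  > n \<ge> m(p - 1) provides one without any divisibility of d.\<close>

lemma unip_transfer_decomposable_1:
  assumes A: "A \<noteq> {#}"
  shows "unip_transfer (x_prod A * y_prod B) \<in> decomposable"
proof (cases "size (A + B) = d \<and> set_mset (A + B) \<subseteq> {..<m}")
  case False
  then show ?thesis using unip_transfer_x_prod_y_prod_degree[of A B]
    unip_transfer_x_prod_y_prod_restrict[of A B] by blast
next
  case True
  have "m * (p - 1) \<le> n"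
    using n1 p_ge_2 mult_le_mono1[of m "p + m - 2" "p - 1"] by linarith
  then have "p * 1 + m * (p - 1) < size (A + B) + p" using True d by linarith
  then obtain C where C: "size C = 1" "repeat_mset p C \<subseteq># A + B"
    using mset_pigeonhole[of "A + B" m p 1] True p_pos by blast
  then obtain i where "C = {#i#}" using size_1_singleton_mset by blast
  then have "p \<le> count (A + B) i" using C(2) unfolding count_le_replicate_mset_subset_eq by simp
  from minor_ideal_decomposable[OF unip_transfer_x_prod_y_prod[OF A this]]
  have 1: "unip_transfer (x_prod A * y_prod B) - (if B \<noteq> {#} \<and> (p - 1) dvd size B then - x_prod
    (A + B) else 0) \<in> decomposable" .
  have "0 \<in> decomposable" using minor_ideal_decomposable[OF minor_ideal.zero] .
  then have "(if B \<noteq> {#} \<and> (p - 1) dvd size B then - x_prod (A + B) else 0) \<in> decomposable"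
    using decomposable_uminus[OF x_prod_decomposable[of "A + B"]] by (simp del: x_prod_simps)
  from decomposable_add[OF 1 this] show ?thesis by (simp only: diff_add_cancel)
qed

text \<open>Each y_i^p is replaced by its norm. The error carries x_i^{p-1}: it is a transfer with
  x-factors if D is empty, and otherwise it is annihilated by a norm from D.\<close>

lemma unip_transfer_decomposable_expand:
  "unip_transfer (norm_prod D * y_prod (repeat_mset p C + B)) - unip_transfer (norm_prod (D + C) *
    y_prod B) \<in> decomposable"
proof (induction C arbitrary: B D)
  case empty
  then show ?case using minor_ideal_decomposable[OF minor_ideal.zero] by simp
next
  case (add i C)
  let ?R = "repeat_mset p C + B"
  have "norm_prod D * y_prod (repeat_mset p (add_mset i C) + B) =
    norm_prod (add_mset i D) * y_prod ?R + norm_prod D * (x_prod (replicate_mset (p - 1) i) *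
      y_prod (add_mset i ?R))"
    by (simp add: x_prod_replicate y_prod_replicate y_power_p algebra_simps)
  then have eq: "unip_transfer (norm_prod D * y_prod (repeat_mset p (add_mset i C) + B)) =
    unip_transfer (norm_prod (add_mset i D) * y_prod ?R) + norm_prod D * unip_transfer
      (x_prod (replicate_mset (p - 1) i) * y_prod (add_mset i ?R))"
    by (simp only: unip_transfer_add unip_transfer_mult[OF unip_inv_norm_prod])
  have ne: "replicate_mset (p - 1) i \<noteq> {#}" using p_gt_1 by simp
  have 1: "norm_prod D * unip_transfer (x_prod (replicate_mset (p - 1) i) * y_prod (add_mset i
    ?R)) \<in> decomposable"
  proof (cases "D = {#}")
    case True
    then show ?thesis using unip_transfer_decomposable_1[OF ne, of "add_mset i ?R"] by simp
  next
    case False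
    have "x_prod (replicate_mset (p - 1) i) * norm_prod D * unip_transfer (y_prod (add_mset i ?R))
      \<in> minor_ideal"
      by (rule minor_ideal_x_prod_norm_prod[OF ne False unip_transfer_unip_inv])
    then show ?thesis by (intro minor_ideal_decomposable) (simp only: unip_transfer_mult[OF
      unip_inv_x_prod] mult_ac)
  qed
  have "unip_transfer (norm_prod (add_mset i D) * y_prod ?R) - unip_transfer
    (norm_prod (add_mset i D + C) * y_prod B) \<in> decomposable"
    by (rule add.IH)
  from decomposable_add[OF this 1] show ?case unfolding eq by (simp add: algebra_simps)
qed

lemma unip_transfer_decomposable: "unip_transfer f \<in> decomposable"
proof (induction f rule: mpoly_induct)
  case (single t c)
  obtain A B where AB: "Poly_Mapping.single t c = const_poly c * (x_prod A * y_prod B)"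
    using single_x_prod_y_prod by blast
  have "unip_transfer (x_prod A * y_prod B) \<in> decomposable"
  proof (cases "A = {#}")
    case False
    then show ?thesis by (rule unip_transfer_decomposable_1)
  next
    case A: True
    consider "size B \<noteq> d" | "\<not> set_mset B \<subseteq> {..<m}" | "\<not> (p - 1) dvd size B"
      | "size B = d" "set_mset B \<subseteq> {..<m}" "(p - 1) dvd d" by metis
    then show ?thesis
    proof cases
      case 1
      then show ?thesis using unip_transfer_x_prod_y_prod_degree[of A B] A by simp
    next
      case 2
      then show ?thesis using unip_transfer_x_prod_y_prod_restrict[of A B] A by simp
    next
      case 3
      then show ?thesis using decomposable_rel_transfer_0[OF unip_transfer_unip_inv
        rel_transfer_unip_transfer_y_prod] A by simp
    next
      case 4
      \<comment> \<open>Three exchanges: y^{pC} becomes N^C by expansion, N^C becomes -x^{pC} by the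
        Dickson relation, and the resulting transfer has x-factors.\<close>
      then obtain C where C: "size C = p - 1" "repeat_mset p C \<subseteq># B" using pigeonhole_d by blast
      obtain B' where B: "B = repeat_mset p C + B'" using C(2)
        by (metis subset_mset.add_diff_inverse)
      have ne: "repeat_mset p C \<noteq> {#}"
        using C(1) p_gt_1 by (auto simp: repeat_mset_eq_empty_iff)
      have 1: "x_prod (repeat_mset p C) * unip_transfer (y_prod B') \<in> decomposable"
        using unip_transfer_decomposable_1[OF ne, of B'] by (simp add: unip_transfer_mult
          unip_inv_x_prod)
      have "(norm_prod C + x_prod (repeat_mset p C)) * unip_transfer (y_prod B') \<in> decomposable"
        by (rule dickson_decomposable[OF C(1) unip_transfer_unip_inv])
      from decomposable_diff[OF this 1] have 2: "unip_transfer (norm_prod ({#} + C) * y_prod B') \<in>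
        decomposable"
        by (simp add: distrib_right unip_transfer_mult unip_inv_norm_prod)
      have "unip_transfer (norm_prod {#} * y_prod (repeat_mset p C + B')) - unip_transfer
        (norm_prod ({#} + C) * y_prod B') \<in> decomposable"
        by (rule unip_transfer_decomposable_expand)
      from decomposable_add[OF this 2] show ?thesis by (simp add: A B)
    qed
  qed
  then show ?case unfolding AB unip_transfer_mult[OF unip_inv_const]
    by (rule decomposable_const_mult)
next
  case (add f g)
  then show ?case by (simp add: unip_transfer_add decomposable_add)
qed

lemma structured_decomposable: "f \<in> structured \<Longrightarrow> f \<in> decomposable"
proof (induction rule: structured.induct)
  case (minor q i j)
  then show ?case by (intro minor_ideal_decomposable minor_ideal.minor)
next
  case (monomial c A B)
  have "x_prod A * norm_prod B \<in> decomposable"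
  proof (cases "A = {#} \<or> B = {#}")
    case True
    then show ?thesis using x_prod_decomposable[of A] norm_prod_decomposable[of B] by auto
  next
    case False
    then show ?thesis using minor_ideal_decomposable[OF minor_ideal_x_prod_norm_prod[OF _ _
      unip_inv_1, of A B]] by simp
  qed
  then show ?case by (rule decomposable_const_mult)
next
  case (unip_transfer h)
  show ?case by (rule unip_transfer_decomposable)
next
  case (add f g)
  then show ?case by (intro decomposable_add)
qed

lemma generated_step:
  assumes f: "f \<in> SL2_invariants m" "weight_homogeneous mono_degree d f"
  shows "f \<in> generated_algebra S"
proof -
  have fG: "f \<in> SL2_inv" and fR: "f \<in> poly_ring_mV2 m" using f(1) by (auto simp: SL2_invariants_eq)
  have "f \<in> decomposable" by (intro structured_decomposable unip_inv_structured SL2_inv_unip_inv fG)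
  then have "rel_transfer (restrict_copies m (weight_part mono_degree d f)) \<in> generated_algebra S"
    by (simp add: decomposable_def)
  then have "- f \<in> generated_algebra S"
    using f(2) by (simp add: weight_homogeneous_iff restrict_ring[OF fR]
      rel_transfer_of_SL2_inv[OF fG])
  from generated_closure(1)[OF this, of "-1"] show ?thesis by (simp add: const_poly_uminus)
qed

end

text \<open>All homogeneous invariants of degree at most n serve as generators. The last assumption
  makes room for the invariants \<open>frob_minor i j\<close>; it is what raises the bound for p = m
  = 2.\<close>

theorem generated_upto:
  assumes "m \<ge> 2" "(p + m - 2) * (p - 1) \<le> n" "p + 1 \<le> n"
  shows "generated_in_degrees_upto (SL2_invariants m :: (nat \<times> 2, 'a) mpoly set) n"
proof -
  define S where "S = {f \<in> SL2_invariants m :: (nat \<times> 2, 'a) mpoly set. \<exists>e\<le>n. weight_homogeneous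
    mono_degree e f}"
  have S: "f \<in> S" if "e \<le> n" "f \<in> SL2_invariants m" "weight_homogeneous mono_degree e f" for e f
    using that by (auto simp: S_def)
  have hom: "f \<in> generated_algebra S" if "f \<in> SL2_invariants m" "weight_homogeneous mono_degree e
    f" for e f
    using that
  proof (induction e arbitrary: f rule: less_induct)
    case (less e)
    show ?case
    proof (cases "e \<le> n")
      case True
      then show ?thesis using S less.prems by (intro generated_algebra.gen) blast
    next
      case False
      then show ?thesis
        using generated_step[OF assms _ S less.IH less.prems] by simp
    qed
  qed
  have "f \<in> generated_algebra S" if f: "f \<in> SL2_invariants m" for f
  proof -
    have "weight_part mono_degree e f \<in> generated_algebra S" for e
      using f by (intro hom[OF _ weight_homogeneous_part]) (simp add: SL2_invariants_eq
        SL2_inv_part poly_ring_part)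
    then show ?thesis
      using generated_sum[of "mono_degree ` Poly_Mapping.keys f" "\<lambda>e. weight_part mono_degree e f"
        S]
      by (simp add: sum_weight_part)
  qed
  moreover have "generated_algebra S \<subseteq> SL2_invariants m"
    by (rule generated_subset) (auto simp: S_def)
  ultimately have "generated_algebra S = SL2_invariants m" by blast
  moreover have "\<forall>f\<in>S. \<exists>e\<le>n. homogeneous_of_degree e f"
    by (auto simp: S_def homogeneous_of_degree_iff)
  ultimately show ?thesis unfolding generated_in_degrees_upto_def by blast
qed

end

subsection \<open>The lower bounds\<close>

interpretation partial_deriv: hom_deriv "\<lambda>f :: ('v, 'a::comm_ring_1) mpoly. f" "partial_deriv v"
  for v
  by unfold_locales (simp_all add: partial_deriv_add partial_deriv_mult algebra_simps)

text \<open>The chain rule; both sides are derivations along \<open>act a b c d\<close>.\<close>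

lemma partial_deriv_act:
  "partial_deriv (i, 1) (act a b c d f) =
    const_poly a * act a b c d (partial_deriv (i, 1) f) + const_poly c * act a b c d
      (partial_deriv (i, 2) f)"
  "partial_deriv (i, 2) (act a b c d f) =
    const_poly b * act a b c d (partial_deriv (i, 1) f) + const_poly d * act a b c d
      (partial_deriv (i, 2) f)"
proof -
  have 1: "hom_deriv (act a b c d) (\<lambda>f. partial_deriv (i, k) (act a b c d f))" for k :: 2
    by unfold_locales
      (simp_all add: act.hom_simps partial_deriv.deriv_add partial_deriv.deriv_mult)
  have 2: "hom_deriv (act a b c d)
    (\<lambda>f. const_poly r * act a b c d (partial_deriv (i, 1) f) + const_poly s * act a b c d
      (partial_deriv (i, 2) f))" for r s
    by unfold_locales
      (simp_all add: act.hom_simps partial_deriv.deriv_add partial_deriv.deriv_mult algebra_simps)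
  show "partial_deriv (i, 1) (act a b c d f) =
    const_poly a * act a b c d (partial_deriv (i, 1) f) + const_poly c * act a b c d
      (partial_deriv (i, 2) f)"
    by (rule hom_deriv_eq_xy[OF 1 2])
      (simp_all add: partial_deriv_var partial_deriv.deriv_add partial_deriv.deriv_mult act.hom_0
        act.hom_1)
  show "partial_deriv (i, 2) (act a b c d f) =
    const_poly b * act a b c d (partial_deriv (i, 1) f) + const_poly d * act a b c d
      (partial_deriv (i, 2) f)"
    by (rule hom_deriv_eq_xy[OF 1 2])
      (simp_all add: partial_deriv_var partial_deriv.deriv_add partial_deriv.deriv_mult act.hom_0
        act.hom_1)
qed

text \<open>Restriction to the line on which only y_0 is nonzero. The shifts fix this line
  pointwise, and the torus scales it.\<close>

definition to_y0 :: "(nat \<times> 2, 'a::field) mpoly \<Rightarrow> (nat \<times> 2, 'a) mpoly" where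
  "to_y0 = subst_poly (\<lambda>v. if v = (0, 2) then y_var 0 else 0)"

lemma alg_hom_to_y0: "alg_hom to_y0"
  unfolding to_y0_def by (rule alg_hom_subst)

interpretation to_y0: alg_hom to_y0
  by (rule alg_hom_to_y0)

lemma to_y0_x [simp]: "to_y0 (x_var i) = 0"
  and to_y0_y [simp]: "to_y0 (y_var i) = (if i = 0 then y_var 0 else 0)"
  by (simp_all add: to_y0_def)

lemma to_y0_single: "\<exists>c'. to_y0 (Poly_Mapping.single t c) = const_poly c' * y_var 0 ^ mono_degree t"
proof (induction t rule: mono_induct)
  case zero
  have "to_y0 (Poly_Mapping.single 0 c) = const_poly c * y_var 0 ^ mono_degree 0"
    using to_y0.hom_const[of c] by (simp add: const_poly_def)
  then show ?case by blast
next
  case (add v t)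
  then obtain c' where c': "to_y0 (Poly_Mapping.single t c) = const_poly c' * y_var 0 ^
    mono_degree t"
    by blast
  show ?case
  proof (cases "v = (0, 2)")
    case True
    then show ?thesis unfolding single_var_times to_y0.hom_mult c'
      by (intro exI[of _ c']) (simp add: mono_degree_add algebra_simps)
  next
    case False
    then have "to_y0 (var_poly v) = (0 :: (nat \<times> 2, 'a) mpoly)" by (simp add: to_y0_def)
    then show ?thesis unfolding single_var_times to_y0.hom_mult
      by (intro exI[of _ 0]) simp
  qed
qed

lemma to_y0_homogeneous:
  assumes "weight_homogeneous mono_degree e f"
  shows "\<exists>c. to_y0 f = const_poly c * y_var 0 ^ e"
proof -
  have "\<exists>c. to_y0 (\<Sum>t\<in>T. Poly_Mapping.single t (Poly_Mapping.lookup f t)) = const_poly c * y_var 0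
    ^ e"
    if "finite T" "T \<subseteq> Poly_Mapping.keys f" for T
    using that
  proof (induction T)
    case empty
    show ?case by (rule exI[of _ 0]) (simp add: to_y0.hom_0)
  next
    case (insert t T)
    then obtain c where c: "to_y0 (\<Sum>t\<in>T. Poly_Mapping.single t (Poly_Mapping.lookup f t)) =
      const_poly c * y_var 0 ^ e"
      by blast
    have "mono_degree t = e" using insert.prems assms by (simp add: weight_homogeneous_def)
    then obtain c' where "to_y0 (Poly_Mapping.single t (Poly_Mapping.lookup f t)) =
      const_poly c' * y_var 0 ^ e"
      using to_y0_single by blast
    then have "to_y0 (\<Sum>t\<in>insert t T. Poly_Mapping.single t (Poly_Mapping.lookup f t)) =
      const_poly (c' + c) * y_var 0 ^ e"
      using insert.hyps c by (simp add: to_y0.hom_add const_poly_add distrib_right)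
    then show ?case by blast
  qed
  from this[of "Poly_Mapping.keys f"] show ?thesis using mpoly_monomial_sum[of f] by simp
qed

lemma to_y0_shift: "to_y0 (shift t f) = to_y0 f"
  by (rule alg_hom_eq_xy[OF alg_hom_comp[OF alg_hom_to_y0 alg_hom_act] alg_hom_to_y0])
    (simp_all add: to_y0.hom_simps)

lemma to_y0_torus: "to_y0 (act a 0 0 d f) = act a 0 0 d (to_y0 f)"
  by (rule alg_hom_eq_xy[OF alg_hom_comp[OF alg_hom_to_y0 alg_hom_act] alg_hom_comp[OF alg_hom_act
    alg_hom_to_y0]])
    (simp_all add: to_y0.hom_simps act.hom_simps)

lemma to_y0_partial_deriv: "to_y0 (partial_deriv (0, 2) f) = partial_deriv (0, 2) (to_y0 f)"
proof (rule hom_deriv_eq_xy[of to_y0 "\<lambda>f. to_y0 (partial_deriv (0, 2) f)" "\<lambda>f. partial_deriv (0,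
  2) (to_y0 f)"])
  show "hom_deriv to_y0 (\<lambda>f. to_y0 (partial_deriv (0, 2) f))"
    by unfold_locales (simp_all add: to_y0.hom_simps partial_deriv.deriv_add
      partial_deriv.deriv_mult)
  show "hom_deriv to_y0 (\<lambda>f. partial_deriv (0, 2) (to_y0 f))"
    by unfold_locales (simp_all add: to_y0.hom_simps partial_deriv.deriv_add
      partial_deriv.deriv_mult)
qed (simp_all add: partial_deriv_var partial_deriv.deriv_0 to_y0.hom_simps)

lemma mpoly_power_nonzero: "(f :: ('v::countable, 'a::idom) mpoly) \<noteq> 0 \<Longrightarrow> f ^ n \<noteq> 0"
  using mpoly_prod_nonzero[of "{..<n}" "\<lambda>_. f"] by simp

lemma const_mult_eq_0: "const_poly c * (f :: ('v::countable, 'a::idom) mpoly) = 0 \<Longrightarrow> f \<noteq> 0 \<Longrightarrow> c = 0"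
  using mpoly_mult_eq_0[of "const_poly c" f] by simp

lemma lookup_polarize_self:
  "Poly_Mapping.lookup (polarize i i f) t = of_nat (copy_degree i t) * Poly_Mapping.lookup f t"
proof (induction f rule: mpoly_induct)
  case (single s c)
  have "polarize i i (Poly_Mapping.single s c) = Poly_Mapping.single s (of_nat (copy_degree i s) *
    c)"
    unfolding polarize_self_single const_poly_of_nat[symmetric] by (simp only: const_poly_def
      mult_single add_0)
  then show ?case by (simp add: lookup_single_if)
next
  case (add f g)
  then show ?case by (simp add: polarize.deriv_add lookup_add algebra_simps)
qed

lemma mono_degree_eq_0: "mono_degree t = 0 \<Longrightarrow> t = 0"
  by (auto simp: mono_degree_def in_keys_iff intro!: poly_mapping_eqI)

lemma partial_deriv_linear:
  assumes "weight_homogeneous mono_degree 1 f"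
  shows "\<exists>c. partial_deriv v f = const_poly c"
proof (intro exI poly_mapping_eqI)
  fix s
  have "s = 0" if "s \<in> Poly_Mapping.keys (partial_deriv v f)"
  proof (rule mono_degree_eq_0)
    have "mono_degree (Poly_Mapping.single v 1 + s) = 1"
      using keys_partial_deriv[OF that] assms by (simp add: weight_homogeneous_def)
    then show "mono_degree s = 0" by (simp add: mono_degree_add)
  qed
  then show "Poly_Mapping.lookup (partial_deriv v f) s =
    Poly_Mapping.lookup (const_poly (Poly_Mapping.lookup (partial_deriv v f) 0)) s"
    by (cases "s = 0") (auto simp: const_poly_def lookup_single_if in_keys_iff)
qed

context prime_char
begin

text \<open>The partial derivatives in a copy are constants a and b. The shift by 1 gives a = a + b,
  and the map x -> y, y -> -x gives b = a, so both vanish.\<close>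

lemma SL2_inv_linear:
  assumes f: "f \<in> SL2_inv" "weight_homogeneous mono_degree 1 f"
  shows "f = 0"
proof (rule poly_mapping_eqI)
  fix t
  have zero: "polarize i i f = 0" for i
  proof -
    obtain a where a: "partial_deriv (i, 1) f = const_poly a" using partial_deriv_linear[OF f(2)]
      by blast
    obtain b where b: "partial_deriv (i, 2) f = const_poly b" using partial_deriv_linear[OF f(2)]
      by blast
    have "act 1 0 1 1 f = f" "act 0 1 (-1) 0 f = f" using f(1) by (auto intro: SL2_inv_act)
    then have "const_poly a = const_poly a + const_poly b" "const_poly b = const_poly a"
      using partial_deriv_act(1)[of i 1 0 1 1 f] partial_deriv_act(2)[of i 0 1 "-1" 0 f]
      by (simp_all add: a b act.hom_const)
    then show ?thesis by (simp add: polarize_def a b)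
  qed
  show "Poly_Mapping.lookup f t = Poly_Mapping.lookup 0 t"
  proof (cases "t \<in> Poly_Mapping.keys f")
    case True
    then have "mono_degree t = 1" using f(2) by (simp add: weight_homogeneous_def)
    then have "t \<noteq> 0" by auto
    then obtain v where v: "v \<in> Poly_Mapping.keys t" by (metis keys_eq_empty ex_in_conv)
    obtain i k where ik: "v = (i, k)" by (cases v)
    have "mono_degree (Poly_Mapping.single v 1 + (t - Poly_Mapping.single v 1)) = 1"
      using single_split[OF v] \<open>mono_degree t = 1\<close> by simp
    then have "t - Poly_Mapping.single v 1 = 0"
      by (intro mono_degree_eq_0) (simp add: mono_degree_add)
    then have "t = Poly_Mapping.single v 1" using single_split[OF v] by simp
    \<comment> \<open>The factor in Euler's identity is 1, so the coefficient can be recovered in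
      every characteristic.\<close>
    then have "copy_degree i t = 1" by (simp add: ik)
    then show ?thesis using lookup_polarize_self[of i f t] zero[of i] by simp
  qed (simp add: in_keys_iff)
qed

text \<open>
  Invariance under the torus gives $p - 1 \mid e$. Comparing the coefficients of $x_0 y_0^{e - 1}$
  in \<open>f\<close> and in its image under $y_i \mapsto y_i + x_i$ gives $p \mid e$.
\<close>

lemma SL2_inv_y0_degree:
  assumes f: "f \<in> SL2_inv" "weight_homogeneous mono_degree e f" and c: "to_y0 f = const_poly c *
    y_var 0 ^ e" "c \<noteq> 0"
  shows "p * (p - 1) dvd e"
proof -
  have y0: "(y_var 0 :: (nat \<times> 2, 'a) mpoly) ^ k \<noteq> 0" for k by (intro mpoly_power_nonzero) simp
  have "(p - 1) dvd e"
  proof (rule ccontr)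
    assume "\<not> (p - 1) dvd e"
    then obtain s where s: "s \<in> Fp" "s \<noteq> 0" "s ^ e \<noteq> 1" using exists_power_neq_1 by blast
    have "act s 0 0 (1 / s) f = f" using s by (intro SL2_inv_act[OF f(1)]) auto
    then have "act s 0 0 (1 / s) (const_poly c * y_var 0 ^ e) = const_poly c * y_var 0 ^ e"
      using to_y0_torus[of s "1 / s" f] by (simp add: c)
    then have "const_poly (c * (1 / s) ^ e - c) * y_var 0 ^ e = (0 :: (nat \<times> 2, 'a) mpoly)"
      unfolding act.hom_simps act_y
      by (simp add: power_mult_distrib const_poly_diff const_poly_mult const_poly_power
        algebra_simps)
    then have "c * (1 / s) ^ e - c = 0" using const_mult_eq_0 y0 by blast
    then have "(1 / s) ^ e = 1" using c(2) by simp
    then show False using s by (simp add: power_divide)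
  qed
  moreover have "p dvd e"
  proof -
    have "shift 1 f = f" using f(1) by (intro SL2_inv_act) auto
    then have "partial_deriv (0, 1) f = shift 1 (partial_deriv (0, 1) f) + shift 1 (partial_deriv
      (0, 2) f)"
      using partial_deriv_act(1)[of 0 1 0 1 1 f] by simp
    then have "to_y0 (partial_deriv (0, 1) f) = to_y0 (partial_deriv (0, 1) f) + to_y0
      (partial_deriv (0, 2) f)"
      using to_y0_shift to_y0.hom_add by metis
    then have "to_y0 (partial_deriv (0, 2) f) = 0" by simp
    then have "partial_deriv (0, 2) (const_poly c * y_var 0 ^ e) = 0"
      unfolding to_y0_partial_deriv c(1) .
    then have "const_poly (c * of_nat e) * y_var 0 ^ (e - 1) = (0 :: (nat \<times> 2, 'a) mpoly)"
      by (simp add: partial_deriv.deriv_mult partial_deriv.deriv_power partial_deriv_var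
        const_poly_mult
          const_poly_of_nat mult.assoc)
    then have "c * of_nat e = 0" using const_mult_eq_0 y0 by blast
    then have "(of_nat e :: 'a) = 0" using c(2) by simp
    then show ?thesis unfolding of_nat_eq_0_iff_char_dvd char_p .
  qed
  moreover have "coprime p (p - 1)"
    using coprime_diff_one_left_nat[OF p_pos] by (simp add: coprime_commute)
  ultimately show ?thesis by (simp add: divides_mult)
qed

text \<open>If the degrees of the generators stay below p(p - 1), every invariant restricts to a
  constant on the y_0-line. But the relative transfer of N_0^{p-1} restricts to -y_0^{p(p-1)}, since
  each conjugate norm has an x-factor and vanishes there.\<close>

lemma degree_lower_bound:
  assumes gen: "generated_in_degrees_upto (SL2_invariants 2 :: (nat \<times> 2, 'a) mpoly set) n"
  shows "p * (p - 1) \<le> n"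
proof (rule ccontr)
  assume less: "\<not> ?thesis"
  obtain S :: "(nat \<times> 2, 'a) mpoly set" where S: "\<And>f. f \<in> S \<Longrightarrow>
    \<exists>e\<le>n. weight_homogeneous mono_degree e f"
    and eq: "generated_algebra S = SL2_invariants 2"
    using gen unfolding generated_in_degrees_upto_def homogeneous_of_degree_iff by blast
  have "\<exists>c. to_y0 f = const_poly c" if "f \<in> generated_algebra S" for f
    using that
  proof (induction rule: generated_algebra.induct)
    case (gen f)
    then obtain e where e: "e \<le> n" "weight_homogeneous mono_degree e f" using S by blast
    obtain c where c: "to_y0 f = const_poly c * y_var 0 ^ e" using to_y0_homogeneous[OF e(2)] by
      blast
    have "f \<in> SL2_inv" using generated_algebra.gen[OF gen] unfolding eq SL2_invariants_eq by blast
    then have "c = 0 \<or> p * (p - 1) dvd e" using SL2_inv_y0_degree e(2) c by blast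
    then have "c = 0 \<or> e = 0" using e(1) less by (auto dest: dvd_imp_le)
    then show ?case
    proof
      assume "c = 0"
      then show ?thesis using c by (intro exI[of _ 0]) simp
    qed (use c in auto)
  next
    case (const c)
    then show ?case using to_y0.hom_const by blast
  next
    case (add f g)
    then show ?case using to_y0.hom_add const_poly_add by metis
  next
    case (mult f g)
    then show ?case using to_y0.hom_mult const_poly_mult by metis
  qed
  moreover define C where "C = replicate_mset (p - 1) (0 :: nat)"
  have C: "size C = p - 1" "set_mset C \<subseteq> {0}" by (auto simp: C_def)
  have "restrict_copies 2 (norm_prod C) = norm_prod C"
    using C(2) by (induction C) (auto simp: restrict.hom_mult restrict.hom_1 norm_y_def
      restrict.hom_diff restrict.hom_power)
  then have "rel_transfer (norm_prod C) \<in> generated_algebra S"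
    unfolding eq using restrict_SL2_inv[OF rel_transfer_SL2_inv[OF unip_inv_norm_prod], of 2 C]
      by (simp add: restrict_rel_transfer)
  ultimately obtain c where c: "to_y0 (rel_transfer (norm_prod C)) = const_poly c" by blast
  have "to_y0 (norm_y 0) = y_var 0 ^ p"
    using p_gt_1 by (simp add: norm_y_def to_y0.hom_simps power_0_left)
  then have "to_y0 (norm_prod C) = (y_var 0 ^ p) ^ (p - 1)"
    unfolding C_def by (induction "p - 1") (simp_all add: to_y0.hom_simps norm_prod_def)
  moreover have "to_y0 (conj_prod C) = 0"
  proof -
    have "C = add_mset 0 (replicate_mset (p - 2) 0)"
      using p_ge_2 unfolding C_def by (metis Suc_diff_le diff_Suc_Suc numeral_2_eq_2 One_nat_def
        replicate_mset_Suc)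
    then show ?thesis using p_pos by (simp add: conj_prod_def to_y0.hom_simps power_0_left)
  qed
  then have "to_y0 (unip_transfer (conj_prod C)) = 0" by (simp add: unip_transfer_def
    to_y0.hom_sum to_y0_shift)
  ultimately have "const_poly c = - ((y_var 0 ^ p) ^ (p - 1) :: (nat \<times> 2, 'a) mpoly)"
    using c by (simp add: rel_transfer_norm_prod[OF C(1)] to_y0.hom_simps)
  then have eq: "const_poly c = - (y_var 0 ^ (p * (p - 1)) :: (nat \<times> 2, 'a) mpoly)"
    by (simp add: power_mult)
  \<comment> \<open>The zero matrix sets all variables to 0, which separates the constant from a
    positive power of y_0.\<close>
  then have "act 0 0 0 0 (const_poly c) = - (act 0 0 0 0 (y_var 0) ^ (p * (p - 1)) ::
    (nat \<times> 2, 'a) mpoly)"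
    by (simp only: act.hom_simps)
  then have "const_poly c = (0 :: (nat \<times> 2, 'a) mpoly)"
    using p_gt_1 by (simp add: act.hom_simps power_0_left)
  then have "y_var 0 ^ (p * (p - 1)) = (0 :: (nat \<times> 2, 'a) mpoly)" using eq by simp
  then show False using mpoly_power_nonzero[of "y_var 0 :: (nat \<times> 2, 'a) mpoly"] by simp
qed

text \<open>For p = 2 the y_0-line only yields the bound 2. The witness for 3 is x_0 N_0, written as
  \<open>frob_minor 0 0\<close>, whose degree is odd.\<close>

lemma degree_lower_bound_2:
  assumes gen: "generated_in_degrees_upto (SL2_invariants 2 :: (nat \<times> 2, 'a) mpoly set) n"
    and p2: "p = 2"
  shows "p + 1 \<le> n"
proof (rule ccontr)
  assume less: "\<not> ?thesis"
  obtain S :: "(nat \<times> 2, 'a) mpoly set" where S: "\<And>f. f \<in> S \<Longrightarrow>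
    \<exists>e\<le>n. weight_homogeneous mono_degree e f"
    and eq: "generated_algebra S = SL2_invariants 2"
    using gen unfolding generated_in_degrees_upto_def homogeneous_of_degree_iff by blast
  have "\<forall>t\<in>Poly_Mapping.keys f. even (mono_degree t)" if "f \<in> generated_algebra S" for f
    using that
  proof (induction rule: generated_algebra.induct)
    case (gen f)
    then obtain e where e: "e \<le> n" "weight_homogeneous mono_degree e f" using S by blast
    have G: "f \<in> SL2_inv" using generated_algebra.gen[OF gen] unfolding eq SL2_invariants_eq by
      blast
    have "e = 0 \<or> e = 1 \<or> e = 2" using e(1) less p2 by auto
    then consider "even e" | "e = 1" by auto
    then show ?case
    proof cases
      case 1
      then show ?thesis using e(2) by (simp add: weight_homogeneous_def)
    next
      case 2
      then show ?thesis using SL2_inv_linear[OF G] e(2) by simp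
    qed
  next
    case (const c)
    then show ?case by (simp add: const_poly_def)
  next
    case (add f g)
    then show ?case using subsetD[OF Poly_Mapping.keys_add[of f g]] by blast
  next
    case (mult f g)
    show ?case
    proof
      fix t assume "t \<in> Poly_Mapping.keys (f * g)"
      then obtain r s where "t = r + s" "r \<in> Poly_Mapping.keys f" "s \<in> Poly_Mapping.keys g"
        using subsetD[OF keys_mult] by blast
      then show "even (mono_degree t)" using mult.IH by (simp add: mono_degree_add)
    qed
  qed
  moreover have "frob_minor 0 0 \<in> generated_algebra S"
  proof -
    have "restrict_copies 2 (frob_minor 0 0) = frob_minor 0 0"
      by (simp add: frob_minor_def restrict.hom_simps)
    then show ?thesis unfolding eq using restrict_SL2_inv[OF frob_minor_SL2_inv, of 2 0 0] by simp
  qed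
  ultimately have even: "\<forall>t\<in>Poly_Mapping.keys (frob_minor 0 0). even (mono_degree t)" by blast
  have "frob_minor 0 0 = x_var 0 * norm_y 0"
    by (simp add: frob_minor_def norm_y_def x_power_p algebra_simps)
  then have "frob_minor 0 0 \<noteq> 0" using mpoly_mult_eq_0[of "x_var 0" "norm_y 0"] norm_y_nonzero by
    auto
  then obtain t where t: "t \<in> Poly_Mapping.keys (frob_minor 0 0)"
    by (metis keys_eq_empty ex_in_conv)
  then have "mono_degree t = 3" using frob_minor_homogeneous[of 0 0] p2
    by (simp add: weight_homogeneous_def)
  then show False using even t by auto
qed

end

lemma noether_number_le: "generated_in_degrees_upto R n \<Longrightarrow> noether_number R \<le> enat n"
  unfolding noether_number_def by (rule Inf_lower) simp

lemma noether_number_eq: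
  assumes "generated_in_degrees_upto R n" "\<And>k. generated_in_degrees_upto R k \<Longrightarrow> n \<le> k"
  shows "noether_number R = enat n"
proof (rule antisym)
  show "noether_number R \<le> enat n" using assms(1) by (rule noether_number_le)
  show "enat n \<le> noether_number R"
    unfolding noether_number_def using assms(2) by (intro Inf_greatest) auto
qed

theorem corollary8p5:
  fixes p :: nat
  assumes "prime p" and "CHAR('a::field) = p"
  shows "(\<forall>m>2. noether_number (SL2_invariants m :: (nat \<times> 2, 'a) mpoly set)
                  \<le> enat ((p + m - 2) * (p - 1))) \<and>
         (p > 2 \<longrightarrow> noether_number (SL2_invariants 2 :: (nat \<times> 2, 'a) mpoly set)
                  = enat (p * (p - 1))) \<and>
         (p = 2 \<longrightarrow> noether_number (SL2_invariants 2 :: (nat \<times> 2, 'a) mpoly set)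
                  = enat (p + 1))"
proof (intro conjI allI impI)
  interpret prime_char p "TYPE('a)"
    using assms by unfold_locales
  show "noether_number (SL2_invariants m :: (nat \<times> 2, 'a) mpoly set) \<le> enat ((p + m - 2) * (p - 1))"
    if m: "m > 2" for m
  proof (intro noether_number_le generated_upto)
    \<comment> \<open>Three copies give \<open>p + 1 \<le> p + m - 2\<close> outright; with two
      copies it is p - 1 \<ge> 2 that makes room for the degree p + 1.\<close>
    have "(p + 1) * 1 \<le> (p + m - 2) * (p - 1)"
      using m p_gt_1 by (intro mult_le_mono) auto
    then show "p + 1 \<le> (p + m - 2) * (p - 1)" by simp
  qed (use m in auto)
  show "noether_number (SL2_invariants 2 :: (nat \<times> 2, 'a) mpoly set) = enat (p * (p - 1))"
    if p: "p > 2"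
  proof (rule noether_number_eq)
    have "p * 2 \<le> p * (p - 1)" using p by (intro mult_le_mono) auto
    then have "p + 1 \<le> p * (p - 1)" using p by linarith
    then show "generated_in_degrees_upto (SL2_invariants 2 :: (nat \<times> 2, 'a) mpoly set)
      (p * (p - 1))"
      by (intro generated_upto) simp_all
  qed (rule degree_lower_bound)
  show "noether_number (SL2_invariants 2 :: (nat \<times> 2, 'a) mpoly set) = enat (p + 1)" if p: "p = 2"
  proof (rule noether_number_eq)
    show "generated_in_degrees_upto (SL2_invariants 2 :: (nat \<times> 2, 'a) mpoly set) (p + 1)"
      using p by (intro generated_upto) simp_all
  qed (rule degree_lower_bound_2[OF _ p])
qed

end
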